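(* Let $A$ be a split-free (small) category. Then the strict $\infty$-category $\tilde A$ is isomorphic to the $\infty$-category $c_\infty N_\infty(A)$, where $N_\infty(A)$ is the Street nerve of $A$ (i.e. the usual nerve of the category $A$) and $c_\infty$ is the left adjoint of the Street nerve functor $N_\infty$ from strict $\infty$-categories to simplicial sets.
   Context: A category $A$ is split-free if it has no split monomorphisms and no split epimorphisms other than identities. Notation. $y*_jx$ denotes composition along $j$-cells in a strict $\infty$-category ($x$ first, then $y$). For parallel $1$-cells $u,v$ of an $\infty$-category $X$, $X(u,v)$ denotes the $\infty$-category whose $j$-cells are the $(j+2)$-cells of $X$ with $1$-source $u$ and $1$-target $v$. Orientals. Let $C(n)$ be the chain complex with $C(n)_p$ free abelian on the strictly increasing tuples $(i_0,\dots,i_p)$ in $[n]=\{0,\dots,n\}$, $d(i_0,\dots,i_p)=\sum_k(-1)^k(i_0,\dots,\widehat{i_k},\dots,i_p)$, augmentation $e(i)=1$, and let $C(n)_p^*$ be the submonoid generated by the basis. The $n$-th oriental $\mathcal O_n$ is the strict $\infty$-category whose $k$-cells are families $x=(x^\varepsilon_p)_{0\le p\le k,\,\varepsilon\in\{0,1\}}$ with $x^\varepsilon_p\in C(n)^*_p$, $d(x^\varepsilon_p)=x^1_{p-1}-x^0_{p-1}$ for $p>0$, $e(x^\varepsilon_0)=1$, $x^0_k=x^1_k$. The source (resp. target) of $x$ is obtained by deleting the entries of degree $k$ and replacing both entries of degree $k-1$ by $x^0_{k-1}$ (resp. $x^1_{k-1}$); identities are obtained by adding a zero column; $(x*_jy)^0_p=y^0_p$,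 $(x*_jy)^1_p=x^1_p$ for $p\le j$, and $(x*_jy)^\varepsilon_p=x^\varepsilon_p+y^\varepsilon_p$ for $p>j$. An order-preserving map $\phi\colon[m]\to[n]$ induces an $\infty$-functor $\mathcal O_\phi\colon\mathcal O_m\to\mathcal O_n$ (a tuple is sent to its image tuple, or to $0$ if that has repetitions). The Street nerve of an $\infty$-category $X$ is $N_\infty(X)_n=\mathrm{Hom}(\mathcal O_n,X)$. For a strictly increasing map $\phi\colon[m]\to[n]$ let $[\phi]$ be the $1$-cell of $\mathcal O_n$ from $\phi(0)$ to $\phi(m)$ with degree-one entry $\sum_{i=1}^m(\phi(i-1),\phi(i))$ (an identity if $m=0$), and let $[n]_{\max}=[\mathrm{id}_{[n]}]$. The $\infty$-category $\tilde A$ ($A$ split-free). - Objects: the objects of $A$. - $1$-cells $a\to a'$: tuples $(f_1,\dots,f_m)$, $m\ge0$, of composable non-identity arrows of $A$ with source of $f_1$ equal to $a$ and target of $f_m$ equal to $a'$ (if $m=0$ then $a=a'$, and the empty tuple is the identity of $a$), i.e. non-degenerate simplices of the nerve of $A$ from $a$ to $a'$. Composition of $1$-cells is concatenation. - For parallel $1$-cells $x=(f_1,\dots,f_m)$, $y=(g_1,\dots,g_n)$, $\tilde A(x,y)=\coprod_\phi\tilde A_\phi(x,y)$, where $\phi$ runs over the strictly increasing maps $\phi\colon[m]\to[n]$ with $\phi(0)=0$, $\phi(m)=n$ and $g_{\phi(i)}\cdots g_{\phi(i-1)+1}=f_i$ in $A$ for all $1\le i\le m$, and where $\tilde A_\phi(x,y)=\mathcal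 O_n([\phi],[n]_{\max})$; via $*_0$ this is canonically isomorphic to $\prod_{i=1}^m\mathcal O_{\Phi(i)}\bigl([0\,\Phi(i)],[\Phi(i)]_{\max}\bigr)$, with $\Phi(i)=\phi(i)-\phi(i-1)$ and $[0\,p]$ the $1$-cell with degree-one entry $(0,p)$. (An empty coproduct is the empty $\infty$-category.) The identity of $x$ is the unique object of $\tilde A_{\mathrm{id}}(x,x)$. The $j$-cells of $\tilde A(x,y)$ are the $(j+2)$-cells of $\tilde A$ with $1$-source $x$ and $1$-target $y$, with the compositions of codimension-index $\ge2$ inherited from the $\infty$-category $\tilde A(x,y)$. - The composition $*_1$: for $x,y,z$ parallel $1$-cells of lengths $\ell,m,n$ and cells $\alpha$ of $\tilde A_\phi(x,y)$, $\beta$ of $\tilde A_\psi(y,z)$, it is $\beta*_1\mathcal O_\psi(\alpha)$, computed in $\mathcal O_n$, a cell of $\tilde A_{\psi\phi}(x,z)=\mathcal O_n([\psi\phi],[n]_{\max})$. - The composition $*_0$: for $1$-cells $x,z\colon a\to a'$ and $y,t\colon a'\to a''$, with $z,t$ of lengths $p,q$, and cells $\alpha$ of $\tilde A_\phi(x,z)$, $\alpha'$ of $\tilde A_{\phi'}(y,t)$, it is $\mathcal O_\kappa(\alpha')*_0\mathcal O_\iota(\alpha)$ computed in $\mathcal O_{p+q}$, where $\iota\colon[p]\to[p+q]$, $i\mapsto i$, and $\kappa\colon[q]\to[p+q]$, $j\mapsto p+j$; it lies in the component of $\tilde A$ from the concatenation of $x$ and $y$ to that of $z$ and $t$ indexed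 by the concatenation of $\phi$ and $\phi'$. *)

theory Defs
  imports "HOL-Library.Poly_Mapping" "HOL-Library.FuncSet"
begin

section \<open>Strict \<open>\<infinity>\<close>-categories\<close>

text \<open>
  The graded presentation: \<open>icells X k\<close> is the set of \<open>k\<close>-cells, \<open>isrc X k\<close> and \<open>itgt X k\<close> go from
  \<open>(k+1)\<close>-cells to \<open>k\<close>-cells, \<open>iidt X k\<close> from \<open>k\<close>-cells to \<open>(k+1)\<close>-cells, and \<open>icmp X j k y x\<close> is the
  composite \<open>y *\<^sub>j x\<close> of two \<open>k\<close>-cells along a \<open>j\<close>-cell, \<open>j < k\<close> (first \<open>x\<close>, then \<open>y\<close>).
  The sets of cells of different dimensions need not be disjoint.
\<close>

record 'c icat =
  icells :: "nat \<Rightarrow> 'c set"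
  isrc :: "nat \<Rightarrow> 'c \<Rightarrow> 'c"
  itgt :: "nat \<Rightarrow> 'c \<Rightarrow> 'c"
  iidt :: "nat \<Rightarrow> 'c \<Rightarrow> 'c"
  icmp :: "nat \<Rightarrow> nat \<Rightarrow> 'c \<Rightarrow> 'c \<Rightarrow> 'c"

text \<open>Iterated source, target (of a \<open>k\<close>-cell, down to dimension \<open>j\<close>) and identity
  (of a \<open>j\<close>-cell, up to dimension \<open>k\<close>), for \<open>j \<le> k\<close>.\<close>

fun sto :: "'c icat \<Rightarrow> nat \<Rightarrow> nat \<Rightarrow> 'c \<Rightarrow> 'c" where
  "sto X j 0 x = x"
| "sto X j (Suc k) x = (if j \<le> k then sto X j k (isrc X k x) else x)"

fun tto :: "'c icat \<Rightarrow> nat \<Rightarrow> nat \<Rightarrow> 'c \<Rightarrow> 'c" where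
  "tto X j 0 x = x"
| "tto X j (Suc k) x = (if j \<le> k then tto X j k (itgt X k x) else x)"

fun ito :: "'c icat \<Rightarrow> nat \<Rightarrow> nat \<Rightarrow> 'c \<Rightarrow> 'c" where
  "ito X j 0 x = x"
| "ito X j (Suc k) x = (if j \<le> k then iidt X k (ito X j k x) else x)"

definition composable :: "'c icat \<Rightarrow> nat \<Rightarrow> nat \<Rightarrow> 'c \<Rightarrow> 'c \<Rightarrow> bool" where
  "composable X j k y x \<longleftrightarrow> j < k \<and> y \<in> icells X k \<and> x \<in> icells X k \<and> sto X j k y = tto X j k x"

definition strict_icat :: "'c icat \<Rightarrow> bool" where
  "strict_icat X \<longleftrightarrow>
    (\<forall>k. \<forall>x\<in>icells X (Suc k). isrc X k x \<in> icells X k \<and> itgt X k x \<in> icells X k) \<and>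
    (\<forall>k. \<forall>x\<in>icells X k. iidt X k x \<in> icells X (Suc k)) \<and>
    (\<forall>j k y x. composable X j k y x \<longrightarrow> icmp X j k y x \<in> icells X k) \<and>
    (\<forall>k. \<forall>x\<in>icells X (Suc (Suc k)).
       isrc X k (isrc X (Suc k) x) = isrc X k (itgt X (Suc k) x) \<and>
       itgt X k (isrc X (Suc k) x) = itgt X k (itgt X (Suc k) x)) \<and>
    (\<forall>k. \<forall>x\<in>icells X k. isrc X k (iidt X k x) = x \<and> itgt X k (iidt X k x) = x) \<and>
    (\<forall>k y x. composable X k (Suc k) y x \<longrightarrow>
       isrc X k (icmp X k (Suc k) y x) = isrc X k x \<and>
       itgt X k (icmp X k (Suc k) y x) = itgt X k y) \<and>
    (\<forall>j k y x. j < k \<and> composable X j (Suc k) y x \<longrightarrow>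
       isrc X k (icmp X j (Suc k) y x) = icmp X j k (isrc X k y) (isrc X k x) \<and>
       itgt X k (icmp X j (Suc k) y x) = icmp X j k (itgt X k y) (itgt X k x)) \<and>
    (\<forall>j k z y x. composable X j k z y \<and> composable X j k y x \<longrightarrow>
       icmp X j k (icmp X j k z y) x = icmp X j k z (icmp X j k y x)) \<and>
    (\<forall>j k. j < k \<longrightarrow> (\<forall>x\<in>icells X k.
       icmp X j k x (ito X j k (sto X j k x)) = x \<and>
       icmp X j k (ito X j k (tto X j k x)) x = x)) \<and>
    (\<forall>j k y x. composable X j k y x \<longrightarrow>
       iidt X k (icmp X j k y x) = icmp X j (Suc k) (iidt X k y) (iidt X k x)) \<and>
    (\<forall>i j k y' y x' x. i < j \<and> composable X j k y' y \<and> composable X j k x' x \<and>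
         composable X i k y' x' \<and> composable X i k y x \<longrightarrow>
       icmp X i k (icmp X j k y' y) (icmp X j k x' x) =
       icmp X j k (icmp X i k y' x') (icmp X i k y x))"

text \<open>Functors are extensional (\<open>undefined\<close> off the cells), so that equality of functors is
  equality of HOL functions.\<close>

definition ifunctor :: "'c icat \<Rightarrow> 'd icat \<Rightarrow> (nat \<Rightarrow> 'c \<Rightarrow> 'd) \<Rightarrow> bool" where
  "ifunctor X Y F \<longleftrightarrow>
    (\<forall>k. F k \<in> icells X k \<rightarrow>\<^sub>E icells Y k) \<and>
    (\<forall>k. \<forall>x\<in>icells X (Suc k).
       F k (isrc X k x) = isrc Y k (F (Suc k) x) \<and> F k (itgt X k x) = itgt Y k (F (Suc k) x)) \<and>
    (\<forall>k. \<forall>x\<in>icells X k. F (Suc k) (iidt X k x) = iidt Y k (F k x)) \<and>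
    (\<forall>j k y x. composable X j k y x \<longrightarrow>
       F k (icmp X j k y x) = icmp Y j k (F k y) (F k x))"

definition fcomp :: "'c icat \<Rightarrow> (nat \<Rightarrow> 'd \<Rightarrow> 'e) \<Rightarrow> (nat \<Rightarrow> 'c \<Rightarrow> 'd) \<Rightarrow> nat \<Rightarrow> 'c \<Rightarrow> 'e" where
  "fcomp X G F = (\<lambda>k. compose (icells X k) (G k) (F k))"

definition icat_iso :: "'c icat \<Rightarrow> 'd icat \<Rightarrow> bool" where
  "icat_iso X Y \<longleftrightarrow> strict_icat X \<and> strict_icat Y \<and>
    (\<exists>F. ifunctor X Y F \<and> (\<forall>k. bij_betw (F k) (icells X k) (icells Y k)))"

definition hom_icat :: "'c icat \<Rightarrow> 'c \<Rightarrow> 'c \<Rightarrow> 'c icat" where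
  "hom_icat X u v =
    \<lparr>icells = (\<lambda>j. {x \<in> icells X (j + 2). sto X 1 (j + 2) x = u \<and> tto X 1 (j + 2) x = v}),
     isrc = (\<lambda>j. isrc X (j + 2)), itgt = (\<lambda>j. itgt X (j + 2)), iidt = (\<lambda>j. iidt X (j + 2)),
     icmp = (\<lambda>i j. icmp X (i + 2) (j + 2))\<rparr>"


section \<open>Simplicial sets\<close>

definition delta :: "nat \<Rightarrow> nat \<Rightarrow> (nat \<Rightarrow> nat) set" where
  "delta m n = {\<phi> \<in> {..m} \<rightarrow>\<^sub>E {..n}. mono_on {..m} \<phi>}"

text \<open>\<open>sact S m n \<phi>\<close> is the map from \<open>n\<close>-simplices to \<open>m\<close>-simplices induced by \<open>\<phi> \<in> delta m n\<close>.\<close>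

record 's sset =
  simp :: "nat \<Rightarrow> 's set"
  sact :: "nat \<Rightarrow> nat \<Rightarrow> (nat \<Rightarrow> nat) \<Rightarrow> 's \<Rightarrow> 's"

definition is_sset :: "'s sset \<Rightarrow> bool" where
  "is_sset S \<longleftrightarrow>
    (\<forall>m n. \<forall>\<phi>\<in>delta m n. \<forall>s\<in>simp S n. sact S m n \<phi> s \<in> simp S m) \<and>
    (\<forall>n. \<forall>s\<in>simp S n. sact S n n (restrict id {..n}) s = s) \<and>
    (\<forall>l m n. \<forall>\<phi>\<in>delta l m. \<forall>\<psi>\<in>delta m n. \<forall>s\<in>simp S n.
       sact S l n (compose {..l} \<psi> \<phi>) s = sact S l m \<phi> (sact S m n \<psi> s))"

definition smap :: "'s sset \<Rightarrow> 't sset \<Rightarrow> (nat \<Rightarrow> 's \<Rightarrow> 't) \<Rightarrow> bool" where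
  "smap S T f \<longleftrightarrow>
    (\<forall>n. f n \<in> simp S n \<rightarrow>\<^sub>E simp T n) \<and>
    (\<forall>m n. \<forall>\<phi>\<in>delta m n. \<forall>s\<in>simp S n. f m (sact S m n \<phi> s) = sact T m n \<phi> (f n s))"


section \<open>Orientals and the Street nerve\<close>

type_synonym chain = "nat list \<Rightarrow>\<^sub>0 int"

definition tuples :: "nat \<Rightarrow> nat \<Rightarrow> nat list set" where
  "tuples n p = {t. length t = Suc p \<and> set t \<subseteq> {..n} \<and> sorted_wrt (<) t}"

definition pos_chains :: "nat \<Rightarrow> nat \<Rightarrow> chain set" where
  "pos_chains n p =
    {c. Poly_Mapping.keys c \<subseteq> tuples n p \<and> (\<forall>t. Poly_Mapping.lookup c t \<ge> 0)}"

definition bdry :: "chain \<Rightarrow> chain" where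
  "bdry = frag_extend (\<lambda>t. \<Sum>k<length t. frag_cmul ((-1) ^ k) (frag_of (take k t @ drop (Suc k) t)))"

definition augm :: "chain \<Rightarrow> int" where
  "augm c = (\<Sum>t\<in>Poly_Mapping.keys c. Poly_Mapping.lookup c t)"

text \<open>
  A cell of an oriental is a function \<open>x\<close> with \<open>x p False = x\<^sup>0\<^sub>p\<close> and \<open>x p True = x\<^sup>1\<^sub>p\<close>.
  The entries above the dimension are set to \<open>0\<close>; adding a zero column is thus invisible
  and the identity operation is the identity function.
\<close>

type_synonym ocell = "nat \<Rightarrow> bool \<Rightarrow> chain"

definition ocells :: "nat \<Rightarrow> nat \<Rightarrow> ocell set" where
  "ocells n k = {x.
    (\<forall>p\<le>k. \<forall>\<epsilon>. x p \<epsilon> \<in> pos_chains n p) \<and>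
    (\<forall>p\<le>k. \<forall>\<epsilon>. p > 0 \<longrightarrow> bdry (x p \<epsilon>) = x (p - 1) True - x (p - 1) False) \<and>
    (\<forall>\<epsilon>. augm (x 0 \<epsilon>) = 1) \<and>
    x k False = x k True \<and>
    (\<forall>p>k. \<forall>\<epsilon>. x p \<epsilon> = 0)}"

definition oriental :: "nat \<Rightarrow> ocell icat" where
  "oriental n =
    \<lparr>icells = ocells n,
     isrc = (\<lambda>k x p \<epsilon>. if p < k then x p \<epsilon> else if p = k then x k False else 0),
     itgt = (\<lambda>k x p \<epsilon>. if p < k then x p \<epsilon> else if p = k then x k True else 0),
     iidt = (\<lambda>k x. x),
     icmp = (\<lambda>j k y x p \<epsilon>. if p \<le> j then (if \<epsilon> then y p True else x p False) else y p \<epsilon> + x p \<epsilon>)\<rparr>"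

definition omap :: "(nat \<Rightarrow> nat) \<Rightarrow> ocell \<Rightarrow> ocell" where
  "omap \<phi> x = (\<lambda>p \<epsilon>.
    frag_extend (\<lambda>t. if distinct (map \<phi> t) then frag_of (map \<phi> t) else 0) (x p \<epsilon>))"

definition nerve :: "'c icat \<Rightarrow> (nat \<Rightarrow> ocell \<Rightarrow> 'c) sset" where
  "nerve X =
    \<lparr>simp = (\<lambda>n. {F. ifunctor (oriental n) X F}),
     sact = (\<lambda>m n \<phi> F. fcomp (oriental m) F (\<lambda>k. omap \<phi>))\<rparr>"


section \<open>The left adjoint of the Street nerve\<close>

text \<open>
  \<open>c_inf S\<close> is the strict \<open>\<infinity>\<close>-category presented by generators and relations: one generating
  \<open>k\<close>-cell \<open>CGen k n s x\<close> for each \<open>n\<close>-simplex \<open>s\<close> of \<open>S\<close> and each \<open>k\<close>-cell \<open>x\<close> of the \<open>n\<close>-th oriental,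
  subject to functoriality in \<open>x\<close> and to \<open>CGen k m (\<phi>\<^sup>* s) x = CGen k n s (\<phi>\<^sub>* x)\<close>; in other words,
  the colimit of the orientals over the category of simplices of \<open>S\<close>.
  That this is the value at \<open>S\<close> of the left adjoint of the Street nerve is \<open>strict_icat_c_inf\<close>,
  \<open>smap_c_unit\<close> and \<open>c_inf_universal\<close> below: \<open>c_unit S\<close> is a universal arrow from \<open>S\<close> to \<open>nerve\<close>,
  with respect to strict \<open>\<infinity>\<close>-categories \<open>X\<close> over arbitrary types.
\<close>

datatype 's cterm =
    CGen nat nat 's ocell
  | CSrc nat "'s cterm"
  | CTgt nat "'s cterm"
  | CIdt nat "'s cterm"
  | CCmp nat nat "'s cterm" "'s cterm"

definition raw_terms :: "'s cterm icat" where
  "raw_terms = \<lparr>icells = (\<lambda>_. UNIV), isrc = CSrc, itgt = CTgt, iidt = CIdt, icmp = CCmp\<rparr>"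

abbreviation ccomposable ::
  "(nat \<Rightarrow> 's cterm \<Rightarrow> 's cterm \<Rightarrow> bool) \<Rightarrow> nat \<Rightarrow> nat \<Rightarrow> 's cterm \<Rightarrow> 's cterm \<Rightarrow> bool" where
  "ccomposable R j k y x \<equiv>
    j < k \<and> R k y y \<and> R k x x \<and> R j (sto raw_terms j k y) (tto raw_terms j k x)"

text \<open>\<open>ceq S k\<close> is a partial equivalence relation: \<open>ceq S k t t\<close> says that \<open>t\<close> is a well-formed
  \<open>k\<close>-cell, and \<open>ceq S k t u\<close> that \<open>t\<close> and \<open>u\<close> are well-formed and equal in the presented
  \<open>\<infinity>\<close>-category.\<close>

inductive ceq :: "'s sset \<Rightarrow> nat \<Rightarrow> 's cterm \<Rightarrow> 's cterm \<Rightarrow> bool" for S :: "'s sset" where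
  ceq_sym: "ceq S k t u \<Longrightarrow> ceq S k u t"
| ceq_trans: "ceq S k t u \<Longrightarrow> ceq S k u v \<Longrightarrow> ceq S k t v"
| ceq_src: "ceq S (Suc k) t u \<Longrightarrow> ceq S k (CSrc k t) (CSrc k u)"
| ceq_tgt: "ceq S (Suc k) t u \<Longrightarrow> ceq S k (CTgt k t) (CTgt k u)"
| ceq_idt: "ceq S k t u \<Longrightarrow> ceq S (Suc k) (CIdt k t) (CIdt k u)"
| ceq_cmp: "ccomposable (ceq S) j k y x \<Longrightarrow> ceq S k y y' \<Longrightarrow> ceq S k x x' \<Longrightarrow>
    ceq S k (CCmp j k y x) (CCmp j k y' x')"
| glob_src: "ceq S (Suc (Suc k)) x x \<Longrightarrow> ceq S k (CSrc k (CSrc (Suc k) x)) (CSrc k (CTgt (Suc k) x))"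
| glob_tgt: "ceq S (Suc (Suc k)) x x \<Longrightarrow> ceq S k (CTgt k (CSrc (Suc k) x)) (CTgt k (CTgt (Suc k) x))"
| src_idt: "ceq S k x x \<Longrightarrow> ceq S k (CSrc k (CIdt k x)) x"
| tgt_idt: "ceq S k x x \<Longrightarrow> ceq S k (CTgt k (CIdt k x)) x"
| src_cmp: "ccomposable (ceq S) k (Suc k) y x \<Longrightarrow> ceq S k (CSrc k (CCmp k (Suc k) y x)) (CSrc k x)"
| tgt_cmp: "ccomposable (ceq S) k (Suc k) y x \<Longrightarrow> ceq S k (CTgt k (CCmp k (Suc k) y x)) (CTgt k y)"
| src_cmp_less: "j < k \<Longrightarrow> ccomposable (ceq S) j (Suc k) y x \<Longrightarrow>
    ceq S k (CSrc k (CCmp j (Suc k) y x)) (CCmp j k (CSrc k y) (CSrc k x))"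
| tgt_cmp_less: "j < k \<Longrightarrow> ccomposable (ceq S) j (Suc k) y x \<Longrightarrow>
    ceq S k (CTgt k (CCmp j (Suc k) y x)) (CCmp j k (CTgt k y) (CTgt k x))"
| assoc: "ccomposable (ceq S) j k z y \<Longrightarrow> ccomposable (ceq S) j k y x \<Longrightarrow>
    ceq S k (CCmp j k (CCmp j k z y) x) (CCmp j k z (CCmp j k y x))"
| unit_src: "j < k \<Longrightarrow> ceq S k x x \<Longrightarrow>
    ceq S k (CCmp j k x (ito raw_terms j k (sto raw_terms j k x))) x"
| unit_tgt: "j < k \<Longrightarrow> ceq S k x x \<Longrightarrow>
    ceq S k (CCmp j k (ito raw_terms j k (tto raw_terms j k x)) x) x"
| idt_cmp: "ccomposable (ceq S) j k y x \<Longrightarrow>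
    ceq S (Suc k) (CIdt k (CCmp j k y x)) (CCmp j (Suc k) (CIdt k y) (CIdt k x))"
| interchange: "i < j \<Longrightarrow> ccomposable (ceq S) j k y' y \<Longrightarrow> ccomposable (ceq S) j k x' x \<Longrightarrow>
    ccomposable (ceq S) i k y' x' \<Longrightarrow> ccomposable (ceq S) i k y x \<Longrightarrow>
    ceq S k (CCmp i k (CCmp j k y' y) (CCmp j k x' x)) (CCmp j k (CCmp i k y' x') (CCmp i k y x))"
| gen: "s \<in> simp S n \<Longrightarrow> x \<in> icells (oriental n) k \<Longrightarrow> ceq S k (CGen k n s x) (CGen k n s x)"
| gen_src: "s \<in> simp S n \<Longrightarrow> x \<in> icells (oriental n) (Suc k) \<Longrightarrow>
    ceq S k (CGen k n s (isrc (oriental n) k x)) (CSrc k (CGen (Suc k) n s x))"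
| gen_tgt: "s \<in> simp S n \<Longrightarrow> x \<in> icells (oriental n) (Suc k) \<Longrightarrow>
    ceq S k (CGen k n s (itgt (oriental n) k x)) (CTgt k (CGen (Suc k) n s x))"
| gen_idt: "s \<in> simp S n \<Longrightarrow> x \<in> icells (oriental n) k \<Longrightarrow>
    ceq S (Suc k) (CGen (Suc k) n s (iidt (oriental n) k x)) (CIdt k (CGen k n s x))"
| gen_cmp: "s \<in> simp S n \<Longrightarrow> composable (oriental n) j k y x \<Longrightarrow>
    ceq S k (CGen k n s (icmp (oriental n) j k y x)) (CCmp j k (CGen k n s y) (CGen k n s x))"
| gen_act: "\<phi> \<in> delta m n \<Longrightarrow> s \<in> simp S n \<Longrightarrow> x \<in> icells (oriental m) k \<Longrightarrow>
    ceq S k (CGen k m (sact S m n \<phi> s) x) (CGen k n s (omap \<phi> x))"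

definition ccls :: "'s sset \<Rightarrow> nat \<Rightarrow> 's cterm \<Rightarrow> 's cterm set" where
  "ccls S k t = {u. ceq S k t u}"

definition crep :: "'s cterm set \<Rightarrow> 's cterm" where
  "crep C = (SOME t. t \<in> C)"

definition c_inf :: "'s sset \<Rightarrow> 's cterm set icat" where
  "c_inf S =
    \<lparr>icells = (\<lambda>k. {ccls S k t | t. ceq S k t t}),
     isrc = (\<lambda>k C. ccls S k (CSrc k (crep C))),
     itgt = (\<lambda>k C. ccls S k (CTgt k (crep C))),
     iidt = (\<lambda>k C. ccls S (Suc k) (CIdt k (crep C))),
     icmp = (\<lambda>j k D C. ccls S k (CCmp j k (crep D) (crep C)))\<rparr>"

definition c_unit :: "'s sset \<Rightarrow> nat \<Rightarrow> 's \<Rightarrow> nat \<Rightarrow> ocell \<Rightarrow> 's cterm set" where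
  "c_unit S n = (\<lambda>s\<in>simp S n. \<lambda>k. \<lambda>x\<in>icells (oriental n) k. ccls S k (CGen k n s x))"

subsection \<open>Basic facts\<close>

lemma strict_icatD:
  assumes "strict_icat X"
  shows "\<And>k x. x \<in> icells X (Suc k) \<Longrightarrow> isrc X k x \<in> icells X k"
    and "\<And>k x. x \<in> icells X (Suc k) \<Longrightarrow> itgt X k x \<in> icells X k"
    and "\<And>k x. x \<in> icells X k \<Longrightarrow> iidt X k x \<in> icells X (Suc k)"
    and "\<And>j k y x. composable X j k y x \<Longrightarrow> icmp X j k y x \<in> icells X k"
    and "\<And>k x. x \<in> icells X (Suc (Suc k)) \<Longrightarrow>
       isrc X k (isrc X (Suc k) x) = isrc X k (itgt X (Suc k) x)"
    and "\<And>k x. x \<in> icells X (Suc (Suc k)) \<Longrightarrow>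
       itgt X k (isrc X (Suc k) x) = itgt X k (itgt X (Suc k) x)"
    and "\<And>k x. x \<in> icells X k \<Longrightarrow> isrc X k (iidt X k x) = x"
    and "\<And>k x. x \<in> icells X k \<Longrightarrow> itgt X k (iidt X k x) = x"
    and "\<And>k y x. composable X k (Suc k) y x \<Longrightarrow> isrc X k (icmp X k (Suc k) y x) = isrc X k x"
    and "\<And>k y x. composable X k (Suc k) y x \<Longrightarrow> itgt X k (icmp X k (Suc k) y x) = itgt X k y"
    and "\<And>j k y x. j < k \<Longrightarrow> composable X j (Suc k) y x \<Longrightarrow>
       isrc X k (icmp X j (Suc k) y x) = icmp X j k (isrc X k y) (isrc X k x)"
    and "\<And>j k y x. j < k \<Longrightarrow> composable X j (Suc k) y x \<Longrightarrow>
       itgt X k (icmp X j (Suc k) y x) = icmp X j k (itgt X k y) (itgt X k x)"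
    and "\<And>j k z y x. composable X j k z y \<Longrightarrow> composable X j k y x \<Longrightarrow>
       icmp X j k (icmp X j k z y) x = icmp X j k z (icmp X j k y x)"
    and "\<And>j k x. j < k \<Longrightarrow> x \<in> icells X k \<Longrightarrow> icmp X j k x (ito X j k (sto X j k x)) = x"
    and "\<And>j k x. j < k \<Longrightarrow> x \<in> icells X k \<Longrightarrow> icmp X j k (ito X j k (tto X j k x)) x = x"
    and "\<And>j k y x. composable X j k y x \<Longrightarrow>
       iidt X k (icmp X j k y x) = icmp X j (Suc k) (iidt X k y) (iidt X k x)"
    and "\<And>i j k y' y x' x. i < j \<Longrightarrow> composable X j k y' y \<Longrightarrow> composable X j k x' x \<Longrightarrow>
         composable X i k y' x' \<Longrightarrow> composable X i k y x \<Longrightarrow>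
       icmp X i k (icmp X j k y' y) (icmp X j k x' x) =
       icmp X j k (icmp X i k y' x') (icmp X i k y x)"
proof -
  note r0 = assms[unfolded strict_icat_def]
  note c1 = r0[THEN conjunct1] and r1 = r0[THEN conjunct2]
  note c2 = r1[THEN conjunct1] and r2 = r1[THEN conjunct2]
  note c3 = r2[THEN conjunct1] and r3 = r2[THEN conjunct2]
  note c4 = r3[THEN conjunct1] and r4 = r3[THEN conjunct2]
  note c5 = r4[THEN conjunct1] and r5 = r4[THEN conjunct2]
  note c6 = r5[THEN conjunct1] and r6 = r5[THEN conjunct2]
  note c7 = r6[THEN conjunct1] and r7 = r6[THEN conjunct2]
  note c8 = r7[THEN conjunct1] and r8 = r7[THEN conjunct2]
  note c9 = r8[THEN conjunct1] and r9 = r8[THEN conjunct2]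
  note c10 = r9[THEN conjunct1] and r10 = r9[THEN conjunct2]
  note c11 = r10
  show "\<And>k x. x \<in> icells X (Suc k) \<Longrightarrow> isrc X k x \<in> icells X k"
    using c1 by blast
  show "\<And>k x. x \<in> icells X (Suc k) \<Longrightarrow> itgt X k x \<in> icells X k"
    using c1 by blast
  show "\<And>k x. x \<in> icells X k \<Longrightarrow> iidt X k x \<in> icells X (Suc k)"
    using c2 by blast
  show "\<And>j k y x. composable X j k y x \<Longrightarrow> icmp X j k y x \<in> icells X k"
    using c3 by blast
  show "\<And>k x. x \<in> icells X (Suc (Suc k)) \<Longrightarrow>
       isrc X k (isrc X (Suc k) x) = isrc X k (itgt X (Suc k) x)"
    using c4 by blast
  show "\<And>k x. x \<in> icells X (Suc (Suc k)) \<Longrightarrow>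
       itgt X k (isrc X (Suc k) x) = itgt X k (itgt X (Suc k) x)"
    using c4 by blast
  show "\<And>k x. x \<in> icells X k \<Longrightarrow> isrc X k (iidt X k x) = x"
    using c5 by blast
  show "\<And>k x. x \<in> icells X k \<Longrightarrow> itgt X k (iidt X k x) = x"
    using c5 by blast
  show "\<And>k y x. composable X k (Suc k) y x \<Longrightarrow> isrc X k (icmp X k (Suc k) y x) = isrc X k x"
    using c6 by blast
  show "\<And>k y x. composable X k (Suc k) y x \<Longrightarrow> itgt X k (icmp X k (Suc k) y x) = itgt X k y"
    using c6 by blast
  show "\<And>j k y x. j < k \<Longrightarrow> composable X j (Suc k) y x \<Longrightarrow>
       isrc X k (icmp X j (Suc k) y x) = icmp X j k (isrc X k y) (isrc X k x)"
    using c7 by blast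
  show "\<And>j k y x. j < k \<Longrightarrow> composable X j (Suc k) y x \<Longrightarrow>
       itgt X k (icmp X j (Suc k) y x) = icmp X j k (itgt X k y) (itgt X k x)"
    using c7 by blast
  show "\<And>j k z y x. composable X j k z y \<Longrightarrow> composable X j k y x \<Longrightarrow>
       icmp X j k (icmp X j k z y) x = icmp X j k z (icmp X j k y x)"
    using c8 by blast
  show "\<And>j k x. j < k \<Longrightarrow> x \<in> icells X k \<Longrightarrow> icmp X j k x (ito X j k (sto X j k x)) = x"
    using c9 by blast
  show "\<And>j k x. j < k \<Longrightarrow> x \<in> icells X k \<Longrightarrow> icmp X j k (ito X j k (tto X j k x)) x = x"
    using c9 by blast
  show "\<And>j k y x. composable X j k y x \<Longrightarrow>
       iidt X k (icmp X j k y x) = icmp X j (Suc k) (iidt X k y) (iidt X k x)"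
    using c10 by blast
  show "\<And>i j k y' y x' x. i < j \<Longrightarrow> composable X j k y' y \<Longrightarrow> composable X j k x' x \<Longrightarrow>
         composable X i k y' x' \<Longrightarrow> composable X i k y x \<Longrightarrow>
       icmp X i k (icmp X j k y' y) (icmp X j k x' x) =
       icmp X j k (icmp X i k y' x') (icmp X i k y x)"
    using c11 by blast
qed

lemma sto_sto: "i \<le> j \<Longrightarrow> j \<le> k \<Longrightarrow> sto X i j (sto X j k x) = sto X i k x"
proof (induction k arbitrary: x)
  case (Suc k)
  then show ?case by (cases "j = Suc k") auto
qed simp

lemma tto_tto: "i \<le> j \<Longrightarrow> j \<le> k \<Longrightarrow> tto X i j (tto X j k x) = tto X i k x"
proof (induction k arbitrary: x)
  case (Suc k)
  then show ?case by (cases "j = Suc k") auto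
qed simp

lemma sto_refl [simp]: "sto X k k x = x"
  by (cases k) auto

lemma tto_refl [simp]: "tto X k k x = x"
  by (cases k) auto

lemma ito_refl [simp]: "ito X k k x = x"
  by (cases k) auto

lemma glob_step:
  assumes "strict_icat X" "x \<in> icells X (Suc k)" "i < k"
  shows "sto X i k (isrc X k x) = sto X i k (itgt X k x)"
    and "tto X i k (isrc X k x) = tto X i k (itgt X k x)"
proof -
  obtain l where "k = Suc l" using assms(3) by (cases k) auto
  with assms show "sto X i k (isrc X k x) = sto X i k (itgt X k x)"
    "tto X i k (isrc X k x) = tto X i k (itgt X k x)"
    using strict_icatD(5,6)[OF assms(1), of x l] by auto
qed

lemma tto_sto:
  assumes "strict_icat X"
  shows "x \<in> icells X k \<Longrightarrow> i < j \<Longrightarrow> j \<le> k \<Longrightarrow> tto X i j (sto X j k x) = tto X i k x"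
proof (induction k arbitrary: x)
  case (Suc k)
  show ?case
  proof (cases "j = Suc k")
    case False
    then have "j \<le> k" "i < k" using Suc.prems by simp_all
    then show ?thesis
      using Suc.IH[OF strict_icatD(1)[OF assms Suc.prems(1)] Suc.prems(2) \<open>j \<le> k\<close>]
        glob_step(2)[OF assms Suc.prems(1) \<open>i < k\<close>] by simp
  qed simp
qed simp

lemma sto_tto:
  assumes "strict_icat X"
  shows "x \<in> icells X k \<Longrightarrow> i < j \<Longrightarrow> j \<le> k \<Longrightarrow> sto X i j (tto X j k x) = sto X i k x"
proof (induction k arbitrary: x)
  case (Suc k)
  show ?case
  proof (cases "j = Suc k")
    case False
    then have "j \<le> k" "i < k" using Suc.prems by simp_all
    then show ?thesis
      using Suc.IH[OF strict_icatD(2)[OF assms Suc.prems(1)] Suc.prems(2) \<open>j \<le> k\<close>]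
        glob_step(1)[OF assms Suc.prems(1) \<open>i < k\<close>] by simp
  qed simp
qed simp

lemma composable_src_tgt:
  assumes X: "strict_icat X" and "j < k" and c: "composable X j (Suc k) y x"
  shows "composable X j k (isrc X k y) (isrc X k x)"
    and "composable X j k (itgt X k y) (itgt X k x)"
proof -
  have y: "y \<in> icells X (Suc k)" and x: "x \<in> icells X (Suc k)"
    and e: "sto X j k (isrc X k y) = tto X j k (itgt X k x)"
    using c \<open>j < k\<close> by (auto simp: composable_def)
  show "composable X j k (isrc X k y) (isrc X k x)" "composable X j k (itgt X k y) (itgt X k x)"
    using e \<open>j < k\<close> strict_icatD(1,2)[OF X x] strict_icatD(1,2)[OF X y]
      glob_step[OF X x \<open>j < k\<close>] glob_step[OF X y \<open>j < k\<close>]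
    by (simp_all add: composable_def)
qed

lemma sto_icmp:
  assumes X: "strict_icat X"
  shows "composable X j k y x \<Longrightarrow> sto X j k (icmp X j k y x) = sto X j k x"
proof (induction k arbitrary: y x)
  case (Suc k)
  show ?case
  proof (cases "j = k")
    case True
    then show ?thesis using strict_icatD(9)[OF X] Suc.prems by simp
  next
    case False
    then have "j < k" using Suc.prems by (simp add: composable_def)
    then show ?thesis
      using Suc.IH[OF composable_src_tgt(1)[OF X \<open>j < k\<close> Suc.prems]]
        strict_icatD(11)[OF X \<open>j < k\<close> Suc.prems] by simp
  qed
qed (simp add: composable_def)

lemma tto_icmp:
  assumes X: "strict_icat X"
  shows "composable X j k y x \<Longrightarrow> tto X j k (icmp X j k y x) = tto X j k y"
proof (induction k arbitrary: y x)
  case (Suc k)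
  show ?case
  proof (cases "j = k")
    case True
    then show ?thesis using strict_icatD(10)[OF X] Suc.prems by simp
  next
    case False
    then have "j < k" using Suc.prems by (simp add: composable_def)
    then show ?thesis
      using Suc.IH[OF composable_src_tgt(2)[OF X \<open>j < k\<close> Suc.prems]]
        strict_icatD(12)[OF X \<open>j < k\<close> Suc.prems] by simp
  qed
qed (simp add: composable_def)

lemma interchange_composable:
  assumes X: "strict_icat X" and "i < j" and c: "composable X j k y' y" "composable X j k x' x"
    "composable X i k y' x'" "composable X i k y x"
  shows "composable X i k (icmp X j k y' y) (icmp X j k x' x)"
proof -
  have x: "x \<in> icells X k" "x' \<in> icells X k" and "j \<le> k" and "i < k" "i \<le> j"
    using c \<open>i < j\<close> by (auto simp: composable_def)
  have "sto X i k (icmp X j k y' y) = sto X i k y"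
    using sto_icmp[OF X c(1)] sto_sto[OF \<open>i \<le> j\<close> \<open>j \<le> k\<close>, of X] by metis
  moreover have "tto X i k (icmp X j k x' x) = tto X i k x'"
    using tto_icmp[OF X c(2)] tto_tto[OF \<open>i \<le> j\<close> \<open>j \<le> k\<close>, of X] by metis
  moreover have "tto X i k x' = tto X i k x"
  proof -
    have "tto X i k x' = tto X i j (sto X j k x')"
      by (rule tto_sto[OF X x(2) \<open>i < j\<close> \<open>j \<le> k\<close>, symmetric])
    also have "sto X j k x' = tto X j k x" using c(2) by (simp add: composable_def)
    finally show ?thesis by (simp add: tto_tto \<open>i \<le> j\<close> \<open>j \<le> k\<close>)
  qed
  moreover have "sto X i k y = tto X i k x" using c(4) by (simp add: composable_def)
  ultimately show ?thesis
    using \<open>i < k\<close> strict_icatD(4)[OF X c(1)] strict_icatD(4)[OF X c(2)]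
    by (simp add: composable_def)
qed

lemma ifunctorD:
  assumes "ifunctor X Y F"
  shows "\<And>k. F k \<in> icells X k \<rightarrow>\<^sub>E icells Y k"
    and "\<And>k x. x \<in> icells X k \<Longrightarrow> F k x \<in> icells Y k"
    and "\<And>k x. x \<in> icells X (Suc k) \<Longrightarrow> F k (isrc X k x) = isrc Y k (F (Suc k) x)"
    and "\<And>k x. x \<in> icells X (Suc k) \<Longrightarrow> F k (itgt X k x) = itgt Y k (F (Suc k) x)"
    and "\<And>k x. x \<in> icells X k \<Longrightarrow> F (Suc k) (iidt X k x) = iidt Y k (F k x)"
    and "\<And>j k y x. composable X j k y x \<Longrightarrow> F k (icmp X j k y x) = icmp Y j k (F k y) (F k x)"
proof -
  note r0 = assms[unfolded ifunctor_def]
  note c1 = r0[THEN conjunct1] and r1 = r0[THEN conjunct2]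
  note c2 = r1[THEN conjunct1] and r2 = r1[THEN conjunct2]
  show "\<And>k. F k \<in> icells X k \<rightarrow>\<^sub>E icells Y k" using c1 by blast
  then show "\<And>k x. x \<in> icells X k \<Longrightarrow> F k x \<in> icells Y k" by blast
  show "\<And>k x. x \<in> icells X (Suc k) \<Longrightarrow> F k (isrc X k x) = isrc Y k (F (Suc k) x)"
    "\<And>k x. x \<in> icells X (Suc k) \<Longrightarrow> F k (itgt X k x) = itgt Y k (F (Suc k) x)"
    using c2 by blast+
  show "\<And>k x. x \<in> icells X k \<Longrightarrow> F (Suc k) (iidt X k x) = iidt Y k (F k x)"
    "\<And>j k y x. composable X j k y x \<Longrightarrow> F k (icmp X j k y x) = icmp Y j k (F k y) (F k x)"
    using r2 by blast+
qed

lemma sto_cells: "strict_icat X \<Longrightarrow> x \<in> icells X k \<Longrightarrow> j \<le> k \<Longrightarrow> sto X j k x \<in> icells X j"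
proof (induction k arbitrary: x)
  case (Suc k)
  then show ?case by (cases "j = Suc k") (auto intro: strict_icatD)
qed simp

lemma tto_cells: "strict_icat X \<Longrightarrow> x \<in> icells X k \<Longrightarrow> j \<le> k \<Longrightarrow> tto X j k x \<in> icells X j"
proof (induction k arbitrary: x)
  case (Suc k)
  then show ?case by (cases "j = Suc k") (auto intro: strict_icatD)
qed simp

lemma ifunctor_sto:
  assumes "strict_icat X" "ifunctor X Y F"
  shows "x \<in> icells X k \<Longrightarrow> j \<le> k \<Longrightarrow> F j (sto X j k x) = sto Y j k (F k x)"
proof (induction k arbitrary: x)
  case (Suc k)
  then show ?case
    by (cases "j = Suc k") (auto simp: ifunctorD[OF assms(2)] strict_icatD[OF assms(1)])
qed simp

lemma ifunctor_tto:
  assumes "strict_icat X" "ifunctor X Y F"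
  shows "x \<in> icells X k \<Longrightarrow> j \<le> k \<Longrightarrow> F j (tto X j k x) = tto Y j k (F k x)"
proof (induction k arbitrary: x)
  case (Suc k)
  then show ?case
    by (cases "j = Suc k") (auto simp: ifunctorD[OF assms(2)] strict_icatD[OF assms(1)])
qed simp

lemma ifunctor_composable:
  assumes "strict_icat X" "ifunctor X Y F" "composable X j k y x"
  shows "composable Y j k (F k y) (F k x)"
proof -
  from assms(3) have c: "j < k" "y \<in> icells X k" "x \<in> icells X k" "sto X j k y = tto X j k x"
    by (auto simp: composable_def)
  then have "sto Y j k (F k y) = tto Y j k (F k x)"
    using ifunctor_sto[OF assms(1,2) c(2), of j] ifunctor_tto[OF assms(1,2) c(3), of j] by simp
  then show ?thesis using c ifunctorD(2)[OF assms(2)] by (simp add: composable_def)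
qed

lemma ifunctor_fcomp:
  assumes "strict_icat X" "ifunctor X Y F" "ifunctor Y Z G"
  shows "ifunctor X Z (fcomp X G F)"
  unfolding ifunctor_def
proof (intro conjI allI ballI impI)
  fix k show "fcomp X G F k \<in> icells X k \<rightarrow>\<^sub>E icells Z k"
    using ifunctorD(2)[OF assms(2)] ifunctorD(2)[OF assms(3)]
    by (auto simp: fcomp_def compose_def)
next
  fix k x assume x: "x \<in> icells X (Suc k)"
  then show "fcomp X G F k (isrc X k x) = isrc Z k (fcomp X G F (Suc k) x)"
    "fcomp X G F k (itgt X k x) = itgt Z k (fcomp X G F (Suc k) x)"
    using strict_icatD(1,2)[OF assms(1) x] ifunctorD[OF assms(2)] ifunctorD[OF assms(3)]
    by (simp_all add: fcomp_def compose_def)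
next
  fix k x assume x: "x \<in> icells X k"
  then show "fcomp X G F (Suc k) (iidt X k x) = iidt Z k (fcomp X G F k x)"
    using strict_icatD(3)[OF assms(1) x] ifunctorD[OF assms(2)] ifunctorD[OF assms(3)]
    by (simp_all add: fcomp_def compose_def)
next
  fix j k y x assume c: "composable X j k y x"
  then have "x \<in> icells X k" "y \<in> icells X k" by (auto simp: composable_def)
  then show "fcomp X G F k (icmp X j k y x) = icmp Z j k (fcomp X G F k y) (fcomp X G F k x)"
    using strict_icatD(4)[OF assms(1) c] ifunctorD(6)[OF assms(2) c]
      ifunctorD(6)[OF assms(3) ifunctor_composable[OF assms(1,2) c]]
    by (simp_all add: fcomp_def compose_def)
qed

subsection \<open>Orientals are strict \<open>\<infinity>\<close>-categories\<close>

lemma pos_chains_zero [simp]: "0 \<in> pos_chains n p"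
  by (simp add: pos_chains_def)

lemma pos_chains_add: "c \<in> pos_chains n p \<Longrightarrow> d \<in> pos_chains n p \<Longrightarrow> c + d \<in> pos_chains n p"
  using Poly_Mapping.keys_add[of c d] by (auto simp: pos_chains_def lookup_add)

lemma bdry_zero [simp]: "bdry 0 = 0"
  by (simp add: bdry_def)

lemma bdry_add: "bdry (c + d) = bdry c + bdry d"
  by (simp add: bdry_def frag_extend_add)

lemma oriental_sto:
  assumes "x \<in> ocells n k" "j \<le> k"
  shows "sto (oriental n) j k x =
    (\<lambda>p \<epsilon>. if p < j then x p \<epsilon> else if p = j then x j False else 0)"
proof -
  have "sto (oriental n) j k x =
    (if j = k then x else (\<lambda>p \<epsilon>. if p < j then x p \<epsilon> else if p = j then x j False else 0))"
    using assms(2) 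
  proof (induction k arbitrary: x)
    case (Suc k)
    show ?case
    proof (cases "j = Suc k")
      case False
      with Suc.prems have "j \<le> k" by simp
      then have "sto (oriental n) j (Suc k) x = sto (oriental n) j k (isrc (oriental n) k x)"
        by simp
      also have "\<dots> = (if j = k then isrc (oriental n) k x else (\<lambda>p \<epsilon>.
          if p < j then isrc (oriental n) k x p \<epsilon>
          else if p = j then isrc (oriental n) k x j False else 0))"
        by (rule Suc.IH) fact
      also have "\<dots> = (\<lambda>p \<epsilon>. if p < j then x p \<epsilon> else if p = j then x j False else 0)"
        using \<open>j \<le> k\<close> by (intro ext) (simp add: oriental_def)
      finally show ?thesis using False by simp
    qed simp
  qed simp
  moreover have "x = (\<lambda>p \<epsilon>. if p < k then x p \<epsilon> else if p = k then x k False else 0)"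
  proof (intro ext)
    fix p \<epsilon> show "x p \<epsilon> = (if p < k then x p \<epsilon> else if p = k then x k False else 0)"
      using assms(1) by (cases \<epsilon>) (auto simp: ocells_def)
  qed
  ultimately show ?thesis by auto
qed

lemma oriental_tto:
  assumes "x \<in> ocells n k" "j \<le> k"
  shows "tto (oriental n) j k x =
    (\<lambda>p \<epsilon>. if p < j then x p \<epsilon> else if p = j then x j True else 0)"
proof -
  have "tto (oriental n) j k x =
    (if j = k then x else (\<lambda>p \<epsilon>. if p < j then x p \<epsilon> else if p = j then x j True else 0))"
    using assms(2) 
  proof (induction k arbitrary: x)
    case (Suc k)
    show ?case
    proof (cases "j = Suc k")
      case False
      with Suc.prems have "j \<le> k" by simp
      then have "tto (oriental n) j (Suc k) x = tto (oriental n) j k (itgt (oriental n) k x)"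
        by simp
      also have "\<dots> = (if j = k then itgt (oriental n) k x else (\<lambda>p \<epsilon>.
          if p < j then itgt (oriental n) k x p \<epsilon>
          else if p = j then itgt (oriental n) k x j True else 0))"
        by (rule Suc.IH) fact
      also have "\<dots> = (\<lambda>p \<epsilon>. if p < j then x p \<epsilon> else if p = j then x j True else 0)"
        using \<open>j \<le> k\<close> by (intro ext) (simp add: oriental_def)
      finally show ?thesis using False by simp
    qed simp
  qed simp
  moreover have "x = (\<lambda>p \<epsilon>. if p < k then x p \<epsilon> else if p = k then x k True else 0)"
  proof (intro ext)
    fix p \<epsilon> show "x p \<epsilon> = (if p < k then x p \<epsilon> else if p = k then x k True else 0)"
      using assms(1) by (cases \<epsilon>) (auto simp: ocells_def)
  qed
  ultimately show ?thesis by auto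
qed

lemma oriental_ito: "ito (oriental n) j k x = x"
  by (induction k) (auto simp: oriental_def)

lemma oriental_composable:
  "composable (oriental n) j k y x \<longleftrightarrow> j < k \<and> y \<in> ocells n k \<and> x \<in> ocells n k \<and>
     (\<forall>p<j. \<forall>\<epsilon>. y p \<epsilon> = x p \<epsilon>) \<and> y j False = x j True" (is "?L \<longleftrightarrow> ?R")
proof
  assume L: ?L
  then have *: "j < k" "y \<in> ocells n k" "x \<in> ocells n k"
    and eq: "sto (oriental n) j k y = tto (oriental n) j k x"
    by (auto simp: composable_def oriental_def)
  have "y p \<epsilon> = x p \<epsilon>" if "p < j" for p \<epsilon>
    using fun_cong[OF fun_cong[OF eq], of p \<epsilon>] * that by (simp add: oriental_sto oriental_tto)
  moreover have "y j False = x j True"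
    using fun_cong[OF fun_cong[OF eq], of j False] * by (simp add: oriental_sto oriental_tto)
  ultimately show ?R using * by blast
next
  assume ?R
  then show ?L
    by (auto simp: composable_def oriental_sto oriental_tto fun_eq_iff)
      (simp_all add: oriental_def)
qed

lemma ocells_src: "x \<in> ocells n (Suc k) \<Longrightarrow> isrc (oriental n) k x \<in> ocells n k"
  and ocells_tgt: "x \<in> ocells n (Suc k) \<Longrightarrow> itgt (oriental n) k x \<in> ocells n k"
  by (auto simp: ocells_def oriental_def)

lemma ocells_idt: "x \<in> ocells n k \<Longrightarrow> x \<in> ocells n (Suc k)"
  by (auto simp: ocells_def le_Suc_eq)

lemma ocells_cmp:
  assumes "composable (oriental n) j k y x"
  shows "icmp (oriental n) j k y x \<in> ocells n k"
proof -
  let ?z = "icmp (oriental n) j k y x"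
  have *: "j < k" "y \<in> ocells n k" "x \<in> ocells n k" "\<And>p \<epsilon>. p < j \<Longrightarrow> y p \<epsilon> = x p \<epsilon>"
    "y j False = x j True"
    using assms by (auto simp: oriental_composable)
  have z: "?z p \<epsilon> = (if p \<le> j then (if \<epsilon> then y p True else x p False) else y p \<epsilon> + x p \<epsilon>)" for p \<epsilon>
    by (simp add: oriental_def)
  have dy: "bdry (y p \<epsilon>) = y (p - 1) True - y (p - 1) False" if "p \<le> k" "p > 0" for p \<epsilon>
    using *(2) that by (simp add: ocells_def)
  have dx: "bdry (x p \<epsilon>) = x (p - 1) True - x (p - 1) False" if "p \<le> k" "p > 0" for p \<epsilon>
    using *(3) that by (simp add: ocells_def)
  have "bdry (?z p \<epsilon>) = ?z (p - 1) True - ?z (p - 1) False" if p: "p \<le> k" "p > 0" for p \<epsilon>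
  proof -
    consider "p \<le> j" | "p = Suc j" | "p > Suc j" by linarith
    then show ?thesis
    proof cases
      case 1 
      then have "p - 1 < j" using p by simp
      with 1 show ?thesis using dy[OF p] dx[OF p] *(4)[of "p - 1"] by (simp add: z)
    next
      case 2
      then show ?thesis using dy[OF p] dx[OF p] *(5) by (simp add: z bdry_add)
    next
      case 3
      then have "\<not> p - 1 \<le> j" "\<not> p \<le> j" by simp_all
      then show ?thesis using dy[OF p] dx[OF p] by (simp add: z bdry_add)
    qed
  qed
  moreover have "?z p \<epsilon> \<in> pos_chains n p" if "p \<le> k" for p \<epsilon>
    unfolding z using that *(2,3) by (auto simp: ocells_def intro: pos_chains_add)
  moreover have "augm (?z 0 \<epsilon>) = 1" for \<epsilon>
    using *(2,3) by (cases \<epsilon>) (simp_all add: z ocells_def)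
  moreover have "?z k False = ?z k True"
    using *(1-3) by (simp add: z ocells_def)
  moreover have "?z p \<epsilon> = 0" if "p > k" for p \<epsilon>
    using *(1-3) that by (simp add: z ocells_def)
  ultimately show ?thesis
    unfolding ocells_def mem_Collect_eq by (intro conjI allI impI) simp_all
qed

lemma oriental_simps:
  "icells (oriental n) = ocells n"
  "isrc (oriental n) k x p \<epsilon> = (if p < k then x p \<epsilon> else if p = k then x k False else 0)"
  "itgt (oriental n) k x p \<epsilon> = (if p < k then x p \<epsilon> else if p = k then x k True else 0)"
  "iidt (oriental n) k x = x"
  "icmp (oriental n) j k y x p \<epsilon> =
    (if p \<le> j then (if \<epsilon> then y p True else x p False) else y p \<epsilon> + x p \<epsilon>)"
  by (simp_all add: oriental_def)

lemma ocells_top: "x \<in> ocells n k \<Longrightarrow> x k False = x k True"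
  and ocells_above: "x \<in> ocells n k \<Longrightarrow> k < p \<Longrightarrow> x p \<epsilon> = 0"
  by (auto simp: ocells_def)

theorem strict_icat_oriental: "strict_icat (oriental n)"
proof -
  note simps = oriental_simps
  have bd: "x p \<epsilon> = (if p < k then x p \<epsilon> else if p = k then x k False else 0)"
    "x p \<epsilon> = (if p < k then x p \<epsilon> else if p = k then x k True else 0)"
    if "x \<in> ocells n k" for x k p \<epsilon>
    using ocells_top[OF that] ocells_above[OF that, of p \<epsilon>] by (cases \<epsilon>; simp)+
  show ?thesis
    unfolding strict_icat_def oriental_simps(1)
  proof (intro conjI allI impI ballI)
    fix k x assume "x \<in> ocells n (Suc k)"
    then show "isrc (oriental n) k x \<in> ocells n k" "itgt (oriental n) k x \<in> ocells n k"
      by (rule ocells_src, rule ocells_tgt)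
  next
    fix k x assume "x \<in> ocells n k"
    then show "iidt (oriental n) k x \<in> ocells n (Suc k)"
      unfolding simps by (rule ocells_idt)
  next
    fix j k y x assume "composable (oriental n) j k y x"
    then show "icmp (oriental n) j k y x \<in> ocells n k" by (rule ocells_cmp)
  next
    fix k x
    show "isrc (oriental n) k (isrc (oriental n) (Suc k) x) =
        isrc (oriental n) k (itgt (oriental n) (Suc k) x)"
      "itgt (oriental n) k (isrc (oriental n) (Suc k) x) =
        itgt (oriental n) k (itgt (oriental n) (Suc k) x)"
      by (intro ext; simp add: simps)+
  next
    fix k x assume "x \<in> ocells n k"
    from bd[OF this] show "isrc (oriental n) k (iidt (oriental n) k x) = x"
      "itgt (oriental n) k (iidt (oriental n) k x) = x"
      unfolding simps by (intro ext; metis simps(2,3))+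
  next
    fix k y x assume "composable (oriental n) k (Suc k) y x"
    then have "\<And>p \<epsilon>. p < k \<Longrightarrow> y p \<epsilon> = x p \<epsilon>" unfolding oriental_composable by blast
    then show "isrc (oriental n) k (icmp (oriental n) k (Suc k) y x) = isrc (oriental n) k x"
      "itgt (oriental n) k (icmp (oriental n) k (Suc k) y x) = itgt (oriental n) k y"
      by (intro ext; simp add: simps)+
  next
    fix j k y x assume "j < k \<and> composable (oriental n) j (Suc k) y x"
    then have "j < k" by blast
    then show "isrc (oriental n) k (icmp (oriental n) j (Suc k) y x) =
        icmp (oriental n) j k (isrc (oriental n) k y) (isrc (oriental n) k x)"
      "itgt (oriental n) k (icmp (oriental n) j (Suc k) y x) =
        icmp (oriental n) j k (itgt (oriental n) k y) (itgt (oriental n) k x)"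
      by (intro ext; simp add: simps)+
  next
    fix j k z y x
    show "icmp (oriental n) j k (icmp (oriental n) j k z y) x =
        icmp (oriental n) j k z (icmp (oriental n) j k y x)"
      by (intro ext) (simp add: simps add.assoc)
  next
    fix j k x assume *: "j < k" "x \<in> ocells n k"
    then have "j \<le> k" by simp
    show "icmp (oriental n) j k x (ito (oriental n) j k (sto (oriental n) j k x)) = x"
      unfolding oriental_ito oriental_sto[OF *(2) \<open>j \<le> k\<close>]
      by (intro ext) (simp add: simps)
    show "icmp (oriental n) j k (ito (oriental n) j k (tto (oriental n) j k x)) x = x"
      unfolding oriental_ito oriental_tto[OF *(2) \<open>j \<le> k\<close>]
      by (intro ext) (simp add: simps)
  next
    fix j k y x
    show "iidt (oriental n) k (icmp (oriental n) j k y x) =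
        icmp (oriental n) j (Suc k) (iidt (oriental n) k y) (iidt (oriental n) k x)"
      by (intro ext) (simp add: simps)
  next
    fix i j k y' y x' x
    assume "i < j \<and> composable (oriental n) j k y' y \<and> composable (oriental n) j k x' x \<and>
      composable (oriental n) i k y' x' \<and> composable (oriental n) i k y x"
    then have "i < j" by blast
    then show "icmp (oriental n) i k (icmp (oriental n) j k y' y) (icmp (oriental n) j k x' x) =
        icmp (oriental n) j k (icmp (oriental n) i k y' x') (icmp (oriental n) i k y x)"
      by (intro ext) (simp add: simps add.assoc add.left_commute)
  qed
qed

subsection \<open>The Street nerve is a simplicial set\<close>

definition push :: "(nat \<Rightarrow> nat) \<Rightarrow> nat list \<Rightarrow> chain" where
  "push \<phi> t = (if distinct (map \<phi> t) then frag_of (map \<phi> t) else 0)"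

lemma omap_push: "omap \<phi> x p \<epsilon> = frag_extend (push \<phi>) (x p \<epsilon>)"
  by (simp add: omap_def push_def[abs_def])

lemma frag_extend_extend:
  "frag_extend f (frag_extend g c) = frag_extend (\<lambda>t. frag_extend f (g t)) c"
  by (rule frag_induction[of c UNIV]) (simp_all add: frag_extend_diff)

lemma frag_extend_bdry:
  "bdry (frag_extend g c) = frag_extend (\<lambda>t. bdry (g t)) c"
  by (simp add: bdry_def frag_extend_extend)

lemma push_tuple:
  assumes "\<phi> \<in> delta m n" "t \<in> tuples m p" "distinct (map \<phi> t)"
  shows "map \<phi> t \<in> tuples n p"
proof -
  have mono: "mono_on {..m} \<phi>" and ran: "\<phi> \<in> {..m} \<rightarrow> {..n}" using assms(1) by (auto simp: delta_def)
  have t: "set t \<subseteq> {..m}" "sorted_wrt (<) t" using assms(2) by (auto simp: tuples_def)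
  have "sorted (map \<phi> t)"
    unfolding sorted_map
    by (rule sorted_wrt_mono_rel[OF _ t(2)]) (use mono t(1) in \<open>auto intro: mono_onD\<close>)
  then have "sorted_wrt (<) (map \<phi> t)" using assms(3) strict_sorted_iff by blast
  then show ?thesis using assms(2) ran t(1) by (auto simp: tuples_def)
qed

lemma push_pos_chains:
  assumes "\<phi> \<in> delta m n" "c \<in> pos_chains m p"
  shows "frag_extend (push \<phi>) c \<in> pos_chains n p"
proof -
  have c: "Poly_Mapping.keys c \<subseteq> tuples m p" "\<And>t. Poly_Mapping.lookup c t \<ge> 0"
    using assms(2) by (auto simp: pos_chains_def)
  have "Poly_Mapping.keys (frag_extend (push \<phi>) c) \<subseteq> tuples n p"
    using keys_frag_extend[of "push \<phi>" c] c(1) push_tuple[OF assms(1)]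
    by (fastforce simp: push_def keys_frag_of split: if_splits)
  moreover have "Poly_Mapping.lookup (frag_extend (push \<phi>) c) t \<ge> 0" for t
    unfolding frag_extend_def lookup_sum
    by (rule sum_nonneg) (simp add: c(2) push_def)
  ultimately show ?thesis by (simp add: pos_chains_def)
qed

lemma augm_push:
  assumes "c \<in> pos_chains m 0"
  shows "augm (frag_extend (push \<phi>) c) = augm c"
proof -
  have augm: "augm c = Poly_Mapping.lookup (frag_extend (\<lambda>_. frag_of ([] :: nat list)) c) []" for c
    by (simp add: augm_def frag_extend_def lookup_sum)
  have "distinct (map \<phi> t)" if "t \<in> Poly_Mapping.keys c" for t
  proof -
    have "length t = 1" using assms that by (auto simp: pos_chains_def tuples_def)
    then show ?thesis by (cases t) auto
  qed
  then have "frag_extend (\<lambda>t. frag_extend (\<lambda>_. frag_of ([] :: nat list)) (push \<phi> t)) c =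
      frag_extend (\<lambda>_. frag_of []) c"
    by (intro frag_extend_eq) (simp add: push_def)
  then show ?thesis by (simp add: augm frag_extend_extend)
qed

lemma nondistinct_sorted_adjacent:
  fixes u :: "nat list"
  assumes "sorted u" "\<not> distinct u"
  obtains i where "Suc i < length u" "u ! i = u ! Suc i"
proof -
  have "\<not> sorted_wrt (<) u" using assms strict_sorted_iff by blast
  then obtain i where i: "Suc i < length u" "\<not> u ! i < u ! Suc i"
    by (auto simp: sorted_wrt_iff_nth_Suc_transp)
  moreover have "u ! i \<le> u ! Suc i" using assms(1) i(1) by (simp add: sorted_iff_nth_Suc)
  ultimately show thesis using that by simp
qed

lemma bdry_push:
  assumes "\<phi> \<in> delta m n" "t \<in> tuples m p"
  shows "bdry (push \<phi> t) = frag_extend (push \<phi>) (bdry (frag_of t))"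
proof -
  let ?del = "\<lambda>k u. take k u @ drop (Suc k) (u :: nat list)"
  let ?u = "map \<phi> t"
  have del: "map \<phi> (?del k t) = ?del k ?u" for k by (simp add: take_map drop_map)
  have rhs: "frag_extend (push \<phi>) (bdry (frag_of t)) =
      (\<Sum>k<length t. frag_cmul ((-1) ^ k) (push \<phi> (?del k t)))"
    by (simp add: bdry_def frag_extend_sum o_def frag_extend_cmul)
  show ?thesis
  proof (cases "distinct ?u")
    case True
    then have "distinct (?del k ?u)" for k
      using set_take_disj_set_drop_if_distinct[OF True, of k "Suc k"] by simp
    then have "push \<phi> (?del k t) = frag_of (?del k ?u)" for k
      unfolding push_def del by simp
    then show ?thesis unfolding rhs using True by (simp add: push_def bdry_def)
  next
    case False
    have mono: "mono_on {..m} \<phi>" using assms(1) by (auto simp: delta_def)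
    have t: "set t \<subseteq> {..m}" "sorted_wrt (<) t" using assms(2) by (auto simp: tuples_def)
    have "sorted ?u"
      unfolding sorted_map
      by (rule sorted_wrt_mono_rel[OF _ t(2)]) (use mono t(1) in \<open>auto intro: mono_onD\<close>)
    then obtain i where i: "Suc i < length ?u" "?u ! i = ?u ! Suc i"
      using False by (rule nondistinct_sorted_adjacent)
    have zero: "push \<phi> (?del k t) = 0" if k: "k < length t" "k \<noteq> i" "k \<noteq> Suc i" for k
    proof -
      have "\<not> distinct (?del k ?u)"
      proof (cases "k < i")
        case True
        then have "drop (Suc k) ?u ! (i - Suc k) = drop (Suc k) ?u ! (Suc i - Suc k)"
          using i by (subst (1 2) nth_drop) simp_all
        moreover have "i - Suc k < length (drop (Suc k) ?u)" "Suc i - Suc k < length (drop (Suc k) ?u)"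
          "i - Suc k \<noteq> Suc i - Suc k" using True i by simp_all
        ultimately have "\<not> distinct (drop (Suc k) ?u)" by (meson nth_eq_iff_index_eq)
        then show ?thesis by simp
      next
        case False
        with k have "Suc i < k" by simp
        then have "take k ?u ! i = take k ?u ! Suc i" using i by simp
        moreover have "i < length (take k ?u)" "Suc i < length (take k ?u)" "i \<noteq> Suc i"
          using \<open>Suc i < k\<close> i by simp_all
        ultimately have "\<not> distinct (take k ?u)" by (meson nth_eq_iff_index_eq)
        then show ?thesis by simp
      qed
      then show ?thesis unfolding push_def del by simp
    qed
    have "?del i ?u = ?del (Suc i) ?u"
      using i by (simp add: take_Suc_conv_app_nth Cons_nth_drop_Suc[of "Suc i" ?u, symmetric]
          del: drop_Suc)
    then have same: "push \<phi> (?del i t) = push \<phi> (?del (Suc i) t)"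
      unfolding push_def del by simp
    have "(\<Sum>k<length t. frag_cmul ((-1) ^ k) (push \<phi> (?del k t))) =
        (\<Sum>k\<in>{i, Suc i}. frag_cmul ((-1) ^ k) (push \<phi> (?del k t)))"
      using i zero by (intro sum.mono_neutral_right) auto
    also have "\<dots> = 0"
      using same by (simp add: frag_cmul_distrib[symmetric])
    finally show ?thesis unfolding rhs using False by (simp add: push_def)
  qed
qed

lemma bdry_frag_extend_push:
  assumes "\<phi> \<in> delta m n" "c \<in> pos_chains m p"
  shows "bdry (frag_extend (push \<phi>) c) = frag_extend (push \<phi>) (bdry c)"
proof -
  have "Poly_Mapping.keys c \<subseteq> tuples m p" using assms(2) by (auto simp: pos_chains_def)
  then have "frag_extend (\<lambda>t. bdry (push \<phi> t)) c =
      frag_extend (\<lambda>t. frag_extend (push \<phi>) (bdry (frag_of t))) c"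
    by (intro frag_extend_eq bdry_push[OF assms(1)]) blast
  also have "\<dots> = frag_extend (push \<phi>) (bdry (frag_extend frag_of c))"
    by (simp add: frag_extend_bdry frag_extend_extend)
  finally show ?thesis by (simp add: frag_extend_bdry frag_expansion[symmetric])
qed

lemma omap_cells:
  assumes "\<phi> \<in> delta m n" "x \<in> icells (oriental m) k"
  shows "omap \<phi> x \<in> icells (oriental n) k"
proof -
  have x: "x \<in> ocells m k" using assms(2) by (simp add: oriental_simps)
  have pos: "x p \<epsilon> \<in> pos_chains m p" if "p \<le> k" for p \<epsilon>
    using x that by (simp add: ocells_def)
  have "bdry (omap \<phi> x p \<epsilon>) = omap \<phi> x (p - 1) True - omap \<phi> x (p - 1) False"
    if "p \<le> k" "p > 0" for p \<epsilon>
  proof -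
    have "bdry (x p \<epsilon>) = x (p - 1) True - x (p - 1) False" using x that by (simp add: ocells_def)
    then show ?thesis
      by (simp add: omap_push bdry_frag_extend_push[OF assms(1) pos[OF that(1)]] frag_extend_diff)
  qed
  moreover have "omap \<phi> x p \<epsilon> \<in> pos_chains n p" if "p \<le> k" for p \<epsilon>
    unfolding omap_push using push_pos_chains[OF assms(1) pos[OF that]] .
  moreover have "augm (omap \<phi> x 0 \<epsilon>) = 1" for \<epsilon>
    using x augm_push[OF pos[of 0 \<epsilon>]] by (simp add: omap_push ocells_def)
  moreover have "omap \<phi> x k False = omap \<phi> x k True" "\<And>p \<epsilon>. p > k \<Longrightarrow> omap \<phi> x p \<epsilon> = 0"
    using x by (simp_all add: omap_push ocells_def)
  ultimately show ?thesis
    unfolding oriental_simps ocells_def mem_Collect_eq by (intro conjI allI impI) simp_all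
qed

lemma ifunctor_omap:
  assumes "\<phi> \<in> delta m n"
  shows "ifunctor (oriental m) (oriental n) (\<lambda>k. \<lambda>x\<in>icells (oriental m) k. omap \<phi> x)"
  unfolding ifunctor_def
proof (intro conjI allI ballI impI)
  fix k show "(\<lambda>x\<in>icells (oriental m) k. omap \<phi> x) \<in>
      icells (oriental m) k \<rightarrow>\<^sub>E icells (oriental n) k"
    using omap_cells[OF assms] by auto
next
  fix k x assume x: "x \<in> icells (oriental m) (Suc k)"
  show "(\<lambda>x\<in>icells (oriental m) k. omap \<phi> x) (isrc (oriental m) k x) =
      isrc (oriental n) k ((\<lambda>x\<in>icells (oriental m) (Suc k). omap \<phi> x) x)"
    using x strict_icatD(1)[OF strict_icat_oriental x]
    by (auto simp: fun_eq_iff omap_push) (simp_all add: oriental_simps omap_push)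
  show "(\<lambda>x\<in>icells (oriental m) k. omap \<phi> x) (itgt (oriental m) k x) =
      itgt (oriental n) k ((\<lambda>x\<in>icells (oriental m) (Suc k). omap \<phi> x) x)"
    using x strict_icatD(2)[OF strict_icat_oriental x]
    by (auto simp: fun_eq_iff omap_push) (simp_all add: oriental_simps omap_push)
next
  fix k x assume x: "x \<in> icells (oriental m) k"
  then show "(\<lambda>x\<in>icells (oriental m) (Suc k). omap \<phi> x) (iidt (oriental m) k x) =
      iidt (oriental n) k ((\<lambda>x\<in>icells (oriental m) k. omap \<phi> x) x)"
    using strict_icatD(3)[OF strict_icat_oriental x] by (simp add: oriental_simps)
next
  fix j k y x assume c: "composable (oriental m) j k y x"
  then have "y \<in> icells (oriental m) k" "x \<in> icells (oriental m) k" by (auto simp: composable_def)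
  moreover have "omap \<phi> (icmp (oriental m) j k y x) =
      icmp (oriental n) j k (omap \<phi> y) (omap \<phi> x)"
    by (intro ext) (simp add: oriental_simps omap_push frag_extend_add)
  ultimately show "(\<lambda>x\<in>icells (oriental m) k. omap \<phi> x) (icmp (oriental m) j k y x) =
      icmp (oriental n) j k ((\<lambda>x\<in>icells (oriental m) k. omap \<phi> x) y)
        ((\<lambda>x\<in>icells (oriental m) k. omap \<phi> x) x)"
    using strict_icatD(4)[OF strict_icat_oriental c] by simp
qed

lemma omap_id:
  assumes "x \<in> icells (oriental n) k"
  shows "omap (restrict id {..n}) x = x"
proof (intro ext)
  fix p \<epsilon>
  have "Poly_Mapping.keys (x p \<epsilon>) \<subseteq> tuples n p"
    using assms by (cases "p \<le> k") (auto simp: oriental_simps ocells_def pos_chains_def)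
  moreover have "push (restrict id {..n}) t = frag_of t" if "t \<in> tuples n p" for t
  proof -
    have "map (restrict id {..n}) t = t"
      using that by (intro map_idI) (auto simp: tuples_def)
    then show ?thesis using that by (simp add: push_def tuples_def strict_sorted_iff)
  qed
  ultimately have "frag_extend (push (restrict id {..n})) (x p \<epsilon>) = frag_extend frag_of (x p \<epsilon>)"
    by (intro frag_extend_eq) blast
  then show "omap (restrict id {..n}) x p \<epsilon> = x p \<epsilon>"
    by (simp add: omap_push frag_expansion[symmetric])
qed

lemma omap_compose:
  assumes "\<phi> \<in> delta l m" "\<psi> \<in> delta m n" "x \<in> icells (oriental l) k"
  shows "omap (compose {..l} \<psi> \<phi>) x = omap \<psi> (omap \<phi> x)"
proof (intro ext)
  fix p \<epsilon>
  have "Poly_Mapping.keys (x p \<epsilon>) \<subseteq> tuples l p"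
    using assms by (cases "p \<le> k") (auto simp: oriental_simps ocells_def pos_chains_def)
  moreover have "push (compose {..l} \<psi> \<phi>) t = frag_extend (push \<psi>) (push \<phi> t)"
    if "t \<in> tuples l p" for t
  proof -
    have "map (compose {..l} \<psi> \<phi>) t = map \<psi> (map \<phi> t)"
      unfolding map_map using that by (intro map_cong) (auto simp: tuples_def compose_def)
    moreover have "distinct (map \<phi> t)" if "distinct (map \<psi> (map \<phi> t))"
      using that distinct_map by blast
    ultimately show ?thesis unfolding push_def by (simp del: map_map)
  qed
  ultimately have "frag_extend (push (compose {..l} \<psi> \<phi>)) (x p \<epsilon>) =
      frag_extend (\<lambda>t. frag_extend (push \<psi>) (push \<phi> t)) (x p \<epsilon>)"
    by (intro frag_extend_eq) blast
  then show "omap (compose {..l} \<psi> \<phi>) x p \<epsilon> = omap \<psi> (omap \<phi> x) p \<epsilon>"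
    by (simp add: omap_push frag_extend_extend)
qed

theorem is_sset_nerve: "is_sset (nerve X)"
  unfolding is_sset_def
proof (intro conjI allI ballI)
  fix m n \<phi> F assume \<phi>: "\<phi> \<in> delta m n" and F: "F \<in> simp (nerve X) n"
  have "fcomp (oriental m) F (\<lambda>k. \<lambda>x\<in>icells (oriental m) k. omap \<phi> x) =
      fcomp (oriental m) F (\<lambda>k. omap \<phi>)"
    by (auto simp: fcomp_def compose_def fun_eq_iff)
  then show "sact (nerve X) m n \<phi> F \<in> simp (nerve X) m"
    using ifunctor_fcomp[OF strict_icat_oriental ifunctor_omap[OF \<phi>], of X F] F
    by (simp add: nerve_def)
next
  fix n F assume "F \<in> simp (nerve X) n"
  then have F: "ifunctor (oriental n) X F" by (simp add: nerve_def)
  show "sact (nerve X) n n (restrict id {..n}) F = F"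
  proof (intro ext)
    fix k x show "sact (nerve X) n n (restrict id {..n}) F k x = F k x"
      using ifunctorD(1)[OF F, of k] omap_id[of x n k]
      by (cases "x \<in> icells (oriental n) k") (auto simp: nerve_def fcomp_def compose_def)
  qed
next
  fix l m n \<phi> \<psi> F assume \<phi>: "\<phi> \<in> delta l m" and \<psi>: "\<psi> \<in> delta m n"
  show "sact (nerve X) l n (compose {..l} \<psi> \<phi>) F =
      sact (nerve X) l m \<phi> (sact (nerve X) m n \<psi> F)"
    using omap_compose[OF \<phi> \<psi>] omap_cells[OF \<phi>]
    by (intro ext) (simp add: nerve_def fcomp_def compose_def restrict_def)
qed

subsection \<open>\<open>c_inf S\<close> is a strict \<open>\<infinity>\<close>-category\<close>

lemma ceq_refl1: "ceq S k t u \<Longrightarrow> ceq S k t t"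
  by (meson ceq_sym ceq_trans)

lemma ceq_refl2: "ceq S k t u \<Longrightarrow> ceq S k u u"
  by (meson ceq_sym ceq_trans)

lemma raw_simps [simp]: "isrc raw_terms = CSrc" "itgt raw_terms = CTgt" "iidt raw_terms = CIdt"
  by (simp_all add: raw_terms_def)

lemma ceq_sto: "ceq S k t u \<Longrightarrow> j \<le> k \<Longrightarrow> ceq S j (sto raw_terms j k t) (sto raw_terms j k u)"
proof (induction k arbitrary: t u)
  case (Suc k)
  then show ?case by (cases "j = Suc k") (auto intro: ceq_src)
qed simp

lemma ceq_tto: "ceq S k t u \<Longrightarrow> j \<le> k \<Longrightarrow> ceq S j (tto raw_terms j k t) (tto raw_terms j k u)"
proof (induction k arbitrary: t u)
  case (Suc k)
  then show ?case by (cases "j = Suc k") (auto intro: ceq_tgt)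
qed simp

lemma ceq_ito: "ceq S j t u \<Longrightarrow> j \<le> k \<Longrightarrow> ceq S k (ito raw_terms j k t) (ito raw_terms j k u)"
proof (induction k)
  case (Suc k)
  then show ?case by (cases "j = Suc k") (auto intro: ceq_idt)
qed simp

lemma ceq_glob_step:
  assumes "ceq S (Suc k) t t" "i < k"
  shows "ceq S i (sto raw_terms i k (CSrc k t)) (sto raw_terms i k (CTgt k t))"
    and "ceq S i (tto raw_terms i k (CSrc k t)) (tto raw_terms i k (CTgt k t))"
proof -
  obtain l where "k = Suc l" "i \<le> l" using assms(2) by (cases k) auto
  with assms show "ceq S i (sto raw_terms i k (CSrc k t)) (sto raw_terms i k (CTgt k t))"
    "ceq S i (tto raw_terms i k (CSrc k t)) (tto raw_terms i k (CTgt k t))"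
    by (auto intro!: ceq_sto ceq_tto intro: glob_src glob_tgt)
qed

lemma ceq_sto_tto:
  "ceq S k t t \<Longrightarrow> i < j \<Longrightarrow> j \<le> k \<Longrightarrow>
    ceq S i (sto raw_terms i j (tto raw_terms j k t)) (sto raw_terms i k t)"
proof (induction k arbitrary: t)
  case (Suc k)
  show ?case
  proof (cases "j = Suc k")
    case True
    then show ?thesis using Suc.prems by (auto intro: ceq_sto ceq_src)
  next
    case False
    then have "j \<le> k" "i < k" using Suc.prems by simp_all
    then show ?thesis
      using Suc.IH[OF ceq_tgt[OF Suc.prems(1)] Suc.prems(2) \<open>j \<le> k\<close>]
        ceq_glob_step(1)[OF Suc.prems(1) \<open>i < k\<close>]
      by simp (meson ceq_sym ceq_trans)
  qed
qed simp

lemma ceq_tto_sto: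
  "ceq S k t t \<Longrightarrow> i < j \<Longrightarrow> j \<le> k \<Longrightarrow>
    ceq S i (tto raw_terms i j (sto raw_terms j k t)) (tto raw_terms i k t)"
proof (induction k arbitrary: t)
  case (Suc k)
  show ?case
  proof (cases "j = Suc k")
    case True
    then show ?thesis using Suc.prems by (auto intro: ceq_tto ceq_tgt)
  next
    case False
    then have "j \<le> k" "i < k" using Suc.prems by simp_all
    then show ?thesis
      using Suc.IH[OF ceq_src[OF Suc.prems(1)] Suc.prems(2) \<open>j \<le> k\<close>]
        ceq_glob_step(2)[OF Suc.prems(1) \<open>i < k\<close>]
      by simp (meson ceq_sym ceq_trans)
  qed
qed simp

lemma ito_ends:
  assumes "ceq S j u u" "j \<le> k"
  shows "ceq S j (sto raw_terms j k (ito raw_terms j k u)) u"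
    and "ceq S j (tto raw_terms j k (ito raw_terms j k u)) u"
proof -
  have "ceq S j (sto raw_terms j k (ito raw_terms j k u)) u \<and>
    ceq S j (tto raw_terms j k (ito raw_terms j k u)) u"
    using assms(2)
  proof (induction k)
    case (Suc k)
    show ?case
    proof (cases "j = Suc k")
      case False
      with Suc have "j \<le> k" by simp
      note it = ceq_ito[OF assms(1) this]
      have "ceq S j (sto raw_terms j k (CSrc k (CIdt k (ito raw_terms j k u))))
          (sto raw_terms j k (ito raw_terms j k u))"
        "ceq S j (tto raw_terms j k (CTgt k (CIdt k (ito raw_terms j k u))))
          (tto raw_terms j k (ito raw_terms j k u))"
        using it \<open>j \<le> k\<close> by (auto intro!: ceq_sto ceq_tto src_idt tgt_idt)
      then show ?thesis
        using Suc.IH[OF \<open>j \<le> k\<close>] \<open>j \<le> k\<close> by simp (meson ceq_trans)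
    qed (use assms in simp)
  qed (use assms in simp)
  then show "ceq S j (sto raw_terms j k (ito raw_terms j k u)) u"
    "ceq S j (tto raw_terms j k (ito raw_terms j k u)) u" by blast+
qed

lemma ccomposable_src_tgt:
  assumes "j < k" "ccomposable (ceq S) j (Suc k) y x"
  shows "ccomposable (ceq S) j k (CSrc k y) (CSrc k x)"
    and "ccomposable (ceq S) j k (CTgt k y) (CTgt k x)"
proof -
  have y: "ceq S (Suc k) y y" and x: "ceq S (Suc k) x x" using assms by blast+
  have s0: "ceq S j (sto raw_terms j k (CSrc k y)) (tto raw_terms j k (CTgt k x))"
    using assms by simp
  show "ccomposable (ceq S) j k (CSrc k y) (CSrc k x)"
    using \<open>j < k\<close> ceq_src[OF y] ceq_src[OF x] s0 ceq_glob_step[OF x \<open>j < k\<close>]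
    by (meson ceq_sym ceq_trans)
  show "ccomposable (ceq S) j k (CTgt k y) (CTgt k x)"
    using \<open>j < k\<close> ceq_tgt[OF y] ceq_tgt[OF x] s0 ceq_glob_step[OF y \<open>j < k\<close>]
    by (meson ceq_sym ceq_trans)
qed

lemma cmp_sto:
  "ccomposable (ceq S) j k y x \<Longrightarrow> j \<le> i \<Longrightarrow> i \<le> k \<Longrightarrow>
    ceq S i (sto raw_terms i k (CCmp j k y x))
      (if i = j then sto raw_terms j k x else CCmp j i (sto raw_terms i k y) (sto raw_terms i k x))"
proof (induction k arbitrary: y x)
  case (Suc k)
  have c: "ccomposable (ceq S) j (Suc k) y x" by (rule Suc.prems)
  consider "i = Suc k" | "i \<le> k" "j = k" | "i \<le> k" "j < k" using Suc.prems(2,3) c by linarith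
  then show ?case
  proof cases
    case 1
    moreover have "ceq S (Suc k) (CCmp j (Suc k) y x) (CCmp j (Suc k) y x)"
      using c by (intro ceq_cmp) auto
    ultimately show ?thesis using c by simp
  next
    case 2
    then have "i = k" using Suc.prems(2) by simp
    moreover have "ceq S k (CSrc k (CCmp k (Suc k) y x)) (CSrc k x)"
      using c 2 by (intro src_cmp) simp
    ultimately show ?thesis using 2 by simp
  next
    case 3
    have "ceq S k (CSrc k (CCmp j (Suc k) y x)) (CCmp j k (CSrc k y) (CSrc k x))"
      by (rule src_cmp_less[OF 3(2) c])
    from ceq_sto[OF this 3(1)] Suc.IH[OF ccomposable_src_tgt(1)[OF 3(2) c] Suc.prems(2) 3(1)]
    show ?thesis using 3 by (simp split: if_splits) (meson ceq_trans)+
  qed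
qed simp

lemma cmp_tto:
  "ccomposable (ceq S) j k y x \<Longrightarrow> j \<le> i \<Longrightarrow> i \<le> k \<Longrightarrow>
    ceq S i (tto raw_terms i k (CCmp j k y x))
      (if i = j then tto raw_terms j k y else CCmp j i (tto raw_terms i k y) (tto raw_terms i k x))"
proof (induction k arbitrary: y x)
  case (Suc k)
  have c: "ccomposable (ceq S) j (Suc k) y x" by (rule Suc.prems)
  consider "i = Suc k" | "i \<le> k" "j = k" | "i \<le> k" "j < k" using Suc.prems(2,3) c by linarith
  then show ?case
  proof cases
    case 1
    moreover have "ceq S (Suc k) (CCmp j (Suc k) y x) (CCmp j (Suc k) y x)"
      using c by (intro ceq_cmp) auto
    ultimately show ?thesis using c by simp
  next
    case 2
    then have "i = k" using Suc.prems(2) by simp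
    moreover have "ceq S k (CTgt k (CCmp k (Suc k) y x)) (CTgt k y)"
      using c 2 by (intro tgt_cmp) simp
    ultimately show ?thesis using 2 by simp
  next
    case 3
    have "ceq S k (CTgt k (CCmp j (Suc k) y x)) (CCmp j k (CTgt k y) (CTgt k x))"
      by (rule tgt_cmp_less[OF 3(2) c])
    from ceq_tto[OF this 3(1)] Suc.IH[OF ccomposable_src_tgt(2)[OF 3(2) c] Suc.prems(2) 3(1)]
    show ?thesis using 3 by (simp split: if_splits) (meson ceq_trans)+
  qed
qed simp

lemma assoc_ccomposable:
  assumes c1: "ccomposable (ceq S) j k z y" and c2: "ccomposable (ceq S) j k y x"
  shows "ccomposable (ceq S) j k (CCmp j k z y) x"
    and "ccomposable (ceq S) j k z (CCmp j k y x)"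
proof -
  have "j < k" using c1 by simp
  have "ceq S j (sto raw_terms j k (CCmp j k z y)) (sto raw_terms j k y)"
    "ceq S j (tto raw_terms j k (CCmp j k y x)) (tto raw_terms j k y)"
    using cmp_sto[OF c1, of j] cmp_tto[OF c2, of j] \<open>j < k\<close> by simp_all
  moreover have "ceq S k (CCmp j k z y) (CCmp j k z y)" "ceq S k (CCmp j k y x) (CCmp j k y x)"
    using c1 c2 by (auto intro: ceq_cmp)
  ultimately show "ccomposable (ceq S) j k (CCmp j k z y) x"
    "ccomposable (ceq S) j k z (CCmp j k y x)"
    using c1 c2 by (meson ceq_trans ceq_sym)+
qed

lemma interchange_ccomposable:
  assumes "i < j" and c1: "ccomposable (ceq S) j k y' y" and c2: "ccomposable (ceq S) j k x' x"
    and c3: "ccomposable (ceq S) i k y' x'" and c4: "ccomposable (ceq S) i k y x"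
  shows "ccomposable (ceq S) i k (CCmp j k y' y) (CCmp j k x' x)"
    and "ccomposable (ceq S) j k (CCmp i k y' x') (CCmp i k y x)"
proof -
  have "j < k" "i < k" "i \<le> j" using c1 c3 \<open>i < j\<close> by simp_all
  have "i \<le> k" "j \<le> k" using \<open>i < k\<close> \<open>j < k\<close> by simp_all
  have wfy: "ceq S k y' y'" and wfx: "ceq S k x' x'" using c1 c2 by blast+
  have r: "ceq S k (CCmp j k y' y) (CCmp j k y' y)" "ceq S k (CCmp j k x' x) (CCmp j k x' x)"
    "ceq S k (CCmp i k y' x') (CCmp i k y' x')" "ceq S k (CCmp i k y x) (CCmp i k y x)"
    using c1 c2 c3 c4 by (auto intro!: ceq_cmp)
  show "ccomposable (ceq S) i k (CCmp j k y' y) (CCmp j k x' x)"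
  proof -
    have "ceq S j (sto raw_terms j k (CCmp j k y' y)) (sto raw_terms j k y)"
      using cmp_sto[OF c1, of j] \<open>j < k\<close> by simp
    from ceq_sto[OF this \<open>i \<le> j\<close>]
    have 1: "ceq S i (sto raw_terms i k (CCmp j k y' y)) (sto raw_terms i k y)"
      by (simp add: sto_sto \<open>i \<le> j\<close> \<open>j \<le> k\<close>)
    have "ceq S j (tto raw_terms j k (CCmp j k x' x)) (tto raw_terms j k x')"
      using cmp_tto[OF c2, of j] \<open>j < k\<close> by simp
    from ceq_tto[OF this \<open>i \<le> j\<close>]
    have 2: "ceq S i (tto raw_terms i k (CCmp j k x' x)) (tto raw_terms i k x')"
      by (simp add: tto_tto \<open>i \<le> j\<close> \<open>j \<le> k\<close>)
    have "ceq S j (sto raw_terms j k x') (tto raw_terms j k x)" using c2 by blast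
    from ceq_tto[OF this \<open>i \<le> j\<close>]
    have "ceq S i (tto raw_terms i j (sto raw_terms j k x')) (tto raw_terms i k x)"
      by (simp add: tto_tto \<open>i \<le> j\<close> \<open>j \<le> k\<close>)
    then have "ceq S i (tto raw_terms i k x) (tto raw_terms i k x')"
      using ceq_tto_sto[OF wfx \<open>i < j\<close> \<open>j \<le> k\<close>] by (meson ceq_sym ceq_trans)
    moreover have "ceq S i (sto raw_terms i k y) (tto raw_terms i k x)" using c4 by blast
    ultimately have "ceq S i (sto raw_terms i k (CCmp j k y' y)) (tto raw_terms i k (CCmp j k x' x))"
      using 1 2 by (meson ceq_sym ceq_trans)
    then show ?thesis using r \<open>i < k\<close> by blast
  qed
  show "ccomposable (ceq S) j k (CCmp i k y' x') (CCmp i k y x)"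
  proof -
    have 1: "ceq S j (sto raw_terms j k (CCmp i k y' x'))
        (CCmp i j (sto raw_terms j k y') (sto raw_terms j k x'))"
      using cmp_sto[OF c3, of j] \<open>i < j\<close> \<open>j < k\<close> by simp
    have 2: "ceq S j (tto raw_terms j k (CCmp i k y x))
        (CCmp i j (tto raw_terms j k y) (tto raw_terms j k x))"
      using cmp_tto[OF c4, of j] \<open>i < j\<close> \<open>j < k\<close> by simp
    have "ceq S i (sto raw_terms i k y') (tto raw_terms i k x')" using c3 by blast
    then have "ceq S i (sto raw_terms i j (sto raw_terms j k y'))
        (tto raw_terms i j (sto raw_terms j k x'))"
      using ceq_tto_sto[OF wfx \<open>i < j\<close> \<open>j \<le> k\<close>]
      unfolding sto_sto[OF \<open>i \<le> j\<close> \<open>j \<le> k\<close>] by (meson ceq_sym ceq_trans)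
    then have "ccomposable (ceq S) i j (sto raw_terms j k y') (sto raw_terms j k x')"
      using \<open>i < j\<close> ceq_sto[OF wfy \<open>j \<le> k\<close>] ceq_sto[OF wfx \<open>j \<le> k\<close>] by blast
    then have "ceq S j (CCmp i j (sto raw_terms j k y') (sto raw_terms j k x'))
        (CCmp i j (tto raw_terms j k y) (tto raw_terms j k x))"
      by (rule ceq_cmp) (use c1 c2 in blast)+
    with 1 2 have "ceq S j (sto raw_terms j k (CCmp i k y' x')) (tto raw_terms j k (CCmp i k y x))"
      by (meson ceq_sym ceq_trans)
    then show ?thesis using r \<open>j < k\<close> by blast
  qed
qed

lemma ccls_eq_iff: "ceq S k t t \<Longrightarrow> ccls S k t = ccls S k u \<longleftrightarrow> ceq S k t u"
  unfolding ccls_def by (auto intro: ceq_sym ceq_trans)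

lemma ccls_eqI: "ceq S k t u \<Longrightarrow> ccls S k t = ccls S k u"
  using ccls_eq_iff ceq_refl1 by blast

lemma crep_ccls: "ceq S k t t \<Longrightarrow> ceq S k t (crep (ccls S k t))"
  unfolding crep_def ccls_def by (rule someI2[of _ t]) auto

lemma c_inf_cells: "C \<in> icells (c_inf S) k \<longleftrightarrow> (\<exists>t. C = ccls S k t \<and> ceq S k t t)"
  by (auto simp: c_inf_def)

lemma c_inf_cellsI: "ceq S k t u \<Longrightarrow> ccls S k t \<in> icells (c_inf S) k"
  using c_inf_cells ceq_refl1 by blast

lemma c_inf_src: "ceq S (Suc k) t t \<Longrightarrow> isrc (c_inf S) k (ccls S (Suc k) t) = ccls S k (CSrc k t)"
  by (simp add: c_inf_def) (metis ccls_eqI ceq_src crep_ccls)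

lemma c_inf_tgt: "ceq S (Suc k) t t \<Longrightarrow> itgt (c_inf S) k (ccls S (Suc k) t) = ccls S k (CTgt k t)"
  by (simp add: c_inf_def) (metis ccls_eqI ceq_tgt crep_ccls)

lemma c_inf_idt: "ceq S k t t \<Longrightarrow> iidt (c_inf S) k (ccls S k t) = ccls S (Suc k) (CIdt k t)"
  by (simp add: c_inf_def) (metis ccls_eqI ceq_idt crep_ccls)

lemma c_inf_cmp:
  assumes "ccomposable (ceq S) j k y x"
  shows "icmp (c_inf S) j k (ccls S k y) (ccls S k x) = ccls S k (CCmp j k y x)"
proof -
  have "ceq S k (CCmp j k y x) (CCmp j k (crep (ccls S k y)) (crep (ccls S k x)))"
    using assms by (intro ceq_cmp) (auto intro: crep_ccls)
  then show ?thesis by (simp add: c_inf_def ccls_eqI)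
qed

lemma c_inf_sto:
  "ceq S k t t \<Longrightarrow> j \<le> k \<Longrightarrow> sto (c_inf S) j k (ccls S k t) = ccls S j (sto raw_terms j k t)"
proof (induction k arbitrary: t)
  case (Suc k)
  then show ?case by (cases "j = Suc k") (auto simp: c_inf_src intro: ceq_src)
qed simp

lemma c_inf_tto:
  "ceq S k t t \<Longrightarrow> j \<le> k \<Longrightarrow> tto (c_inf S) j k (ccls S k t) = ccls S j (tto raw_terms j k t)"
proof (induction k arbitrary: t)
  case (Suc k)
  then show ?case by (cases "j = Suc k") (auto simp: c_inf_tgt intro: ceq_tgt)
qed simp

lemma c_inf_ito:
  "ceq S j t t \<Longrightarrow> j \<le> k \<Longrightarrow> ito (c_inf S) j k (ccls S j t) = ccls S k (ito raw_terms j k t)"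
proof (induction k)
  case (Suc k)
  show ?case
  proof (cases "j = Suc k")
    case False
    with Suc have "j \<le> k" by simp
    then show ?thesis using Suc.IH[OF Suc.prems(1)] c_inf_idt[OF ceq_ito[OF Suc.prems(1)]] by simp
  qed simp
qed simp

lemma c_inf_composable:
  assumes "ceq S k y y" "ceq S k x x"
  shows "composable (c_inf S) j k (ccls S k y) (ccls S k x) \<longleftrightarrow> ccomposable (ceq S) j k y x"
proof (cases "j < k")
  case True
  then have "ceq S j (sto raw_terms j k y) (sto raw_terms j k y)"
    using assms by (auto intro: ceq_sto)
  with True assms show ?thesis
    by (simp add: composable_def c_inf_sto c_inf_tto ccls_eq_iff c_inf_cellsI)
qed (simp add: composable_def)

lemma c_inf_composableE:
  assumes "composable (c_inf S) j k D C"
  obtains y x where "D = ccls S k y" "C = ccls S k x" "ccomposable (ceq S) j k y x"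
proof -
  from assms obtain y x where "D = ccls S k y" "C = ccls S k x" "ceq S k y y" "ceq S k x x"
    unfolding composable_def c_inf_cells by blast
  with assms c_inf_composable that show thesis by blast
qed

theorem strict_icat_c_inf: "strict_icat (c_inf S)"
  unfolding strict_icat_def
proof (intro conjI allI impI ballI)
  fix k C assume "C \<in> icells (c_inf S) (Suc k)"
  then obtain t where t: "C = ccls S (Suc k) t" "ceq S (Suc k) t t" unfolding c_inf_cells by blast
  show "isrc (c_inf S) k C \<in> icells (c_inf S) k" "itgt (c_inf S) k C \<in> icells (c_inf S) k"
    using c_inf_cellsI[OF ceq_src[OF t(2)]] c_inf_cellsI[OF ceq_tgt[OF t(2)]]
    by (simp_all add: t(1) c_inf_src[OF t(2)] c_inf_tgt[OF t(2)])
next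
  fix k C assume "C \<in> icells (c_inf S) k"
  then obtain t where t: "C = ccls S k t" "ceq S k t t" unfolding c_inf_cells by blast
  show "iidt (c_inf S) k C \<in> icells (c_inf S) (Suc k)"
    using c_inf_cellsI[OF ceq_idt[OF t(2)]] by (simp add: t(1) c_inf_idt[OF t(2)])
  show "isrc (c_inf S) k (iidt (c_inf S) k C) = C"
    unfolding t(1) c_inf_idt[OF t(2)] c_inf_src[OF ceq_idt[OF t(2)]]
    by (rule ccls_eqI) (rule src_idt[OF t(2)])
  show "itgt (c_inf S) k (iidt (c_inf S) k C) = C"
    unfolding t(1) c_inf_idt[OF t(2)] c_inf_tgt[OF ceq_idt[OF t(2)]]
    by (rule ccls_eqI) (rule tgt_idt[OF t(2)])
next
  fix j k D C assume "composable (c_inf S) j k D C"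
  then obtain y x where *: "D = ccls S k y" "C = ccls S k x" and c: "ccomposable (ceq S) j k y x"
    by (rule c_inf_composableE)
  have cc: "ceq S k (CCmp j k y x) (CCmp j k y x)" using c by (intro ceq_cmp) auto
  show "icmp (c_inf S) j k D C \<in> icells (c_inf S) k"
    unfolding * c_inf_cmp[OF c] by (rule c_inf_cellsI[OF cc])
  have y: "ceq S k y y" and x: "ceq S k x x" using c by blast+
  note ic = idt_cmp[OF c]
  have ci: "ccomposable (ceq S) j (Suc k) (CIdt k y) (CIdt k x)"
  proof (intro conjI)
    show "ceq S (Suc k) (CIdt k y) (CIdt k y)" "ceq S (Suc k) (CIdt k x) (CIdt k x)"
      using c by (auto intro: ceq_idt)
    have "ceq S j (sto raw_terms j k (CSrc k (CIdt k y))) (sto raw_terms j k y)"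
      "ceq S j (tto raw_terms j k (CTgt k (CIdt k x))) (tto raw_terms j k x)"
      using c by (auto intro!: ceq_sto ceq_tto src_idt tgt_idt)
    then show "ceq S j (sto raw_terms j (Suc k) (CIdt k y)) (tto raw_terms j (Suc k) (CIdt k x))"
      using c by simp (meson ceq_sym ceq_trans)
  qed (use c in auto)
  show "iidt (c_inf S) k (icmp (c_inf S) j k D C) =
      icmp (c_inf S) j (Suc k) (iidt (c_inf S) k D) (iidt (c_inf S) k C)"
    unfolding * c_inf_cmp[OF c] c_inf_idt[OF cc] c_inf_idt[OF y] c_inf_idt[OF x] c_inf_cmp[OF ci]
    by (rule ccls_eqI) (rule ic)
next
  fix k C assume "C \<in> icells (c_inf S) (Suc (Suc k))"
  then obtain t where t: "C = ccls S (Suc (Suc k)) t" "ceq S (Suc (Suc k)) t t"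
    unfolding c_inf_cells by blast
  note [simp] = t(1) c_inf_src[OF t(2)] c_inf_tgt[OF t(2)] c_inf_src[OF ceq_src[OF t(2)]]
    c_inf_src[OF ceq_tgt[OF t(2)]] c_inf_tgt[OF ceq_src[OF t(2)]] c_inf_tgt[OF ceq_tgt[OF t(2)]]
  show "isrc (c_inf S) k (isrc (c_inf S) (Suc k) C) = isrc (c_inf S) k (itgt (c_inf S) (Suc k) C)"
    by simp (rule ccls_eqI, rule glob_src[OF t(2)])
  show "itgt (c_inf S) k (isrc (c_inf S) (Suc k) C) = itgt (c_inf S) k (itgt (c_inf S) (Suc k) C)"
    by simp (rule ccls_eqI, rule glob_tgt[OF t(2)])
next
  fix k D C assume "composable (c_inf S) k (Suc k) D C"
  then obtain y x where *: "D = ccls S (Suc k) y" "C = ccls S (Suc k) x"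
    and c: "ccomposable (ceq S) k (Suc k) y x"
    by (rule c_inf_composableE)
  have cc: "ceq S (Suc k) (CCmp k (Suc k) y x) (CCmp k (Suc k) y x)"
    using c by (intro ceq_cmp) auto
  have y: "ceq S (Suc k) y y" and x: "ceq S (Suc k) x x" using c by blast+
  show "isrc (c_inf S) k (icmp (c_inf S) k (Suc k) D C) = isrc (c_inf S) k C"
    unfolding * c_inf_cmp[OF c] c_inf_src[OF cc] c_inf_src[OF x]
    by (rule ccls_eqI) (rule src_cmp[OF c])
  show "itgt (c_inf S) k (icmp (c_inf S) k (Suc k) D C) = itgt (c_inf S) k D"
    unfolding * c_inf_cmp[OF c] c_inf_tgt[OF cc] c_inf_tgt[OF y]
    by (rule ccls_eqI) (rule tgt_cmp[OF c])
next
  fix j k D C assume "j < k \<and> composable (c_inf S) j (Suc k) D C"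
  then have "j < k" and comp: "composable (c_inf S) j (Suc k) D C" by blast+
  from comp obtain y x where *: "D = ccls S (Suc k) y" "C = ccls S (Suc k) x"
    and c: "ccomposable (ceq S) j (Suc k) y x"
    by (rule c_inf_composableE)
  have cc: "ceq S (Suc k) (CCmp j (Suc k) y x) (CCmp j (Suc k) y x)"
    using c by (intro ceq_cmp) auto
  have y: "ceq S (Suc k) y y" and x: "ceq S (Suc k) x x" using c by blast+
  note cs = ccomposable_src_tgt(1)[OF \<open>j < k\<close> c] and ct = ccomposable_src_tgt(2)[OF \<open>j < k\<close> c]
  show "isrc (c_inf S) k (icmp (c_inf S) j (Suc k) D C) =
      icmp (c_inf S) j k (isrc (c_inf S) k D) (isrc (c_inf S) k C)"
    unfolding * c_inf_cmp[OF c] c_inf_src[OF cc] c_inf_src[OF x] c_inf_src[OF y] c_inf_cmp[OF cs]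
    by (rule ccls_eqI) (rule src_cmp_less[OF \<open>j < k\<close> c])
  show "itgt (c_inf S) k (icmp (c_inf S) j (Suc k) D C) =
      icmp (c_inf S) j k (itgt (c_inf S) k D) (itgt (c_inf S) k C)"
    unfolding * c_inf_cmp[OF c] c_inf_tgt[OF cc] c_inf_tgt[OF x] c_inf_tgt[OF y] c_inf_cmp[OF ct]
    by (rule ccls_eqI) (rule tgt_cmp_less[OF \<open>j < k\<close> c])
next
  fix j k E D C
  assume a: "composable (c_inf S) j k E D \<and> composable (c_inf S) j k D C"
  then obtain z y x where *: "E = ccls S k z" "D = ccls S k y" "C = ccls S k x"
    and wf: "ceq S k z z" "ceq S k y y" "ceq S k x x"
    unfolding composable_def c_inf_cells by blast
  from a have c1: "ccomposable (ceq S) j k z y" and c2: "ccomposable (ceq S) j k y x"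
    unfolding * using wf by (simp_all add: c_inf_composable)
  note as = assoc[OF c1 c2]
  note c3 = assoc_ccomposable(1)[OF c1 c2] and c4 = assoc_ccomposable(2)[OF c1 c2]
  show "icmp (c_inf S) j k (icmp (c_inf S) j k E D) C =
      icmp (c_inf S) j k E (icmp (c_inf S) j k D C)"
    unfolding * c_inf_cmp[OF c1] c_inf_cmp[OF c2] c_inf_cmp[OF c3] c_inf_cmp[OF c4]
    by (rule ccls_eqI) (rule as)
next
  fix j k C assume "j < k" "C \<in> icells (c_inf S) k"
  then obtain t where t: "C = ccls S k t" "ceq S k t t" unfolding c_inf_cells by blast
  have "j \<le> k" using \<open>j < k\<close> by simp
  note st = ceq_sto[OF t(2) \<open>j \<le> k\<close>] and tt = ceq_tto[OF t(2) \<open>j \<le> k\<close>]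
  have c1: "ccomposable (ceq S) j k t (ito raw_terms j k (sto raw_terms j k t))"
    using \<open>j < k\<close> t(2) ceq_ito[OF st \<open>j \<le> k\<close>] st ito_ends[OF st \<open>j \<le> k\<close>]
    by (meson ceq_sym)
  have c2: "ccomposable (ceq S) j k (ito raw_terms j k (tto raw_terms j k t)) t"
    using \<open>j < k\<close> t(2) ceq_ito[OF tt \<open>j \<le> k\<close>] tt ito_ends[OF tt \<open>j \<le> k\<close>]
    by (meson ceq_sym)
  show "icmp (c_inf S) j k C (ito (c_inf S) j k (sto (c_inf S) j k C)) = C"
    unfolding t(1) c_inf_sto[OF t(2) \<open>j \<le> k\<close>] c_inf_ito[OF st \<open>j \<le> k\<close>] c_inf_cmp[OF c1]
    by (rule ccls_eqI) (rule unit_src[OF \<open>j < k\<close> t(2)])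
  show "icmp (c_inf S) j k (ito (c_inf S) j k (tto (c_inf S) j k C)) C = C"
    unfolding t(1) c_inf_tto[OF t(2) \<open>j \<le> k\<close>] c_inf_ito[OF tt \<open>j \<le> k\<close>] c_inf_cmp[OF c2]
    by (rule ccls_eqI) (rule unit_tgt[OF \<open>j < k\<close> t(2)])
next
  fix i j k D' D C' C
  assume a: "i < j \<and> composable (c_inf S) j k D' D \<and> composable (c_inf S) j k C' C \<and>
    composable (c_inf S) i k D' C' \<and> composable (c_inf S) i k D C"
  then obtain y' y x' x where *: "D' = ccls S k y'" "D = ccls S k y" "C' = ccls S k x'" "C = ccls S k x"
    and wf: "ceq S k y' y'" "ceq S k y y" "ceq S k x' x'" "ceq S k x x"
    unfolding composable_def c_inf_cells by blast
  from a have "i < j" and c1: "ccomposable (ceq S) j k y' y" and c2: "ccomposable (ceq S) j k x' x"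
    and c3: "ccomposable (ceq S) i k y' x'" and c4: "ccomposable (ceq S) i k y x"
    unfolding * using wf by (simp_all add: c_inf_composable)
  note ic = interchange[OF \<open>i < j\<close> c1 c2 c3 c4]
  note c5 = interchange_ccomposable(1)[OF \<open>i < j\<close> c1 c2 c3 c4]
    and c6 = interchange_ccomposable(2)[OF \<open>i < j\<close> c1 c2 c3 c4]
  show "icmp (c_inf S) i k (icmp (c_inf S) j k D' D) (icmp (c_inf S) j k C' C) =
      icmp (c_inf S) j k (icmp (c_inf S) i k D' C') (icmp (c_inf S) i k D C)"
    unfolding * c_inf_cmp[OF c1] c_inf_cmp[OF c2] c_inf_cmp[OF c3] c_inf_cmp[OF c4]
      c_inf_cmp[OF c5] c_inf_cmp[OF c6]
    by (rule ccls_eqI) (rule ic)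
qed

subsection \<open>The universal property\<close>

lemma ceq_gen_sto:
  assumes "s \<in> simp S n"
  shows "x \<in> icells (oriental n) k \<Longrightarrow> j \<le> k \<Longrightarrow>
    ceq S j (CGen j n s (sto (oriental n) j k x)) (sto raw_terms j k (CGen k n s x))"
proof (induction k arbitrary: x)
  case 0
  then show ?case using assms by (auto intro: gen)
next
  case (Suc k)
  show ?case
  proof (cases "j = Suc k")
    case True
    then show ?thesis using Suc.prems assms by (auto intro: gen)
  next
    case False
    then have "j \<le> k" using Suc.prems by simp
    then show ?thesis
      using Suc.IH[OF strict_icatD(1)[OF strict_icat_oriental Suc.prems(1)] \<open>j \<le> k\<close>]
        ceq_sto[OF gen_src[OF assms Suc.prems(1)] \<open>j \<le> k\<close>]
      by simp (meson ceq_trans)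
  qed
qed

lemma ceq_gen_tto:
  assumes "s \<in> simp S n"
  shows "x \<in> icells (oriental n) k \<Longrightarrow> j \<le> k \<Longrightarrow>
    ceq S j (CGen j n s (tto (oriental n) j k x)) (tto raw_terms j k (CGen k n s x))"
proof (induction k arbitrary: x)
  case 0
  then show ?case using assms by (auto intro: gen)
next
  case (Suc k)
  show ?case
  proof (cases "j = Suc k")
    case True
    then show ?thesis using Suc.prems assms by (auto intro: gen)
  next
    case False
    then have "j \<le> k" using Suc.prems by simp
    then show ?thesis
      using Suc.IH[OF strict_icatD(2)[OF strict_icat_oriental Suc.prems(1)] \<open>j \<le> k\<close>]
        ceq_tto[OF gen_tgt[OF assms Suc.prems(1)] \<open>j \<le> k\<close>]
      by simp (meson ceq_trans)
  qed
qed

lemma c_unit_apply: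
  "s \<in> simp S n \<Longrightarrow> x \<in> icells (oriental n) k \<Longrightarrow> c_unit S n s k x = ccls S k (CGen k n s x)"
  by (simp add: c_unit_def)

lemma ifunctor_c_unit:
  assumes s: "s \<in> simp S n"
  shows "ifunctor (oriental n) (c_inf S) (c_unit S n s)"
  unfolding ifunctor_def
proof (intro conjI allI ballI impI)
  fix k show "c_unit S n s k \<in> icells (oriental n) k \<rightarrow>\<^sub>E icells (c_inf S) k"
    using s by (auto simp: c_unit_def intro!: c_inf_cellsI gen)
next
  fix k x assume x: "x \<in> icells (oriental n) (Suc k)"
  note x' = strict_icatD(1,2)[OF strict_icat_oriental x]
  show "c_unit S n s k (isrc (oriental n) k x) = isrc (c_inf S) k (c_unit S n s (Suc k) x)"
    "c_unit S n s k (itgt (oriental n) k x) = itgt (c_inf S) k (c_unit S n s (Suc k) x)"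
    unfolding c_unit_apply[OF s x] c_unit_apply[OF s x'(1)] c_unit_apply[OF s x'(2)]
      c_inf_src[OF gen[OF s x]] c_inf_tgt[OF gen[OF s x]]
    by (rule ccls_eqI, rule gen_src[OF s x]) (rule ccls_eqI, rule gen_tgt[OF s x])
next
  fix k x assume x: "x \<in> icells (oriental n) k"
  note x' = strict_icatD(3)[OF strict_icat_oriental x]
  show "c_unit S n s (Suc k) (iidt (oriental n) k x) = iidt (c_inf S) k (c_unit S n s k x)"
    unfolding c_unit_apply[OF s x] c_unit_apply[OF s x'] c_inf_idt[OF gen[OF s x]]
    by (rule ccls_eqI, rule gen_idt[OF s x])
next
  fix j k y x assume c: "composable (oriental n) j k y x"
  then have y: "y \<in> icells (oriental n) k" and x: "x \<in> icells (oriental n) k" and "j < k"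
    and e: "sto (oriental n) j k y = tto (oriental n) j k x"
    by (auto simp: composable_def)
  have "ceq S j (sto raw_terms j k (CGen k n s y)) (tto raw_terms j k (CGen k n s x))"
    using ceq_gen_sto[OF s y, of j] ceq_gen_tto[OF s x, of j] \<open>j < k\<close> e
    by simp (meson ceq_sym ceq_trans)
  then have cc: "ccomposable (ceq S) j k (CGen k n s y) (CGen k n s x)"
    using \<open>j < k\<close> gen[OF s y] gen[OF s x] by blast
  note c' = strict_icatD(4)[OF strict_icat_oriental c]
  show "c_unit S n s k (icmp (oriental n) j k y x) =
      icmp (c_inf S) j k (c_unit S n s k y) (c_unit S n s k x)"
    unfolding c_unit_apply[OF s x] c_unit_apply[OF s y] c_unit_apply[OF s c'] c_inf_cmp[OF cc]
    by (rule ccls_eqI, rule gen_cmp[OF s c])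
qed

theorem smap_c_unit:
  assumes "is_sset S"
  shows "smap S (nerve (c_inf S)) (c_unit S)"
  unfolding smap_def
proof (intro conjI allI ballI)
  fix n show "c_unit S n \<in> simp S n \<rightarrow>\<^sub>E simp (nerve (c_inf S)) n"
    by (auto simp: nerve_def ifunctor_c_unit) (simp add: c_unit_def)
next
  fix m n \<phi> s assume \<phi>: "\<phi> \<in> delta m n" and s: "s \<in> simp S n"
  have s': "sact S m n \<phi> s \<in> simp S m" using assms \<phi> s unfolding is_sset_def by blast
  show "c_unit S m (sact S m n \<phi> s) = sact (nerve (c_inf S)) m n \<phi> (c_unit S n s)"
  proof (intro ext)
    fix k x
    show "c_unit S m (sact S m n \<phi> s) k x = sact (nerve (c_inf S)) m n \<phi> (c_unit S n s) k x"
    proof (cases "x \<in> icells (oriental m) k")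
      case True
      then have "omap \<phi> x \<in> icells (oriental n) k" using omap_cells[OF \<phi>] by blast
      with True show ?thesis
        using ccls_eqI[OF gen_act[OF \<phi> s True]]
        by (simp add: nerve_def fcomp_def compose_def c_unit_apply s s')
    next
      case False
      then show ?thesis using s' by (simp add: nerve_def fcomp_def compose_def c_unit_def)
    qed
  qed
qed

fun ceval :: "'c icat \<Rightarrow> (nat \<Rightarrow> 's \<Rightarrow> nat \<Rightarrow> ocell \<Rightarrow> 'c) \<Rightarrow> 's cterm \<Rightarrow> 'c" where
  "ceval X g (CGen k n s x) = g n s k x"
| "ceval X g (CSrc k t) = isrc X k (ceval X g t)"
| "ceval X g (CTgt k t) = itgt X k (ceval X g t)"
| "ceval X g (CIdt k t) = iidt X k (ceval X g t)"
| "ceval X g (CCmp j k t u) = icmp X j k (ceval X g t) (ceval X g u)"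

lemma ceval_sto: "ceval X g (sto raw_terms j k t) = sto X j k (ceval X g t)"
  by (induction k arbitrary: t) auto

lemma ceval_tto: "ceval X g (tto raw_terms j k t) = tto X j k (ceval X g t)"
  by (induction k arbitrary: t) auto

lemma ceval_ito: "ceval X g (ito raw_terms j k t) = ito X j k (ceval X g t)"
  by (induction k arbitrary: t) auto

lemma ceval_sound:
  assumes X: "strict_icat X" and g: "smap S (nerve X) g"
  shows "ceq S k t u \<Longrightarrow> ceval X g t \<in> icells X k \<and> ceval X g t = ceval X g u"
proof (induction rule: ceq.induct)
  case (unit_src j k x)
  then show ?case by (simp add: ceval_ito ceval_sto strict_icatD(14)[OF X])
next
  case (unit_tgt j k x)
  then show ?case by (simp add: ceval_ito ceval_tto strict_icatD(15)[OF X])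
next
  case (assoc j k z y x)
  let ?e = "ceval X g"
  from assoc have c: "composable X j k (?e z) (?e y)" "composable X j k (?e y) (?e x)"
    by (simp_all add: composable_def ceval_sto ceval_tto)
  have "j < k" using c by (simp add: composable_def)
  have "composable X j k (icmp X j k (?e z) (?e y)) (?e x)"
    using c strict_icatD(4)[OF X c(1)] sto_icmp[OF X c(1)]
    by (simp add: composable_def)
  from strict_icatD(4)[OF X this] strict_icatD(13)[OF X c] show ?case by simp
next
  case (gen s n x k)
  have "ifunctor (oriental n) X (g n s)" using g gen by (auto simp: smap_def nerve_def)
  then show ?case using gen ifunctorD(2) by fastforce
next
  case (gen_src s n x k)
  have F: "ifunctor (oriental n) X (g n s)" using g gen_src by (auto simp: smap_def nerve_def)
  show ?case
    using ifunctorD(2)[OF F strict_icatD(1)[OF strict_icat_oriental gen_src(2)]]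
      ifunctorD(3)[OF F gen_src(2)] by simp
next
  case (gen_tgt s n x k)
  have F: "ifunctor (oriental n) X (g n s)" using g gen_tgt by (auto simp: smap_def nerve_def)
  show ?case
    using ifunctorD(2)[OF F strict_icatD(2)[OF strict_icat_oriental gen_tgt(2)]]
      ifunctorD(4)[OF F gen_tgt(2)] by simp
next
  case (gen_idt s n x k)
  have F: "ifunctor (oriental n) X (g n s)" using g gen_idt by (auto simp: smap_def nerve_def)
  show ?case
    using ifunctorD(2)[OF F strict_icatD(3)[OF strict_icat_oriental gen_idt(2)]]
      ifunctorD(5)[OF F gen_idt(2)] by simp
next
  case (gen_cmp s n j k y x)
  have F: "ifunctor (oriental n) X (g n s)" using g gen_cmp by (auto simp: smap_def nerve_def)
  show ?case
    using ifunctorD(2)[OF F strict_icatD(4)[OF strict_icat_oriental gen_cmp(2)]]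
      ifunctorD(6)[OF F gen_cmp(2)] by simp
next
  case (gen_act \<phi> m n s x k)
  have F: "ifunctor (oriental n) X (g n s)" using g gen_act by (auto simp: smap_def nerve_def)
  have "g m (sact S m n \<phi> s) = sact (nerve X) m n \<phi> (g n s)"
    using g gen_act unfolding smap_def by blast
  then have "g m (sact S m n \<phi> s) k x = g n s k (omap \<phi> x)"
    using gen_act by (simp add: nerve_def fcomp_def compose_def)
  moreover have "omap \<phi> x \<in> icells (oriental n) k" using omap_cells gen_act by blast
  ultimately show ?case using ifunctorD(2)[OF F] by simp
next
  case (interchange i j k y' y x' x)
  let ?e = "ceval X g"
  from interchange have "i < j"
    and c: "composable X j k (?e y') (?e y)" "composable X j k (?e x') (?e x)"
      "composable X i k (?e y') (?e x')" "composable X i k (?e y) (?e x)"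
    by (simp_all add: composable_def ceval_sto ceval_tto)
  have "composable X i k (icmp X j k (?e y') (?e y)) (icmp X j k (?e x') (?e x))"
    by (rule interchange_composable[OF X \<open>i < j\<close> c])
  from strict_icatD(4)[OF X this] strict_icatD(17)[OF X \<open>i < j\<close> c] show ?case by simp
next
  case (idt_cmp j k y x)
  then have c: "composable X j k (ceval X g y) (ceval X g x)"
    by (simp add: composable_def ceval_sto ceval_tto)
  from strict_icatD(3)[OF X strict_icatD(4)[OF X c]] strict_icatD(16)[OF X c] show ?case by simp
next
  case (src_cmp k y x)
  then have c: "composable X k (Suc k) (ceval X g y) (ceval X g x)"
    by (simp add: composable_def ceval_sto ceval_tto)
  then have "ceval X g x \<in> icells X (Suc k)" by (simp add: composable_def)
  then show ?case using strict_icatD(9)[OF X c] strict_icatD(1)[OF X] by simp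
next
  case (tgt_cmp k y x)
  then have c: "composable X k (Suc k) (ceval X g y) (ceval X g x)"
    by (simp add: composable_def ceval_sto ceval_tto)
  then have "ceval X g y \<in> icells X (Suc k)" by (simp add: composable_def)
  then show ?case using strict_icatD(10)[OF X c] strict_icatD(2)[OF X] by simp
next
  case (src_cmp_less j k y x)
  then have c: "composable X j (Suc k) (ceval X g y) (ceval X g x)" and "j < k"
    by (simp_all add: composable_def ceval_sto ceval_tto)
  then show ?case using strict_icatD(11)[OF X _ c] strict_icatD(1)[OF X strict_icatD(4)[OF X c]] by simp
next
  case (tgt_cmp_less j k y x)
  then have c: "composable X j (Suc k) (ceval X g y) (ceval X g x)" and "j < k"
    by (simp_all add: composable_def ceval_sto ceval_tto)
  then show ?case using strict_icatD(12)[OF X _ c] strict_icatD(2)[OF X strict_icatD(4)[OF X c]] by simp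
next
  case (ceq_cmp j k y x y' x')
  then have "composable X j k (ceval X g y) (ceval X g x)"
    by (simp add: composable_def ceval_sto ceval_tto)
  then show ?case using ceq_cmp strict_icatD(4)[OF X] by simp
qed (auto intro: strict_icatD[OF X] simp: strict_icatD(7,8)[OF X])

theorem c_inf_universal:
  assumes X: "strict_icat X" and g: "smap S (nerve X) g"
  shows "\<exists>!F. ifunctor (c_inf S) X F \<and>
    (\<forall>n. \<forall>s\<in>simp S n. fcomp (oriental n) F (c_unit S n s) = g n s)"
proof (rule ex_ex1I)
  let ?e = "ceval X g"
  define F where "F = (\<lambda>k. \<lambda>C\<in>icells (c_inf S) k. ?e (crep C))"
  have Fc: "F k (ccls S k t) = ?e t" "?e t \<in> icells X k" if "ceq S k t t" for k t
    using ceval_sound[OF X g crep_ccls[OF that]] c_inf_cellsI[OF that] by (auto simp: F_def)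
  have "ifunctor (c_inf S) X F"
    unfolding ifunctor_def
  proof (intro conjI allI ballI impI)
    fix k show "F k \<in> icells (c_inf S) k \<rightarrow>\<^sub>E icells X k"
    proof (rule PiE_I)
      fix C assume "C \<in> icells (c_inf S) k"
      then obtain t where "C = ccls S k t" "ceq S k t t" unfolding c_inf_cells by blast
      then show "F k C \<in> icells X k" using Fc by simp
    qed (simp add: F_def)
  next
    fix k C assume "C \<in> icells (c_inf S) (Suc k)"
    then obtain t where t: "C = ccls S (Suc k) t" "ceq S (Suc k) t t" unfolding c_inf_cells by blast
    then show "F k (isrc (c_inf S) k C) = isrc X k (F (Suc k) C)"
      "F k (itgt (c_inf S) k C) = itgt X k (F (Suc k) C)"
      using Fc(1)[OF t(2)] Fc(1)[OF ceq_src[OF t(2)]] Fc(1)[OF ceq_tgt[OF t(2)]]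
      by (simp_all add: c_inf_src c_inf_tgt)
  next
    fix k C assume "C \<in> icells (c_inf S) k"
    then obtain t where t: "C = ccls S k t" "ceq S k t t" unfolding c_inf_cells by blast
    then show "F (Suc k) (iidt (c_inf S) k C) = iidt X k (F k C)"
      using Fc(1)[OF t(2)] Fc(1)[OF ceq_idt[OF t(2)]] by (simp add: c_inf_idt)
  next
    fix j k D C assume "composable (c_inf S) j k D C"
    then obtain y x where *: "D = ccls S k y" "C = ccls S k x" and c: "ccomposable (ceq S) j k y x"
      by (rule c_inf_composableE)
    have "ceq S k y y" "ceq S k x x" "ceq S k (CCmp j k y x) (CCmp j k y x)"
      using c by (auto intro: ceq_cmp)
    from this[THEN Fc(1)] show "F k (icmp (c_inf S) j k D C) = icmp X j k (F k D) (F k C)"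
      unfolding * c_inf_cmp[OF c] by simp
  qed
  moreover have "fcomp (oriental n) F (c_unit S n s) = g n s" if s: "s \<in> simp S n" for n s
  proof (intro ext)
    fix k x
    have G: "ifunctor (oriental n) X (g n s)" using g s by (auto simp: smap_def nerve_def)
    show "fcomp (oriental n) F (c_unit S n s) k x = g n s k x"
    proof (cases "x \<in> icells (oriental n) k")
      case True
      then show ?thesis using Fc(1)[OF gen[OF s True]]
        by (simp add: fcomp_def compose_def c_unit_apply s)
    next
      case False
      then show ?thesis using ifunctorD(1)[OF G, of k] by (auto simp: fcomp_def compose_def)
    qed
  qed
  ultimately show "\<exists>F. ifunctor (c_inf S) X F \<and>
      (\<forall>n. \<forall>s\<in>simp S n. fcomp (oriental n) F (c_unit S n s) = g n s)"
    by blast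
next
  fix F G
  assume F: "ifunctor (c_inf S) X F \<and>
      (\<forall>n. \<forall>s\<in>simp S n. fcomp (oriental n) F (c_unit S n s) = g n s)"
    and G: "ifunctor (c_inf S) X G \<and>
      (\<forall>n. \<forall>s\<in>simp S n. fcomp (oriental n) G (c_unit S n s) = g n s)"
  have ev: "H k (ccls S k t) = ceval X g t"
    if H: "ifunctor (c_inf S) X H"
      "\<And>n s. s \<in> simp S n \<Longrightarrow> fcomp (oriental n) H (c_unit S n s) = g n s"
    and t: "ceq S k t u" for H k t u
  proof -
    let ?e = "ceval X g"
    have src: "H k (ccls S k (CSrc k t)) = ?e (CSrc k t)"
      if "ceq S (Suc k) t t" "H (Suc k) (ccls S (Suc k) t) = ?e t" for k t
      using that ifunctorD(3)[OF H(1) c_inf_cellsI[OF that(1)]] by (simp add: c_inf_src)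
    have tgt: "H k (ccls S k (CTgt k t)) = ?e (CTgt k t)"
      if "ceq S (Suc k) t t" "H (Suc k) (ccls S (Suc k) t) = ?e t" for k t
      using that ifunctorD(4)[OF H(1) c_inf_cellsI[OF that(1)]] by (simp add: c_inf_tgt)
    have idt: "H (Suc k) (ccls S (Suc k) (CIdt k t)) = ?e (CIdt k t)"
      if "ceq S k t t" "H k (ccls S k t) = ?e t" for k t
      using that ifunctorD(5)[OF H(1) c_inf_cellsI[OF that(1)]] by (simp add: c_inf_idt)
    have cmp: "H k (ccls S k (CCmp j k y x)) = ?e (CCmp j k y x)"
      if c: "ccomposable (ceq S) j k y x" and h: "H k (ccls S k y) = ?e y" "H k (ccls S k x) = ?e x"
      for j k y x
    proof -
      have "composable (c_inf S) j k (ccls S k y) (ccls S k x)"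
        using c c_inf_composable by blast
      from ifunctorD(6)[OF H(1) this] show ?thesis using h by (simp add: c_inf_cmp[OF c])
    qed
    have gen': "H k (ccls S k (CGen k n s x)) = ?e (CGen k n s x)"
      if s: "s \<in> simp S n" and x: "x \<in> icells (oriental n) k" for n s k x
      using fun_cong[OF fun_cong[OF H(2)[OF s]], of k x] x
      by (simp add: fcomp_def compose_def c_unit_apply[OF s x])
    have swap: "H k (ccls S k t) = ?e t" if "ceq S k t u" "H k (ccls S k u) = ?e u" for k t u
      using that ccls_eqI[OF that(1)] ceval_sound[OF X g that(1)] by simp
    have refl: "ceq S k (CCmp j k y x) (CCmp j k y x)" if "ccomposable (ceq S) j k y x" for j k y x
      using that by (intro ceq_cmp) auto
    show ?thesis
      using t
    proof (induction rule: ceq.induct)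
      case (ceq_sym k t u)
      show ?case by (rule swap[OF ceq.ceq_sym[OF ceq_sym(1)] ceq_sym(2)])
    next
      case (ceq_src k t u)
      show ?case by (rule src[OF ceq_refl1[OF ceq_src(1)] ceq_src(2)])
    next
      case (ceq_tgt k t u)
      show ?case by (rule tgt[OF ceq_refl1[OF ceq_tgt(1)] ceq_tgt(2)])
    next
      case (ceq_idt k t u)
      show ?case by (rule idt[OF ceq_refl1[OF ceq_idt(1)] ceq_idt(2)])
    next
      case (ceq_cmp j k y x y' x')
      then show ?case by (intro cmp) blast+
    next
      case (glob_src k x)
      show ?case by (rule src[OF ceq.ceq_src[OF glob_src(1)] src[OF glob_src]])
    next
      case (glob_tgt k x)
      show ?case by (rule tgt[OF ceq.ceq_src[OF glob_tgt(1)] src[OF glob_tgt]])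
    next
      case (src_idt k x)
      show ?case by (rule src[OF ceq.ceq_idt[OF src_idt(1)] idt[OF src_idt]])
    next
      case (tgt_idt k x)
      show ?case by (rule tgt[OF ceq.ceq_idt[OF tgt_idt(1)] idt[OF tgt_idt]])
    next
      case (src_cmp k y x)
      then have c: "ccomposable (ceq S) k (Suc k) y x" by blast
      show ?case by (rule src[OF refl[OF c] cmp[OF c]]) (use src_cmp in blast)+
    next
      case (tgt_cmp k y x)
      then have c: "ccomposable (ceq S) k (Suc k) y x" by blast
      show ?case by (rule tgt[OF refl[OF c] cmp[OF c]]) (use tgt_cmp in blast)+
    next
      case (src_cmp_less j k y x)
      then have c: "ccomposable (ceq S) j (Suc k) y x" by blast
      show ?case by (rule src[OF refl[OF c] cmp[OF c]]) (use src_cmp_less in blast)+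
    next
      case (tgt_cmp_less j k y x)
      then have c: "ccomposable (ceq S) j (Suc k) y x" by blast
      show ?case by (rule tgt[OF refl[OF c] cmp[OF c]]) (use tgt_cmp_less in blast)+
    next
      case (assoc j k z y x)
      then have c: "ccomposable (ceq S) j k z y" "ccomposable (ceq S) j k y x" by blast+
      show ?case by (rule cmp[OF assoc_ccomposable(1)[OF c] cmp[OF c(1)]]) (use assoc in blast)+
    next
      case (unit_src j k x)
      show ?case by (rule swap[OF ceq.unit_src[OF unit_src(1,2)] unit_src(3)])
    next
      case (unit_tgt j k x)
      show ?case by (rule swap[OF ceq.unit_tgt[OF unit_tgt(1,2)] unit_tgt(3)])
    next
      case (idt_cmp j k y x)
      then have c: "ccomposable (ceq S) j k y x" by blast
      show ?case by (rule idt[OF refl[OF c] cmp[OF c]]) (use idt_cmp in blast)+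
    next
      case (interchange i j k y' y x' x)
      then have "i < j" and c: "ccomposable (ceq S) j k y' y" "ccomposable (ceq S) j k x' x"
        "ccomposable (ceq S) i k y' x'" "ccomposable (ceq S) i k y x" by blast+
      show ?case
        by (rule cmp[OF interchange_ccomposable(1)[OF \<open>i < j\<close> c] cmp[OF c(1)] cmp[OF c(2)]])
          (use interchange in blast)+
    next
      case (gen s n x k)
      then show ?case by (rule gen')
    next
      case (gen_src s n x k)
      then show ?case by (intro gen' strict_icatD(1)[OF strict_icat_oriental])
    next
      case (gen_tgt s n x k)
      then show ?case by (intro gen' strict_icatD(2)[OF strict_icat_oriental])
    next
      case (gen_idt s n x k)
      then show ?case by (intro gen' strict_icatD(3)[OF strict_icat_oriental])
    next
      case (gen_cmp s n j k y x)
      then show ?case by (intro gen' strict_icatD(4)[OF strict_icat_oriental])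
    next
      case (gen_act \<phi> m n s x k)
      show ?case
        by (rule swap[OF ceq.gen_act[OF gen_act] gen'[OF gen_act(2) omap_cells[OF gen_act(1,3)]]])
    qed
  qed
  show "F = G"
  proof (intro ext)
    fix k C
    show "F k C = G k C"
    proof (cases "C \<in> icells (c_inf S) k")
      case True
      then obtain t where "C = ccls S k t" "ceq S k t t" unfolding c_inf_cells by blast
      then show ?thesis using ev[of F k t t] ev[of G k t t] F G by simp
    next
      case False
      then show ?thesis
        using ifunctorD(1)[OF conjunct1[OF F], of k] ifunctorD(1)[OF conjunct1[OF G], of k]
        by (auto simp: PiE_def extensional_def)
    qed
  qed
qed


section \<open>Categories\<close>

record ('o, 'a) cat =
  obj :: "'o set"
  arr :: "'a set"
  cdom :: "'a \<Rightarrow> 'o"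
  ccod :: "'a \<Rightarrow> 'o"
  cone :: "'o \<Rightarrow> 'a"
  ccmp :: "'a \<Rightarrow> 'a \<Rightarrow> 'a"

text \<open>\<open>ccmp A g f\<close> is \<open>g \<circ> f\<close>.\<close>

definition category :: "('o, 'a) cat \<Rightarrow> bool" where
  "category A \<longleftrightarrow>
    (\<forall>f\<in>arr A. cdom A f \<in> obj A \<and> ccod A f \<in> obj A) \<and>
    (\<forall>a\<in>obj A. cone A a \<in> arr A \<and> cdom A (cone A a) = a \<and> ccod A (cone A a) = a) \<and>
    (\<forall>f\<in>arr A. \<forall>g\<in>arr A. cdom A g = ccod A f \<longrightarrow>
       ccmp A g f \<in> arr A \<and> cdom A (ccmp A g f) = cdom A f \<and> ccod A (ccmp A g f) = ccod A g) \<and>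
    (\<forall>f\<in>arr A. ccmp A f (cone A (cdom A f)) = f \<and> ccmp A (cone A (ccod A f)) f = f) \<and>
    (\<forall>f\<in>arr A. \<forall>g\<in>arr A. \<forall>h\<in>arr A. cdom A g = ccod A f \<and> cdom A h = ccod A g \<longrightarrow>
       ccmp A (ccmp A h g) f = ccmp A h (ccmp A g f))"

definition is_identity :: "('o, 'a) cat \<Rightarrow> 'a \<Rightarrow> bool" where
  "is_identity A f \<longleftrightarrow> (\<exists>a\<in>obj A. f = cone A a)"

definition split_mono :: "('o, 'a) cat \<Rightarrow> 'a \<Rightarrow> bool" where
  "split_mono A f \<longleftrightarrow> f \<in> arr A \<and>
    (\<exists>g\<in>arr A. cdom A g = ccod A f \<and> ccod A g = cdom A f \<and> ccmp A g f = cone A (cdom A f))"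

definition split_epi :: "('o, 'a) cat \<Rightarrow> 'a \<Rightarrow> bool" where
  "split_epi A f \<longleftrightarrow> f \<in> arr A \<and>
    (\<exists>g\<in>arr A. cdom A g = ccod A f \<and> ccod A g = cdom A f \<and> ccmp A f g = cone A (ccod A f))"

definition split_free :: "('o, 'a) cat \<Rightarrow> bool" where
  "split_free A \<longleftrightarrow> (\<forall>f. split_mono A f \<or> split_epi A f \<longrightarrow> is_identity A f)"

text \<open>A category as a strict \<open>\<infinity>\<close>-category whose cells of dimension at least two are identities:
  for every \<open>k \<ge> 1\<close> the \<open>k\<close>-cells are the arrows. Cells composable along \<open>j \<ge> 1\<close> are equal, so that
  their composite is either of them.\<close>

definition icat_of_cat :: "('o, 'a) cat \<Rightarrow> ('o + 'a) icat" where
  "icat_of_cat A =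
    \<lparr>icells = (\<lambda>k. if k = 0 then Inl ` obj A else Inr ` arr A),
     isrc = (\<lambda>k x. if k = 0 then Inl (cdom A (projr x)) else x),
     itgt = (\<lambda>k x. if k = 0 then Inl (ccod A (projr x)) else x),
     iidt = (\<lambda>k x. if k = 0 then Inr (cone A (projl x)) else x),
     icmp = (\<lambda>j k y x. if j = 0 then Inr (ccmp A (projr y) (projr x)) else x)\<rparr>"


section \<open>The \<open>\<infinity>\<close>-category \<open>\<tilde>A\<close>\<close>

text \<open>A \<open>1\<close>-cell \<open>a \<rightarrow> a'\<close> is a pair \<open>(a, fs)\<close>; the source has to be recorded for \<open>fs = []\<close>, and
  the target is then determined.\<close>

fun is_path :: "('o, 'a) cat \<Rightarrow> 'o \<Rightarrow> 'a list \<Rightarrow> bool" where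
  "is_path A a [] \<longleftrightarrow> a \<in> obj A"
| "is_path A a (f # fs) \<longleftrightarrow>
    f \<in> arr A \<and> \<not> is_identity A f \<and> cdom A f = a \<and> is_path A (ccod A f) fs"

fun path_end :: "('o, 'a) cat \<Rightarrow> 'o \<times> 'a list \<Rightarrow> 'o" where
  "path_end A (a, fs) = (if fs = [] then a else ccod A (last fs))"

definition paths :: "('o, 'a) cat \<Rightarrow> ('o \<times> 'a list) set" where
  "paths A = {(a, fs). is_path A a fs}"

abbreviation plen :: "'o \<times> 'a list \<Rightarrow> nat" where
  "plen x \<equiv> length (snd x)"

definition pconcat :: "'o \<times> 'a list \<Rightarrow> 'o \<times> 'a list \<Rightarrow> 'o \<times> 'a list" where
  "pconcat x y = (fst x, snd x @ snd y)"

fun arr_composite :: "('o, 'a) cat \<Rightarrow> 'a list \<Rightarrow> 'a" where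
  "arr_composite A [f] = f"
| "arr_composite A (f # g # fs) = ccmp A (arr_composite A (g # fs)) f"

text \<open>The index set of the coproduct for \<open>x = (f\<^sub>1, \<dots>, f\<^sub>m)\<close> and \<open>y = (g\<^sub>1, \<dots>, g\<^sub>n)\<close>; as lists are indexed
  from \<open>0\<close>, \<open>f\<^sub>i\<close> is \<open>snd x ! (i - 1)\<close>, and the segment \<open>g\<^bsub>\<phi>(i-1)+1\<^esub>, \<dots>, g\<^bsub>\<phi>(i)\<^esub>\<close> consists of the
  list entries with indices from \<open>\<phi> (i - 1)\<close> up to, but excluding, \<open>\<phi> i\<close>.\<close>

definition refinements ::
    "('o, 'a) cat \<Rightarrow> 'o \<times> 'a list \<Rightarrow> 'o \<times> 'a list \<Rightarrow> (nat \<Rightarrow> nat) set" where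
  "refinements A x y = {\<phi> \<in> {..plen x} \<rightarrow>\<^sub>E {..plen y}.
     strict_mono_on {..plen x} \<phi> \<and> \<phi> 0 = 0 \<and> \<phi> (plen x) = plen y \<and>
     (\<forall>i\<in>{1..plen x}.
        arr_composite A (map ((!) (snd y)) [\<phi> (i - 1)..<\<phi> i]) = snd x ! (i - 1))}"

text \<open>\<open>obr m \<phi>\<close> is the \<open>1\<close>-cell \<open>[\<phi>]\<close>, and \<open>obr n id\<close> is \<open>[n]\<^sub>m\<^sub>a\<^sub>x\<close>.\<close>

definition obr :: "nat \<Rightarrow> (nat \<Rightarrow> nat) \<Rightarrow> ocell" where
  "obr m \<phi> = (\<lambda>p \<epsilon>.
    if p = 0 then frag_of [if \<epsilon> then \<phi> m else \<phi> 0]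
    else if p = 1 then (\<Sum>i\<in>{1..m}. frag_of [\<phi> (i - 1), \<phi> i])
    else 0)"

definition map_concat :: "nat \<Rightarrow> nat \<Rightarrow> nat \<Rightarrow> (nat \<Rightarrow> nat) \<Rightarrow> (nat \<Rightarrow> nat) \<Rightarrow> nat \<Rightarrow> nat" where
  "map_concat l l' p \<phi> \<phi>' = (\<lambda>i\<in>{..l + l'}. if i \<le> l then \<phi> i else p + \<phi>' (i - l))"

text \<open>\<open>THi x y \<phi> \<alpha>\<close> is the cell \<open>\<alpha>\<close> in the summand of the hom \<open>\<infinity>\<close>-category from \<open>x\<close> to \<open>y\<close> indexed
  by \<open>\<phi>\<close>.\<close>

datatype ('o, 'a) tcell =
    TObj 'o
  | TOne "'o \<times> 'a list"
  | THi "'o \<times> 'a list" "'o \<times> 'a list" "nat \<Rightarrow> nat" ocell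

fun tilde_cells :: "('o, 'a) cat \<Rightarrow> nat \<Rightarrow> ('o, 'a) tcell set" where
  "tilde_cells A 0 = TObj ` obj A"
| "tilde_cells A (Suc 0) = TOne ` paths A"
| "tilde_cells A (Suc (Suc j)) = {THi x y \<phi> \<alpha> | x y \<phi> \<alpha>.
     x \<in> paths A \<and> y \<in> paths A \<and> fst x = fst y \<and> path_end A x = path_end A y \<and>
     \<phi> \<in> refinements A x y \<and>
     \<alpha> \<in> icells (hom_icat (oriental (plen y)) (obr (plen x) \<phi>) (obr (plen y) id)) j}"

text \<open>In the following, dimensions of cells of \<open>\<tilde>A\<close> of the form \<open>THi x y \<phi> \<alpha>\<close> agree with those of
  \<open>\<alpha>\<close> as a cell of the oriental.\<close>

fun tilde_src :: "('o, 'a) cat \<Rightarrow> nat \<Rightarrow> ('o, 'a) tcell \<Rightarrow> ('o, 'a) tcell" where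
  "tilde_src A k (TOne x) = TObj (fst x)"
| "tilde_src A k (THi x y \<phi> \<alpha>) =
    (if k = 1 then TOne x else THi x y \<phi> (isrc (oriental (plen y)) k \<alpha>))"
| "tilde_src A k (TObj a) = undefined"

fun tilde_tgt :: "('o, 'a) cat \<Rightarrow> nat \<Rightarrow> ('o, 'a) tcell \<Rightarrow> ('o, 'a) tcell" where
  "tilde_tgt A k (TOne x) = TObj (path_end A x)"
| "tilde_tgt A k (THi x y \<phi> \<alpha>) =
    (if k = 1 then TOne y else THi x y \<phi> (itgt (oriental (plen y)) k \<alpha>))"
| "tilde_tgt A k (TObj a) = undefined"

fun tilde_idt :: "('o, 'a) cat \<Rightarrow> nat \<Rightarrow> ('o, 'a) tcell \<Rightarrow> ('o, 'a) tcell" where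
  "tilde_idt A k (TObj a) = TOne (a, [])"
| "tilde_idt A k (TOne x) =
    THi x x (restrict id {..plen x}) (iidt (oriental (plen x)) 1 (obr (plen x) id))"
| "tilde_idt A k (THi x y \<phi> \<alpha>) = THi x y \<phi> (iidt (oriental (plen y)) k \<alpha>)"

text \<open>For \<open>j = 0\<close> the first argument is the one applied last, so that it comes last in the
  concatenation.\<close>

fun tilde_cmp ::
    "('o, 'a) cat \<Rightarrow> nat \<Rightarrow> nat \<Rightarrow> ('o, 'a) tcell \<Rightarrow> ('o, 'a) tcell \<Rightarrow> ('o, 'a) tcell" where
  "tilde_cmp A j k (TOne y) (TOne x) = TOne (pconcat x y)"
| "tilde_cmp A j k (THi y t \<phi>' \<alpha>') (THi x z \<phi> \<alpha>) =
    (if j = 0 then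
       THi (pconcat x y) (pconcat z t) (map_concat (plen x) (plen y) (plen z) \<phi> \<phi>')
         (icmp (oriental (plen z + plen t)) 0 k (omap (\<lambda>i. plen z + i) \<alpha>') (omap (\<lambda>i. i) \<alpha>))
     else if j = 1 then
       THi x t (compose {..plen x} \<phi>' \<phi>) (icmp (oriental (plen t)) 1 k \<alpha>' (omap \<phi>' \<alpha>))
     else
       THi x z \<phi> (icmp (oriental (plen z)) j k \<alpha>' \<alpha>))"
| "tilde_cmp A j k _ _ = undefined"

definition tilde :: "('o, 'a) cat \<Rightarrow> ('o, 'a) tcell icat" where
  "tilde A =
    \<lparr>icells = tilde_cells A, isrc = tilde_src A, itgt = tilde_tgt A, iidt = tilde_idt A,
     icmp = tilde_cmp A\<rparr>"

end

theory Submission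
  imports Defs
begin

text \<open>
  The \<open>1\<close>-cells of an oriental are the nonempty subsets of its vertices, and a positive chain of degree
  at least two cannot lose a vertex under the boundary; hence all the vertices of a cell of
  positive dimension lie on its \<open>1\<close>-target, the finest of its \<open>1\<close>-cells. A cell of \<open>\<O>\<^sub>n\<close> is therefore
  the image of a unique cell with maximal \<open>1\<close>-target of the sub-oriental on its vertices. For a path
  \<open>z\<close> of length \<open>n\<close>, recording this cell together with the restrictions of \<open>z\<close> to the vertices of the
  \<open>1\<close>-source and of the \<open>1\<close>-target defines a map \<open>tcell z\<close> from \<open>\<O>\<^sub>n\<close> to \<open>\<tilde>A\<close> which preserves all
  operations. As \<open>A\<close> is split-free, composites of non-identity arrows are not identities, so that
  these restrictions are again non-degenerate and every simplex of the nerve is uniquely a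
  degeneracy of a path; this makes \<open>tcell\<close> natural in the simplex.

  Every configuration of composable cells of \<open>\<tilde>A\<close> occurring in the axioms is the image under some
  \<open>tcell z\<close> of such a configuration in an oriental. So \<open>\<tilde>A\<close> inherits the axioms, the maps
  \<open>tcell z\<close> induce a functor from \<open>c_inf\<close> of the nerve to \<open>\<tilde>A\<close>, and its inverse sends \<open>tcell z \<alpha>\<close> to
  the generator given by \<open>z\<close> and \<open>\<alpha>\<close>.
\<close>

section \<open>Chains of the orientals\<close>

text \<open>The obstacle to transporting the axioms is that \<open>tcell z\<close> is not injective:
  a path may repeat an arrow, so composability in \<open>tilde A\<close> does not by itself give
  composability of lifts. Along dimension at least one, the boundary equation exhibits the path
  carrying the right factor as a restriction of the path carrying the left one; the right factor can
  be relabelled accordingly, the two boundaries then have the same vertices, and on cells with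
  prescribed vertices \<open>tcell z\<close> is injective. Along dimension zero, the lifts are put
  side by side on the concatenated path, where they share only one vertex. Vertices are controlled
  because a triangle goes from its long edge to the path through its middle vertex, so that they are
  only gained towards the target, and because chains with nonnegative coefficients cannot cancel.
  For the isomorphism, the functor out of \<open>c_inf\<close> exists by the universal property. One
  composite is computed on lifts; the other is the identity by uniqueness, applied to the functors
  from \<open>c_inf\<close> to itself.\<close>

definition vset :: "chain \<Rightarrow> nat set" where
  "vset c = (\<Union>t\<in>Poly_Mapping.keys c. set t)"

definition nonneg :: "chain \<Rightarrow> bool" where
  "nonneg c \<longleftrightarrow> (\<forall>t. Poly_Mapping.lookup c t \<ge> 0)"

lemma vset_simps [simp]: "vset 0 = {}" "vset (frag_of t) = set t"
  by (auto simp: vset_def keys_frag_of)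

lemma vset_keys: "t \<in> Poly_Mapping.keys c \<Longrightarrow> v \<in> set t \<Longrightarrow> v \<in> vset c"
  by (auto simp: vset_def)

lemma nonneg_simps [simp]: "nonneg 0" "nonneg (frag_of t)"
  by (auto simp: nonneg_def)

lemma keys_add_nonneg:
  assumes "nonneg c" "nonneg d"
  shows "Poly_Mapping.keys (c + d) = Poly_Mapping.keys c \<union> Poly_Mapping.keys d"
proof -
  have "Poly_Mapping.lookup c t + Poly_Mapping.lookup d t = 0 \<longleftrightarrow>
      Poly_Mapping.lookup c t = 0 \<and> Poly_Mapping.lookup d t = 0" for t
    using assms by (simp add: nonneg_def add_nonneg_eq_0_iff)
  then show ?thesis by (intro set_eqI) (simp add: in_keys_iff lookup_add)
qed

lemma vset_add_nonneg: "nonneg c \<Longrightarrow> nonneg d \<Longrightarrow> vset (c + d) = vset c \<union> vset d"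
  by (simp add: vset_def keys_add_nonneg)

lemma nonneg_sum: "(\<And>i. i \<in> I \<Longrightarrow> nonneg (f i)) \<Longrightarrow> nonneg (sum f I)"
  by (auto simp: nonneg_def lookup_sum intro: sum_nonneg)

lemma pos_chains_nonneg: "c \<in> pos_chains n p \<Longrightarrow> nonneg c"
  by (simp add: pos_chains_def nonneg_def)

lemma pos_chains_tuples: "c \<in> pos_chains n p \<Longrightarrow> t \<in> Poly_Mapping.keys c \<Longrightarrow> t \<in> tuples n p"
  by (auto simp: pos_chains_def)

lemma vset_pos_chains: "c \<in> pos_chains n p \<Longrightarrow> vset c \<subseteq> {..n}"
  by (fastforce simp: vset_def pos_chains_def tuples_def)

section \<open>Vertices under the boundary of a positive chain\<close>

lemma lookup_frag_extend:
  "Poly_Mapping.lookup (frag_extend f c) u =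
    (\<Sum>t\<in>Poly_Mapping.keys c. Poly_Mapping.lookup c t * Poly_Mapping.lookup (f t) u)"
  by (simp add: frag_extend_def lookup_sum)

abbreviation face :: "nat \<Rightarrow> nat list \<Rightarrow> nat list" where
  "face k t \<equiv> take k t @ drop (Suc k) t"

lemma lookup_bdry:
  "Poly_Mapping.lookup (bdry c) u = (\<Sum>t\<in>Poly_Mapping.keys c.
     Poly_Mapping.lookup c t * (\<Sum>k<length t. if face k t = u then (-1) ^ k else 0))"
  by (auto simp: bdry_def lookup_frag_extend lookup_sum intro!: sum.cong)

text \<open>If the face \<open>face k t\<close> arose only at even positions, every summand of its
  coefficient in the boundary would be nonnegative and that of \<open>t\<close> positive. A
  vanishing coefficient therefore forces an odd face to compensate.\<close>

lemma odd_face_cancels: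
  assumes c: "nonneg c" and t: "t \<in> Poly_Mapping.keys c" "even k" "k < length t"
    and u: "face k t \<notin> Poly_Mapping.keys (bdry c)"
  obtains s l where "s \<in> Poly_Mapping.keys c" "odd l" "l < length s" "face l s = face k t"
proof (rule ccontr)
  assume nt: "\<not> thesis"
  note witness = that
  have no: "even l" if "s \<in> Poly_Mapping.keys c" "l < length s" "face l s = face k t" for s l
    using that nt witness by blast
  let ?g = "\<lambda>s. \<Sum>l<length s. if face l s = face k t then (-1) ^ l else (0 :: int)"
  have ge: "?g s \<ge> 0" if "s \<in> Poly_Mapping.keys c" for s
    using no[OF that] by (intro sum_nonneg) auto
  have "?g t \<ge> (\<Sum>l\<in>{k}. if face l t = face k t then (-1) ^ l else (0 :: int))"
    using no[OF t(1)] t(3) by (intro sum_mono2) auto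
  then have "?g t > 0" using t(2) by simp
  moreover have "Poly_Mapping.lookup c t > 0"
    using c t(1) by (simp add: nonneg_def in_keys_iff order_less_le)
  ultimately have "Poly_Mapping.lookup c t * ?g t > 0" by simp
  then have "(\<Sum>s\<in>Poly_Mapping.keys c. Poly_Mapping.lookup c s * ?g s) > 0"
    using ge c t(1) by (intro sum_pos2[of _ t]) (auto simp: nonneg_def)
  then show False using u by (simp add: lookup_bdry[symmetric] in_keys_iff)
qed

lemma max_by_nat:
  assumes "finite S" "S \<noteq> {}"
  obtains t where "t \<in> S" "\<And>s. s \<in> S \<Longrightarrow> (f s :: nat) \<le> f t"
proof -
  have "Max (f ` S) \<in> f ` S" using assms by simp
  then obtain t where "t \<in> S" "f t = Max (f ` S)" by auto
  then show thesis using that[of t] assms by simp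
qed

text \<open>Suppose that the boundary loses the vertex \<open>v\<close>. Among the tuples starting with \<open>v\<close>, one with minimal
  entry 1 and then maximal entry 2 has a face 2 that no odd face cancels; if there are none, then
  among the tuples containing \<open>v\<close> one with maximal entry 0 has such a face 0.\<close>

lemma vset_bdry:
  assumes c: "c \<in> pos_chains n p" and p: "p \<ge> 2"
  shows "vset c \<subseteq> vset (bdry c)"
proof
  fix v assume vc: "v \<in> vset c"
  show "v \<in> vset (bdry c)"
  proof (rule ccontr)
    assume v: "v \<notin> vset (bdry c)"
    note nn = pos_chains_nonneg[OF c]
    have tup: "length t = Suc p" "set t \<subseteq> {..n}" "sorted_wrt (<) t" if "t \<in> Poly_Mapping.keys c" for t
      using pos_chains_tuples[OF c that] by (auto simp: tuples_def)
    have canc: "\<exists>s l. s \<in> Poly_Mapping.keys c \<and> odd l \<and> l < length s \<and> face l s = face k t"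
      if "t \<in> Poly_Mapping.keys c" "even k" "k < length t" "v \<in> set (face k t)" for t k
    proof -
      have "face k t \<notin> Poly_Mapping.keys (bdry c)" using v that(4) vset_keys by blast
      then show ?thesis using odd_face_cancels[OF nn that(1-3)] by metis
    qed
    have nthface: "face k t ! i = (if i < k then t ! i else t ! Suc i)" if "k < length t" for k i t
      using that by (auto simp: nth_append min_def)
    have A: "t ! 0 \<noteq> v" if "t \<in> Poly_Mapping.keys c" for t
    proof
      assume t0: "t ! 0 = v"
      define S where "S = {s \<in> Poly_Mapping.keys c. s ! 0 = v}"
      have "finite S" "S \<noteq> {}" using that t0 by (auto simp: S_def)
      \<comment> \<open>The weight encodes a lexicographic order: entry 2 is at most
        \<open>n\<close>, hence below the factor \<open>Suc n\<close>, and \<open>n - s ! 1\<close>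
        reverses the order of entry 1.\<close>
      then obtain t where t: "t \<in> S"
        and mx: "\<And>s. s \<in> S \<Longrightarrow> (n - s ! 1) * Suc n + s ! 2 \<le> (n - t ! 1) * Suc n + t ! 2"
        using max_by_nat[of S "\<lambda>s. (n - s ! 1) * Suc n + s ! 2"] by blast
      then have tk: "t \<in> Poly_Mapping.keys c" and t0: "t ! 0 = v" by (auto simp: S_def)
      have "2 < length t" using tup(1)[OF tk] p by simp
      have "face 2 t ! 0 = v" using nthface[OF \<open>2 < length t\<close>, of 0] t0 by simp
      then have "v \<in> set (face 2 t)" 
        using nth_mem[of 0 "face 2 t"] \<open>2 < length t\<close> by simp
      then obtain s l where s: "s \<in> Poly_Mapping.keys c" "odd l" "l < length s" "face l s = face 2 t"
        using canc[OF tk _ \<open>2 < length t\<close>] by auto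
      have eq: "(if i < l then s ! i else s ! Suc i) = (if i < 2 then t ! i else t ! Suc i)" for i
        using s(4) nthface[OF s(3), of i] nthface[OF \<open>2 < length t\<close>, of i] by simp
      have "l \<noteq> 0" using s(2) by (cases l) auto
      then have s0: "s ! 0 = v" using eq[of 0] t0 by simp
      then have "s \<in> S" using s(1) by (simp add: S_def)
      have t2: "t ! 2 \<le> n" and s2: "s ! 2 \<le> n" and s1: "s ! 1 \<le> n" and t1: "t ! 1 \<le> n"
        using tup[OF tk] tup[OF s(1)] p by (auto simp: subset_iff)
      have lt: "s ! i < s ! j" if "i < j" "j \<le> p" for i j
        using sorted_wrt_nth_less[OF tup(3)[OF s(1)] that(1)] that tup(1)[OF s(1)] by simp
      have ltt: "t ! i < t ! j" if "i < j" "j \<le> p" for i j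
        using sorted_wrt_nth_less[OF tup(3)[OF tk] that(1)] that tup(1)[OF tk] by simp
      \<comment> \<open>For \<open>l = 1\<close>, the tuple \<open>s\<close> has an additional
        vertex between \<open>v\<close> and \<open>t ! 1\<close>, so its entry 1 is smaller. For odd
        \<open>l\<close> at least 3 it keeps entry 1 but has \<open>t ! 3\<close> at place 2. Both
        contradict the choice of \<open>t\<close>.\<close>
      have "(n - t ! 1) * Suc n + t ! 2 < (n - s ! 1) * Suc n + s ! 2"
      proof (cases "l = 1")
        case True
        then have "s ! 2 = t ! 1" using eq[of 1] by (simp add: numeral_2_eq_2)
        then have "s ! 1 < t ! 1" using lt[of 1 2] p by simp
        then have "n - s ! 1 \<ge> Suc (n - t ! 1)" using t1 by simp
        then have "(n - s ! 1) * Suc n \<ge> Suc (n - t ! 1) * Suc n" by (rule mult_le_mono1)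
        then show ?thesis using t2 by simp
      next
        case False
        then have "l > 2" using s(2) \<open>l \<noteq> 0\<close> by (cases "l = 2") auto
        then have "p \<ge> 3" using s(3) tup(1)[OF s(1)] by simp
        have "s ! 1 = t ! 1" "s ! 2 = t ! 3" using eq[of 1] eq[of 2] \<open>l > 2\<close> by (simp_all add: numeral_eq_Suc)
        then show ?thesis using ltt[of 2 3] \<open>p \<ge> 3\<close> by simp
      qed
      then show False using mx[OF \<open>s \<in> S\<close>] by simp
    qed
    define S where "S = {s \<in> Poly_Mapping.keys c. v \<in> set s}"
    have "finite S" "S \<noteq> {}" using vc by (auto simp: S_def vset_def)
    then obtain t where t: "t \<in> S" and mx: "\<And>s. s \<in> S \<Longrightarrow> s ! 0 \<le> t ! 0"
      using max_by_nat[of S "\<lambda>s. s ! 0"] by blast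
    then have tk: "t \<in> Poly_Mapping.keys c" and vt: "v \<in> set t" by (auto simp: S_def)
    \<comment> \<open>By \<open>A\<close> no tuple starts with \<open>v\<close>, so deleting entry 0
      keeps \<open>v\<close>.\<close>
    have vt': "v \<in> set (face 0 t)" using vt A[OF tk] by (cases t) auto
    have "0 < length t" using tup(1)[OF tk] by simp
    then obtain s l where s: "s \<in> Poly_Mapping.keys c" "odd l" "l < length s" "face l s = face 0 t"
      using canc[OF tk _ _ vt'] by auto
    have "l \<noteq> 0" using s(2) by (cases l) auto
    \<comment> \<open>An odd \<open>l\<close> is positive, so \<open>s\<close> starts where
      \<open>face 0 t\<close> does, which is strictly above \<open>t ! 0\<close>.\<close>
    have "s ! 0 = t ! Suc 0"
      using s(4) nthface[OF s(3), of 0] nthface[OF \<open>0 < length t\<close>, of 0] \<open>l \<noteq> 0\<close> by simp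
    moreover have "t ! 0 < t ! Suc 0"
      using sorted_wrt_nth_less[OF tup(3)[OF tk], of 0 1] tup(1)[OF tk] p by simp
    moreover have "v \<in> set s" using vt' s(4) by (metis Un_iff in_set_takeD in_set_dropD set_append)
    ultimately show False using mx[of s] s(1) by (simp add: S_def)
  qed
qed

section \<open>Positive 1-chains: in-degrees, out-degrees and decomposition into a path\<close>

lemma lookup_bdry_edge:
  assumes "c \<in> pos_chains n 1"
  shows "Poly_Mapping.lookup (bdry c) [v] = (\<Sum>t\<in>Poly_Mapping.keys c.
    Poly_Mapping.lookup c t * ((if t ! 1 = v then 1 else 0) - (if t ! 0 = v then 1 else 0)))"
  unfolding lookup_bdry
proof (intro sum.cong refl arg_cong2[of _ _ _ _ times])
  fix t assume "t \<in> Poly_Mapping.keys c"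
  then have "length t = 2" using pos_chains_tuples[OF assms] by (auto simp: tuples_def)
  then obtain a b where "t = [a, b]" by (auto simp: length_Suc_conv numeral_2_eq_2)
  then show "(\<Sum>k<length t. if face k t = [v] then (-1) ^ k else 0) =
      (if t ! 1 = v then 1 else 0) - (if t ! 0 = v then (1::int) else 0)"
    by (simp add: numeral_2_eq_2 lessThan_Suc)
qed

lemma pos_chains_1_cases:
  assumes "c \<in> pos_chains n 1" "t \<in> Poly_Mapping.keys c"
  obtains i j where "t = [i, j]" "i < j" "j \<le> n"
proof -
  have "length t = 2" "set t \<subseteq> {..n}" "sorted_wrt (<) t"
    using pos_chains_tuples[OF assms] by (auto simp: tuples_def)
  then obtain a b where "t = [a, b]" by (auto simp: length_Suc_conv numeral_2_eq_2)
  then show thesis using that \<open>set t \<subseteq> {..n}\<close> \<open>sorted_wrt (<) t\<close> by auto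
qed

definition edges :: "nat \<Rightarrow> (nat \<Rightarrow> nat) \<Rightarrow> chain" where
  "edges m \<phi> = (\<Sum>i\<in>{1..m}. frag_of [\<phi> (i - 1), \<phi> i])"

lemma edges_simps: "edges 0 \<phi> = 0" "edges (Suc m) \<phi> = edges m \<phi> + frag_of [\<phi> m, \<phi> (Suc m)]"
  by (simp_all add: edges_def atLeastAtMostSuc_conv)

lemma edges_shift: "edges (Suc m) \<phi> = frag_of [\<phi> 0, \<phi> 1] + edges m (\<lambda>i. \<phi> (Suc i))"
  by (induction m) (simp_all add: edges_simps add.assoc)

lemma nonneg_edges [simp]: "nonneg (edges m \<phi>)"
  by (simp add: edges_def nonneg_sum)

lemma vset_edges: "vset (edges m \<phi>) = (if m = 0 then {} else \<phi> ` {..m})"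
proof (induction m)
  case (Suc m)
  then show ?case by (auto simp: edges_simps vset_add_nonneg atMost_Suc)
qed (simp add: edges_simps)

lemma bdry_edge: "bdry (frag_of [a, b]) = frag_of [b] - frag_of [a]"
  by (simp add: bdry_def lessThan_Suc)

text \<open>No edge ends at the least vertex \<open>i\<close> from which an edge of \<open>c\<close>
  starts, since edges increase. So the boundary is negative at \<open>i\<close>, which forces
  \<open>i = a\<close>. Removing one edge from \<open>a\<close> to \<open>j\<close> leaves a chain
  with boundary from \<open>j\<close> to \<open>b\<close>; the induction is on \<open>augm\<close>,
  which counts edges with multiplicity.\<close>

lemma path_decomposition:
  assumes "c \<in> pos_chains n 1" "bdry c = frag_of [b] - frag_of [a]" "a \<le> n"
  shows "\<exists>m \<phi>. strict_mono_on {..m} \<phi> \<and> \<phi> ` {..m} \<subseteq> {..n} \<and> \<phi> 0 = a \<and> \<phi> m = b \<and> c = edges m \<phi>"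
  using assms
proof (induction "nat (augm c)" arbitrary: c a rule: less_induct)
  case less
  note c = less.prems(1) and bc = less.prems(2) and an = less.prems(3)
  show ?case
  proof (cases "c = 0")
    case True
    then have "a = b" using bc by (simp add: frag_of_eq)
    then show ?thesis using an True
      by (intro exI[of _ 0] exI[of _ "\<lambda>_. a"]) (auto simp: edges_simps strict_mono_on_def)
  next
    case False
    then have ne: "Poly_Mapping.keys c \<noteq> {}" by simp
    obtain t where t: "t \<in> Poly_Mapping.keys c"
      and mn: "\<And>s. s \<in> Poly_Mapping.keys c \<Longrightarrow> t ! 0 \<le> s ! 0"
      using ex_has_least_nat[of "\<lambda>s. s \<in> Poly_Mapping.keys c" _ "\<lambda>s. s ! 0"] ne by blast
    obtain i j where ij: "t = [i, j]" "i < j" "j \<le> n" using pos_chains_1_cases[OF c t] .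
    have cpos: "Poly_Mapping.lookup c s > 0" if "s \<in> Poly_Mapping.keys c" for s
      using that c by (simp add: pos_chains_def in_keys_iff order_less_le)
    have noin: "s ! 1 \<noteq> i" if "s \<in> Poly_Mapping.keys c" for s

    proof -
      obtain a b where "s = [a, b]" "a < b" using pos_chains_1_cases[OF c \<open>s \<in> _\<close>] .
      then show ?thesis using mn[OF \<open>s \<in> _\<close>] ij by auto
    qed
    have "(\<Sum>t\<in>Poly_Mapping.keys c. Poly_Mapping.lookup c t * (if t ! 0 = i then 1 else 0)) > 0"
      by (rule sum_pos2[OF finite_keys t]) (use cpos t in \<open>auto simp: ij intro: less_imp_le\<close>)
    then have "Poly_Mapping.lookup (bdry c) [i] < 0"
      unfolding lookup_bdry_edge[OF c] using noin by (simp add: sum_negf)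
    then have "i = a" unfolding bc by (auto simp: lookup_minus split: if_splits)
    define c' where "c' = c - frag_of [a, j]"
    have c': "c' \<in> pos_chains n 1"
    proof -
      have "Poly_Mapping.lookup c [a, j] \<ge> 1" using cpos[OF t] ij \<open>i = a\<close> by simp
      then have "Poly_Mapping.lookup c' s \<ge> 0" for s
        using c by (auto simp: c'_def lookup_minus pos_chains_def)
      moreover have "Poly_Mapping.keys c' \<subseteq> Poly_Mapping.keys c"
        using t ij \<open>i = a\<close> by (auto simp: c'_def in_keys_iff lookup_minus split: if_splits)
      ultimately show ?thesis using c by (auto simp: pos_chains_def)
    qed
    have cc: "c = frag_of [a, j] + c'" by (simp add: c'_def)
    have augm_add: "augm (x + y) = augm x + augm y" for x y
    proof -
      \<comment> \<open>Sending all tuples to the empty one turns the sum of coefficients into a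
        single coefficient of a linear image, from which additivity is immediate.\<close>
      have augm: "augm c = Poly_Mapping.lookup (frag_extend (\<lambda>_. frag_of ([] :: nat list)) c) []" for c
        by (simp add: augm_def frag_extend_def lookup_sum)
      show ?thesis by (simp add: augm frag_extend_add lookup_add)
    qed
    have "augm c = augm c' + 1" unfolding cc augm_add by (simp add: augm_def keys_frag_of)
    moreover have "augm c' \<ge> 0" using c' by (auto simp: augm_def pos_chains_def intro: sum_nonneg)
    moreover have bc': "bdry c' = frag_of [b] - frag_of [j]"
      using bc unfolding cc bdry_add bdry_edge by (simp add: algebra_simps)
    ultimately obtain m \<phi> where m: "strict_mono_on {..m} \<phi>" "\<phi> ` {..m} \<subseteq> {..n}" "\<phi> 0 = j" "\<phi> m = b"
      "c' = edges m \<phi>" using less.hyps[OF _ c' bc' ij(3)] by auto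
    let ?\<phi> = "\<lambda>i. if i = 0 then a else \<phi> (i - 1)"
    have "strict_mono_on {..Suc m} ?\<phi>"
    proof (rule strict_mono_onI)
      fix r s assume rs: "r \<in> {..Suc m}" "s \<in> {..Suc m}" "r < s"
      have "\<phi> 0 \<le> \<phi> (s - 1)" using rs by (intro strict_mono_on_leD[OF m(1)]) auto
      moreover have "\<phi> (r - 1) < \<phi> (s - 1)" if "r > 0"
        using rs that strict_mono_onD[OF m(1), of "r - 1" "s - 1"] by auto
      ultimately show "?\<phi> r < ?\<phi> s" using rs m(3) ij \<open>i = a\<close> by auto
    qed
    moreover have "?\<phi> ` {..Suc m} \<subseteq> {..n}" using m(2) an by (auto simp: image_subset_iff)
    moreover have "c = edges (Suc m) ?\<phi>" unfolding edges_shift using m(3,5) cc by simp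
    ultimately show ?thesis using m(4) by (intro exI[of _ "Suc m"] exI[of _ ?\<phi>]) simp
  qed
qed

section \<open>Vertices of cells\<close>

text \<open>For finite \<open>W\<close> with \<open>m + 1\<close> elements, \<open>enum W\<close> and \<open>rank W\<close> are inverse order isomorphisms between
  \<open>{..m}\<close> and \<open>W\<close>. The truncated subtraction makes \<open>rank W\<close> monotone into \<open>{..m}\<close> on all of \<open>nat\<close>.\<close>

definition enum :: "nat set \<Rightarrow> nat \<Rightarrow> nat" where
  "enum W i = sorted_list_of_set W ! i"

definition rank :: "nat set \<Rightarrow> nat \<Rightarrow> nat" where
  "rank W v = card {w \<in> W. w \<le> v} - 1"

lemma card_image_strict_mono: "strict_mono_on {..m::nat} (\<phi> :: nat \<Rightarrow> nat) \<Longrightarrow> card (\<phi> ` {..m}) = Suc m"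
  by (simp add: card_image strict_mono_on_imp_inj_on)

lemma rank_image:
  assumes "strict_mono_on {..m} \<phi>" "i \<le> m"
  shows "rank (\<phi> ` {..m}) (\<phi> i) = i"
proof -
  have "{w \<in> \<phi> ` {..m}. w \<le> \<phi> i} = \<phi> ` {..i}"
    using assms by (auto simp: strict_mono_on_less_eq)
  moreover have "inj_on \<phi> {..i}"
    using strict_mono_on_imp_inj_on[OF assms(1)] by (rule inj_on_subset) (use assms(2) in auto)
  ultimately show ?thesis by (simp add: rank_def card_image)
qed

lemma enum_image:
  assumes "strict_mono_on {..m} \<phi>" "i \<le> m"
  shows "enum (\<phi> ` {..m}) i = \<phi> i"
proof -
  have "sorted_wrt (<) (map \<phi> [0..<Suc m])"
    unfolding sorted_wrt_map using assms(1)
    by (intro sorted_wrt_mono_rel[OF _ sorted_wrt_upt]) (auto intro: strict_mono_onD)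
  moreover have "set (map \<phi> [0..<Suc m]) = \<phi> ` {..m}"
    by (simp only: set_map set_upt atLeast0LessThan lessThan_Suc_atMost)
  ultimately have "sorted_list_of_set (\<phi> ` {..m}) = map \<phi> [0..<Suc m]"
    by (metis sorted_list_of_set.idem_if_sorted_distinct strict_sorted_iff)
  then show ?thesis using assms(2) by (simp add: enum_def del: upt_Suc)
qed

lemma enum_strict_mono:
  assumes "finite W" "card W = Suc m"
  shows "strict_mono_on {..m} (enum W)" and "enum W ` {..m} = W"
proof -
  have l: "length (sorted_list_of_set W) = Suc m" using assms by simp
  show "strict_mono_on {..m} (enum W)"
    unfolding enum_def using l
    by (intro strict_mono_onI sorted_wrt_nth_less[of "(<)"]) auto
  have "enum W ` {..m} = set (sorted_list_of_set W)"
    unfolding enum_def set_conv_nth using l by (auto simp: less_Suc_eq_le image_iff)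
  then show "enum W ` {..m} = W" using assms(1) by simp
qed

lemma enumE:
  assumes "finite W" "W \<noteq> {}"
  obtains m where "card W = Suc m" "strict_mono_on {..m} (enum W)" "enum W ` {..m} = W"
proof -
  have "card W \<noteq> 0" using assms by simp
  then obtain m where "card W = Suc m" by (cases "card W") auto
  then show thesis using that enum_strict_mono[OF assms(1)] by blast
qed

lemma enum_rank:
  assumes "finite W" "w \<in> W"
  shows "enum W (rank W w) = w"
proof -
  obtain m where m: "strict_mono_on {..m} (enum W)" "enum W ` {..m} = W"
    using enumE[of W] assms by blast
  then obtain i where "i \<le> m" "w = enum W i" using assms(2) by auto
  then show ?thesis using rank_image[OF m(1), of i] by (simp add: m(2))
qed

lemma rank_enum:
  assumes "finite W" "i < card W"
  shows "rank W (enum W i) = i"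
proof -
  obtain m where m: "card W = Suc m" "strict_mono_on {..m} (enum W)" "enum W ` {..m} = W"
    using enumE[of W] assms by (metis card.empty not_less_zero)
  then show ?thesis using rank_image[OF m(2), of i] assms(2) by simp
qed

lemma enum_in: "finite W \<Longrightarrow> i < card W \<Longrightarrow> enum W i \<in> W"
  unfolding enum_def by (metis length_sorted_list_of_set nth_mem set_sorted_list_of_set)

lemma rank_mono: "finite W \<Longrightarrow> v \<le> w \<Longrightarrow> rank W v \<le> rank W w"
  unfolding rank_def by (intro diff_le_mono card_mono) auto

lemma rank_le: "finite W \<Longrightarrow> rank W v \<le> card W - 1"
  unfolding rank_def by (intro diff_le_mono card_mono) auto

lemma rank_strict_mono:
  assumes "finite W" "v \<in> W" "w \<in> W" "v < w"
  shows "rank W v < rank W w"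
  by (metis assms enum_rank less_le rank_mono)

lemma rank_Min: "finite W \<Longrightarrow> W \<noteq> {} \<Longrightarrow> rank W (Min W) = 0"
proof -
  assume W: "finite W" "W \<noteq> {}"
  then have "{w \<in> W. w \<le> Min W} = {Min W}" using Min_in[OF W] Min_le[OF W(1)] by fastforce
  then show ?thesis by (simp add: rank_def)
qed

lemma rank_Max: "finite W \<Longrightarrow> W \<noteq> {} \<Longrightarrow> rank W (Max W) = card W - 1"
proof -
  assume W: "finite W" "W \<noteq> {}"
  then have "{w \<in> W. w \<le> Max W} = W" by auto
  then show ?thesis by (simp add: rank_def)
qed

lemma enum_0: "finite W \<Longrightarrow> W \<noteq> {} \<Longrightarrow> enum W 0 = Min W"
  by (metis rank_Min enum_rank Min_in)

lemma enum_last: "finite W \<Longrightarrow> W \<noteq> {} \<Longrightarrow> enum W (card W - 1) = Max W"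
  by (metis rank_Max enum_rank Max_in)

lemma enum_atMost: "i \<le> n \<Longrightarrow> enum {..n} i = i"
  using enum_image[of n id i] by (simp add: strict_mono_on_def)

lemma rank_atMost: "i \<le> n \<Longrightarrow> rank {..n} i = i"
  using rank_image[of n id i] by (simp add: strict_mono_on_def)

text \<open>For \<open>U\<close> the vertices of the 1-source and \<open>W\<close> those of the
  1-target, this map is the refinement that indexes the summand of a hom of
  \<open>tilde A\<close>.\<close>

lemma rank_strict_mono_on:
  assumes "finite W" "U \<subseteq> W" "U \<noteq> {}"
  shows "strict_mono_on {..card U - 1} (\<lambda>i. rank W (enum U i))"
    and "(\<lambda>i. rank W (enum U i)) ` {..card U - 1} = rank W ` U"
proof -
  have fin: "finite U" using assms finite_subset by blast
  obtain m where m: "card U = Suc m" "strict_mono_on {..m} (enum U)" "enum U ` {..m} = U"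
    using enumE[OF fin assms(3)] .
  have "enum U i \<in> W" if "i \<le> m" for i using m(3) that assms(2) by blast
  then show "strict_mono_on {..card U - 1} (\<lambda>i. rank W (enum U i))"
    unfolding m(1) diff_Suc_1
    by (intro strict_mono_onI rank_strict_mono[OF assms(1)] strict_mono_onD[OF m(2)]) auto
  show "(\<lambda>i. rank W (enum U i)) ` {..card U - 1} = rank W ` U"
    unfolding m(1) diff_Suc_1 using m(3) by (metis image_image)
qed

lemma rank_props:
  assumes "finite W"
  shows "mono_on {..m} (rank W)" "rank W ` {..m} \<subseteq> {..card W - 1}"
  using rank_mono[OF assms] rank_le[OF assms] by (auto intro: mono_onI)

lemma rank_image_self: "finite W \<Longrightarrow> W \<noteq> {} \<Longrightarrow> rank W ` W = {..card W - 1}"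
proof -
  assume W: "finite W" "W \<noteq> {}"
  then have "card W > 0" by (simp add: card_gt_0_iff)
  then have "(\<lambda>i. rank W (enum W i)) ` {..card W - 1} = (\<lambda>i. i) ` {..card W - 1}"
    using rank_enum[OF W(1)] by (intro image_cong) auto
  then show "rank W ` W = {..card W - 1}" using rank_strict_mono_on(2)[OF W(1) subset_refl W(2)] by simp
qed

text \<open>\<open>ssupp x\<close> are the vertices of the \<open>1\<close>-source of \<open>x\<close>.\<close>

definition supp :: "ocell \<Rightarrow> nat set" where
  "supp x = (\<Union>p. \<Union>\<epsilon>. vset (x p \<epsilon>))"

definition ssupp :: "ocell \<Rightarrow> nat set" where
  "ssupp x = vset (x 0 False) \<union> vset (x 1 False)"

section \<open>The 0-cells and 1-cells of an oriental\<close>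

lemma obr_edges: "obr m \<phi> p \<epsilon> =
    (if p = 0 then frag_of [if \<epsilon> then \<phi> m else \<phi> 0] else if p = 1 then edges m \<phi> else 0)"
  by (simp add: obr_def edges_def)

lemma supp_obr [simp]: "supp (obr m \<phi>) = \<phi> ` {..m}"
proof
  show "supp (obr m \<phi>) \<subseteq> \<phi> ` {..m}"
    by (auto simp: supp_def obr_edges vset_edges split: if_splits)
  have "vset (obr m \<phi> 0 False) \<union> vset (obr m \<phi> 1 False) \<subseteq> supp (obr m \<phi>)"
    unfolding supp_def by blast
  then show "\<phi> ` {..m} \<subseteq> supp (obr m \<phi>)"
    by (cases "m = 0") (auto simp: obr_edges vset_edges)
qed

lemma ssupp_obr [simp]: "ssupp (obr m \<phi>) = \<phi> ` {..m}"
  by (auto simp: ssupp_def obr_edges vset_edges)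

lemma edges_cong: "(\<And>i. i \<le> m \<Longrightarrow> \<phi> i = \<psi> i) \<Longrightarrow> edges m \<phi> = edges m \<psi>"
  unfolding edges_def by (intro sum.cong) auto

lemma obr_cong: "(\<And>i. i \<le> m \<Longrightarrow> \<phi> i = \<psi> i) \<Longrightarrow> obr m \<phi> = obr m \<psi>"
  using edges_cong[of m \<phi> \<psi>] by (intro ext) (auto simp: obr_edges)

lemma bdry_edges: "bdry (edges m \<phi>) = frag_of [\<phi> m] - frag_of [\<phi> 0]"
  by (induction m) (simp_all add: edges_simps bdry_add bdry_edge)

lemma frag_of_pos_chains: "t \<in> tuples n p \<Longrightarrow> frag_of t \<in> pos_chains n p"
  by (simp add: pos_chains_def keys_frag_of)

lemma edges_pos_chains:
  assumes "strict_mono_on {..m} \<phi>" "\<phi> ` {..m} \<subseteq> {..n}"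
  shows "edges m \<phi> \<in> pos_chains n 1"
proof -
  have "edges k \<phi> \<in> pos_chains n 1" if "k \<le> m" for k
    using that
  proof (induction k)
    case (Suc k)
    have "\<phi> k < \<phi> (Suc k)" using Suc.prems by (intro strict_mono_onD[OF assms(1)]) auto
    then have "frag_of [\<phi> k, \<phi> (Suc k)] \<in> pos_chains n 1"
      using Suc.prems assms(2) by (intro frag_of_pos_chains) (auto simp: tuples_def image_subset_iff)
    then show ?case using Suc by (simp add: edges_simps pos_chains_add)
  qed (simp add: edges_simps)
  then show ?thesis by blast
qed

lemma obr_cells:
  assumes "strict_mono_on {..m} \<phi>" "\<phi> ` {..m} \<subseteq> {..n}"
  shows "obr m \<phi> \<in> ocells n 1"
proof -
  have "frag_of [\<phi> i] \<in> pos_chains n 0" if "i \<le> m" for i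
    using that assms(2) by (intro frag_of_pos_chains) (auto simp: tuples_def)
  then have "obr m \<phi> p \<epsilon> \<in> pos_chains n p" for p \<epsilon>
    using edges_pos_chains[OF assms] by (simp add: obr_edges)
  moreover have "bdry (obr m \<phi> p \<epsilon>) = obr m \<phi> (p - 1) True - obr m \<phi> (p - 1) False"
    if "0 < p" "p \<le> 1" for p \<epsilon>
  proof -
    have "p = 1" using that by simp
    then show ?thesis by (simp add: obr_edges bdry_edges)
  qed
  moreover have "augm (obr m \<phi> 0 \<epsilon>) = 1" for \<epsilon>
    by (simp add: obr_edges augm_def keys_frag_of)
  moreover have "obr m \<phi> p \<epsilon> = 0" if "p > 1" for p \<epsilon>
    using that by (simp add: obr_edges)
  moreover have "obr m \<phi> 1 False = obr m \<phi> 1 True" by (simp add: obr_edges)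
  ultimately show ?thesis unfolding ocells_def mem_Collect_eq by blast
qed

text \<open>Each coefficient that occurs is at least 1 and they sum to 1, so the positive chain
  \<open>x 0 \<epsilon>\<close> is a single basis element.\<close>

lemma ocells_vertex:
  assumes "x \<in> ocells n k"
  obtains v where "v \<le> n" "x 0 \<epsilon> = frag_of [v]"
proof -
  define c where "c = x 0 \<epsilon>"
  have c: "c \<in> pos_chains n 0" "augm c = 1" using assms by (auto simp: ocells_def c_def)
  have pos: "Poly_Mapping.lookup c t \<ge> 1" if "t \<in> Poly_Mapping.keys c" for t
  proof -
    have "Poly_Mapping.lookup c t \<ge> 0" "Poly_Mapping.lookup c t \<noteq> 0"
      using c(1) that by (auto simp: pos_chains_def in_keys_iff)
    then show ?thesis by simp
  qed
  have "int (card (Poly_Mapping.keys c)) = (\<Sum>t\<in>Poly_Mapping.keys c. 1)" by simp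
  also have "\<dots> \<le> augm c" unfolding augm_def using pos by (rule sum_mono)
  finally have "card (Poly_Mapping.keys c) \<le> 1" using c(2) by simp
  moreover have "Poly_Mapping.keys c \<noteq> {}" using c(2) by (auto simp: augm_def)
  ultimately have "card (Poly_Mapping.keys c) = 1" by (simp add: le_Suc_eq)
  then obtain t where t: "Poly_Mapping.keys c = {t}" by (auto simp: card_1_singleton_iff)
  then have "Poly_Mapping.lookup c t = 1" using c(2) by (simp add: augm_def)
  then have "c = frag_of t" using t by (intro poly_mapping_eqI) (auto simp: in_keys_iff set_eq_iff)
  moreover have "t \<in> tuples n 0" using c(1) t by (auto simp: pos_chains_def)
  then obtain v where "t = [v]" "v \<le> n" by (auto simp: tuples_def length_Suc_conv)
  ultimately show thesis using that[of v] by (simp add: c_def)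
qed

lemma ocells_1_obr:
  assumes "x \<in> ocells n 1"
  obtains m \<phi> where "strict_mono_on {..m} \<phi>" "\<phi> ` {..m} \<subseteq> {..n}" "x = obr m \<phi>"
proof -
  obtain a where a: "a \<le> n" "x 0 False = frag_of [a]" using ocells_vertex[OF assms] .
  obtain b where b: "b \<le> n" "x 0 True = frag_of [b]" using ocells_vertex[OF assms] .
  have c: "x 1 True \<in> pos_chains n 1" "x 1 False = x 1 True"
    and bd: "\<And>p \<epsilon>. p \<le> 1 \<Longrightarrow> 0 < p \<Longrightarrow> bdry (x p \<epsilon>) = x (p - 1) True - x (p - 1) False"
    and z: "\<And>p \<epsilon>. p > 1 \<Longrightarrow> x p \<epsilon> = 0"
    using assms unfolding ocells_def by auto
  have "bdry (x 1 True) = frag_of [b] - frag_of [a]" using bd[of 1 True] a(2) b(2) by simp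
  from path_decomposition[OF c(1) this a(1)] obtain m \<phi> where m:
    "strict_mono_on {..m} \<phi>" "\<phi> ` {..m} \<subseteq> {..n}" "\<phi> 0 = a" "\<phi> m = b" "x 1 True = edges m \<phi>"
    by blast
  have "x = obr m \<phi>"
  proof (intro ext)
    fix p :: nat and \<epsilon> :: bool
    consider "p = 0" | "p = 1" | "p > 1" by linarith
    then show "x p \<epsilon> = obr m \<phi> p \<epsilon>"
    proof cases
      case 1
      then show ?thesis using a(2) b(2) m(3,4) by (cases \<epsilon>) (simp_all add: obr_edges)
    next
      case 2
      then show ?thesis using m(5) c(2) by (cases \<epsilon>) (simp_all add: obr_edges)
    next
      case 3
      then show ?thesis using z[OF 3] by (simp add: obr_edges)
    qed
  qed
  then show thesis using that m by blast
qed

lemma ocells_1_supp: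
  assumes "x \<in> ocells n 1"
  shows "x = obr (card (supp x) - 1) (enum (supp x))"
proof -
  obtain m \<phi> where m: "strict_mono_on {..m} \<phi>" "\<phi> ` {..m} \<subseteq> {..n}" "x = obr m \<phi>"
    using ocells_1_obr[OF assms] .
  show ?thesis unfolding m(3) supp_obr card_image_strict_mono[OF m(1)]
    using enum_image[OF m(1)] by (auto intro: obr_cong)
qed

lemma ocells_1_eqI: "x \<in> ocells n 1 \<Longrightarrow> y \<in> ocells n' 1 \<Longrightarrow> supp x = supp y \<Longrightarrow> x = y"
  using ocells_1_supp by metis

lemma ocells_pos: "x \<in> ocells n k \<Longrightarrow> x p \<epsilon> \<in> pos_chains n p"
  by (cases "p \<le> k") (auto simp: ocells_def)

lemma ocells_bdry: "x \<in> ocells n k \<Longrightarrow> 0 < p \<Longrightarrow> p \<le> k \<Longrightarrow> bdry (x p \<epsilon>) = x (p - 1) True - x (p - 1) False"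
  by (auto simp: ocells_def)

lemma supp_subset: "x \<in> ocells n k \<Longrightarrow> supp x \<subseteq> {..n}"
  unfolding supp_def using vset_pos_chains ocells_pos by blast

lemma finite_supp [simp]: "x \<in> ocells n k \<Longrightarrow> finite (supp x)"
  by (rule finite_subset[OF supp_subset]) auto

lemma ssupp_subset_supp: "ssupp x \<subseteq> supp x"
  by (auto simp: ssupp_def supp_def)

lemma finite_ssupp [simp]: "x \<in> ocells n k \<Longrightarrow> finite (ssupp x)"
  using ssupp_subset_supp finite_supp finite_subset by metis

lemma ssupp_nonempty [simp]: "x \<in> ocells n k \<Longrightarrow> ssupp x \<noteq> {}"
  by (rule ocells_vertex[of x n k False]) (auto simp: ssupp_def)

lemma supp_nonempty [simp]: "x \<in> ocells n k \<Longrightarrow> supp x \<noteq> {}"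
  using ssupp_nonempty ssupp_subset_supp by fastforce

lemma vset_diff: "vset (c - d) \<subseteq> vset c \<union> vset d"
  unfolding vset_def using keys_diff[of c d] by blast

text \<open>The number of edges entering a vertex \<open>v\<close> grows from the 1-source to the 1-target,
  by the number of triangles with middle vertex \<open>v\<close>.\<close>

lemma vset_source_edges:
  assumes x: "x \<in> ocells n k" and k: "k \<ge> 1"
  shows "vset (x 1 False) \<subseteq> vset (x 1 True) \<union> vset (x 0 False)"
proof (cases "k = 1")
  case True
  then show ?thesis using ocells_top[OF x] by auto
next
  case False
  then have k2: "2 \<le> k" using k by simp
  \<comment> \<open>The coefficient of \<open>[]\<close> in \<open>E v c\<close> is the total weight
    of the tuples of \<open>c\<close> with entry 1 equal to \<open>v\<close>: for edges those
    entering \<open>v\<close>, for triangles those with middle vertex \<open>v\<close>.\<close>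
  define E where "E v = frag_extend (\<lambda>t. if t ! 1 = v then frag_of ([] :: nat list) else 0)" for v :: nat
  define x1 where "x1 = sto (oriental n) 1 k x"
  have x1: "x1 \<in> ocells n 1" unfolding x1_def
    using sto_cells[OF strict_icat_oriental, of x n k 1] x k by (simp add: oriental_simps)
  have x1v: "x1 0 False = x 0 False" "x1 1 False = x 1 False"
    unfolding x1_def oriental_sto[OF x k] by simp_all
  obtain m \<phi> where m: "strict_mono_on {..m} \<phi>" "x1 = obr m \<phi>" using ocells_1_obr[OF x1] by blast
  have E0: "Poly_Mapping.lookup (E v c) [] =
      (\<Sum>t\<in>Poly_Mapping.keys c. Poly_Mapping.lookup c t * (if t ! 1 = v then 1 else 0))" for v c
    unfolding E_def lookup_frag_extend by (intro sum.cong) auto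
  \<comment> \<open>Of the faces \<open>[b, c]\<close>, \<open>[a, c]\<close>, \<open>[a, b]\<close>
    of \<open>[a, b, c]\<close>, with signs +, -, +, the first two have the same entry 1 and cancel
    under \<open>E\<close>; the third has entry 1 equal to the middle vertex.\<close>
  have Ebd: "E v (bdry (x 2 False)) = frag_extend (\<lambda>t. if t ! 1 = v then frag_of [] else 0) (x 2 False)" for v
    unfolding E_def bdry_def frag_extend_extend
  proof (rule frag_extend_eq)
    fix t assume "t \<in> Poly_Mapping.keys (x 2 False)"
    then have "t \<in> tuples n 2" using ocells_pos[OF x] pos_chains_tuples by blast
    then obtain a b c where "t = [a, b, c]"
      by (auto simp: tuples_def length_Suc_conv numeral_2_eq_2)
    then show "frag_extend (\<lambda>t. if t ! 1 = v then frag_of [] else 0)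
        (\<Sum>l<length t. frag_cmul ((- 1) ^ l) (frag_of (face l t))) =
        (if t ! 1 = v then frag_of [] else 0)"
      by (simp add: lessThan_Suc frag_extend_add frag_extend_diff frag_extend_minus numeral_2_eq_2)
  qed
  show ?thesis
  proof
    fix v assume v: "v \<in> vset (x 1 False)"
    show "v \<in> vset (x 1 True) \<union> vset (x 0 False)"
    proof (rule ccontr)
      assume nv: "v \<notin> vset (x 1 True) \<union> vset (x 0 False)"
      have "v \<in> supp x1" using v x1v unfolding supp_def by (metis UN_I UNIV_I)
      then obtain i where i: "i \<le> m" "v = \<phi> i" unfolding m(2) by auto
      have "x 0 False = frag_of [\<phi> 0]" using x1v(1) by (simp add: m(2) obr_edges)
      then have "i \<noteq> 0" using nv i by (cases i) auto
      \<comment> \<open>The 1-source is a path and \<open>v\<close> is not its initial vertex, so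
        some edge of it enters \<open>v\<close>.\<close>
      have tk: "[\<phi> (i - 1), v] \<in> Poly_Mapping.keys (x 1 False)"
      proof -
        have "Poly_Mapping.lookup (edges m \<phi>) [\<phi> (i - 1), v] > 0"
          unfolding edges_def lookup_sum
          by (rule sum_pos2[of _ i]) (use i \<open>i \<noteq> 0\<close> in auto)
        then show ?thesis using x1v(2) unfolding m(2) obr_edges by (simp add: in_keys_iff)
      qed
      have "Poly_Mapping.lookup (E v (x 1 False)) [] > 0"
        unfolding E0
        by (rule sum_pos2[OF _ tk])
          (use tk ocells_pos[OF x, of 1 False] in \<open>auto simp: pos_chains_def in_keys_iff order_less_le\<close>)
      moreover have "Poly_Mapping.lookup (E v (x 1 True)) [] = 0"
        unfolding E0
      proof (rule sum.neutral, rule ballI)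
        fix t assume t: "t \<in> Poly_Mapping.keys (x 1 True)"
        obtain a b where "t = [a, b]" using pos_chains_1_cases[OF ocells_pos[OF x] t] .
        then have "t ! 1 \<noteq> v" using nv vset_keys[OF t, of b] by auto
        then show "Poly_Mapping.lookup (x 1 True) t * (if t ! 1 = v then 1 else 0) = 0" by simp
      qed
      moreover have "E v (x 1 True) = E v (x 1 False) + E v (bdry (x 2 False))"
        using ocells_bdry[OF x, of 2 False] k2 by (simp add: E_def frag_extend_diff)
      moreover have "Poly_Mapping.lookup (E v (bdry (x 2 False))) [] \<ge> 0"
        unfolding Ebd lookup_frag_extend using ocells_pos[OF x, of 2 False]
        by (intro sum_nonneg) (auto simp: pos_chains_def)
      ultimately show False by (simp add: lookup_add)
    qed
  qed
qed

lemma supp_target_source: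
  assumes x: "x \<in> ocells n k" and k: "k \<ge> 1"
  shows "supp (tto (oriental n) 1 k x) = vset (x 0 False) \<union> vset (x 1 True)"
    and "supp (sto (oriental n) 1 k x) = ssupp x"
proof -
  have *: "y \<in> ocells n 1 \<Longrightarrow> supp y = vset (y 0 False) \<union> vset (y 1 False)" for y
    by (erule ocells_1_obr) (simp, auto simp: obr_edges vset_edges)
  have "tto (oriental n) 1 k x \<in> ocells n 1" "sto (oriental n) 1 k x \<in> ocells n 1"
    using tto_cells[OF strict_icat_oriental, of x n k 1] sto_cells[OF strict_icat_oriental, of x n k 1]
      x k by (simp_all add: oriental_simps)
  then show "supp (tto (oriental n) 1 k x) = vset (x 0 False) \<union> vset (x 1 True)"
    "supp (sto (oriental n) 1 k x) = ssupp x"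
    by (simp_all add: * oriental_tto[OF x k] oriental_sto[OF x k] ssupp_def del: One_nat_def)
qed

text \<open>By induction on the degree of the entry: \<open>vset_bdry\<close> moves a vertex from
  degree at least two down by one, \<open>vset_source_edges\<close> moves one from the 1-source to
  the 1-target, and the 1-target has the same end vertices as \<open>x\<close>.\<close>

lemma supp_target:
  assumes x: "x \<in> ocells n k" and k: "k \<ge> 1"
  shows "supp (tto (oriental n) 1 k x) = supp x"
proof
  let ?T = "vset (x 0 False) \<union> vset (x 1 True)"
  have T: "supp (tto (oriental n) 1 k x) = ?T" by (rule supp_target_source[OF x k])
  show "supp (tto (oriental n) 1 k x) \<subseteq> supp x" unfolding T by (auto simp: supp_def)
  have 0: "vset (x 0 \<epsilon>) \<subseteq> ?T" for \<epsilon>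
  proof (cases \<epsilon>)
    case True
    have "vset (x 0 True) = vset (tto (oriental n) 1 k x 0 True)"
      by (simp add: oriental_tto[OF x k] del: One_nat_def)
    also have "\<dots> \<subseteq> ?T" unfolding T[symmetric] by (auto simp: supp_def)
    finally show ?thesis using True by simp
  qed auto
  have 1: "vset (x 1 \<epsilon>) \<subseteq> ?T" for \<epsilon>
    using vset_source_edges[OF x k] by (cases \<epsilon>) auto
  have "vset (x p \<epsilon>) \<subseteq> ?T" for p \<epsilon>
  proof (induction p arbitrary: \<epsilon>)
    case (Suc p)
    show ?case
    proof (cases "p = 0 \<or> k < Suc p")
      case True
      then show ?thesis using 1 ocells_above[OF x] by auto
    next
      case False
      then have "vset (x (Suc p) \<epsilon>) \<subseteq> vset (bdry (x (Suc p) \<epsilon>))"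
        by (intro vset_bdry[OF ocells_pos[OF x]]) simp
      also have "\<dots> \<subseteq> vset (x p True) \<union> vset (x p False)"
        using ocells_bdry[OF x, of "Suc p" \<epsilon>] False vset_diff by simp
      finally show ?thesis using Suc by blast
    qed
  qed (rule 0)
  then show "supp x \<subseteq> supp (tto (oriental n) 1 k x)" unfolding T supp_def[of x] by (intro UN_least)
qed

section \<open>Vertices of sources, targets and composites\<close>

lemma oriental_cells_simps [simp]: "icells (oriental n) = ocells n"
  by (simp add: oriental_simps)

lemma sto_ocells: "x \<in> ocells n k \<Longrightarrow> j \<le> k \<Longrightarrow> sto (oriental n) j k x \<in> ocells n j"
  and tto_ocells: "x \<in> ocells n k \<Longrightarrow> j \<le> k \<Longrightarrow> tto (oriental n) j k x \<in> ocells n j"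
  using sto_cells[OF strict_icat_oriental, of x n k j] tto_cells[OF strict_icat_oriental, of x n k j]
  by simp_all

lemma ssupp_ocells_1: "x \<in> ocells n 1 \<Longrightarrow> ssupp x = supp x"
  by (erule ocells_1_obr) simp

lemma supp_eqI_target:
  assumes "x \<in> ocells n k" "y \<in> ocells n l" "k \<ge> 1" "l \<ge> 1"
    and "tto (oriental n) 1 k x = tto (oriental n) 1 l y"
  shows "supp x = supp y"
  using supp_target[OF assms(1,3)] supp_target[OF assms(2,4)] assms(5) by simp

lemma supp_eqI_source:
  assumes "x \<in> ocells n k" "y \<in> ocells n l" "k \<ge> 1" "l \<ge> 1"
    and "sto (oriental n) 1 k x = sto (oriental n) 1 l y"
  shows "ssupp x = ssupp y"
  using supp_target_source(2)[OF assms(1,3)] supp_target_source(2)[OF assms(2,4)] assms(5) by simp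

text \<open>For \<open>k = 1\<close> the source is the 1-source itself; for larger \<open>k\<close>
  globularity gives it the same 1-source and 1-target as \<open>x\<close>, and these determine
  \<open>ssupp\<close> and \<open>supp\<close>.\<close>

lemma supp_isrc:
  assumes x: "x \<in> ocells n (Suc k)" and k: "k \<ge> 1"
  shows "supp (isrc (oriental n) k x) = (if k = 1 then ssupp x else supp x)"
    and "ssupp (isrc (oriental n) k x) = ssupp x"
proof -
  have s: "isrc (oriental n) k x \<in> ocells n k" by (rule ocells_src[OF x])
  show "supp (isrc (oriental n) k x) = (if k = 1 then ssupp x else supp x)"
  proof (cases "k = 1")
    case True
    have "sto (oriental n) 1 (Suc k) x = isrc (oriental n) k x" using True by simp
    then show ?thesis using supp_target_source(2)[OF x] True by simp
  next
    case False
    have "tto (oriental n) 1 k (isrc (oriental n) k x) = tto (oriental n) 1 (Suc k) x"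
      using tto_sto[OF strict_icat_oriental, of x n "Suc k" 1 k] x k False by simp
    then show ?thesis using supp_eqI_target[OF s x k] False by simp
  qed
  have "sto (oriental n) 1 k (isrc (oriental n) k x) = sto (oriental n) 1 (Suc k) x"
    using k by simp
  then show "ssupp (isrc (oriental n) k x) = ssupp x" using supp_eqI_source[OF s x k] by simp
qed

lemma supp_itgt:
  assumes x: "x \<in> ocells n (Suc k)" and k: "k \<ge> 1"
  shows "supp (itgt (oriental n) k x) = supp x"
    and "k \<noteq> 1 \<Longrightarrow> ssupp (itgt (oriental n) k x) = ssupp x"
proof -
  have s: "itgt (oriental n) k x \<in> ocells n k" by (rule ocells_tgt[OF x])
  have "tto (oriental n) 1 k (itgt (oriental n) k x) = tto (oriental n) 1 (Suc k) x"
    using k by simp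
  then show "supp (itgt (oriental n) k x) = supp x" using supp_eqI_target[OF s x k] by simp
  assume "k \<noteq> 1"
  then have "sto (oriental n) 1 k (itgt (oriental n) k x) = sto (oriental n) 1 (Suc k) x"
    using sto_tto[OF strict_icat_oriental, of x n "Suc k" 1 k] x k by simp
  then show "ssupp (itgt (oriental n) k x) = ssupp x" using supp_eqI_source[OF s x k] by simp
qed

text \<open>The 1-cells are increasing paths, so they start at their least vertex and end at their
  greatest one, and \<open>x\<close> has the ends of its 1-source and of its 1-target. A 0-cell is
  treated as its own identity 1-cell.\<close>

lemma ends_supp:
  assumes x: "x \<in> ocells n k"
  shows "x 0 False = frag_of [Min (supp x)]" and "x 0 False = frag_of [Min (ssupp x)]"
    and "k \<ge> 1 \<Longrightarrow> x 0 True = frag_of [Max (supp x)]"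
    and "k \<ge> 1 \<Longrightarrow> x 0 True = frag_of [Max (ssupp x)]"
proof -
  have 1: "y 0 False = frag_of [Min (supp y)]" "y 0 True = frag_of [Max (supp y)]" if "y \<in> ocells n 1" for y
  proof -
    obtain m \<phi> where m: "strict_mono_on {..m} \<phi>" "y = obr m \<phi>"
      using ocells_1_obr[OF \<open>y \<in> ocells n 1\<close>] .
    have "Min (\<phi> ` {..m}) = \<phi> 0"
      using strict_mono_on_leD[OF m(1), of 0] by (intro Min_eqI) auto
    moreover have "Max (\<phi> ` {..m}) = \<phi> m"
      using strict_mono_on_leD[OF m(1), of _ m] by (intro Max_eqI) auto
    ultimately show "y 0 False = frag_of [Min (supp y)]" "y 0 True = frag_of [Max (supp y)]"
      unfolding m(2) supp_obr by (simp_all add: obr_edges)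
  qed
  have pos: "x 0 False = frag_of [Min (supp x)] \<and> x 0 False = frag_of [Min (ssupp x)] \<and>
    x 0 True = frag_of [Max (supp x)] \<and> x 0 True = frag_of [Max (ssupp x)]" if k: "k \<ge> 1"
  proof -
    note s = sto_ocells[OF x k] and t = tto_ocells[OF x k]
    show ?thesis
      using 1[OF s] 1[OF t] supp_target[OF x k] supp_target_source(2)[OF x k]
        fun_cong[OF fun_cong[OF oriental_sto[OF x k]], of 0 False]
        fun_cong[OF fun_cong[OF oriental_tto[OF x k]], of 0 False]
        fun_cong[OF fun_cong[OF oriental_sto[OF x k]], of 0 True]
        fun_cong[OF fun_cong[OF oriental_tto[OF x k]], of 0 True] by simp
  qed
  have zero: "x 0 False = frag_of [Min (supp x)] \<and> x 0 False = frag_of [Min (ssupp x)]" if "k = 0"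
  proof -
    have x': "x \<in> ocells n 1" using x that ocells_idt[of x n 0] by simp
    show ?thesis using 1[OF x'] ssupp_ocells_1[OF x'] by simp
  qed
  show "x 0 False = frag_of [Min (supp x)]" "x 0 False = frag_of [Min (ssupp x)]"
    using pos zero by (cases "k = 0"; simp)+
  assume "k \<ge> 1"
  then show "x 0 True = frag_of [Max (supp x)]" "x 0 True = frag_of [Max (ssupp x)]"
    using pos by blast+
qed

lemma concat_image:
  assumes "\<psi> 0 = \<phi> m"
  shows "(\<lambda>i. if i \<le> m then \<phi> i else \<psi> (i - m)) ` {..m + l} = \<phi> ` {..m} \<union> \<psi> ` {..l::nat}"
proof (intro equalityI subsetI)
  fix v assume "v \<in> \<phi> ` {..m} \<union> \<psi> ` {..l}"
  then consider i where "i \<le> m" "v = \<phi> i" | i where "i \<le> l" "v = \<psi> i" by auto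
  then show "v \<in> (\<lambda>i. if i \<le> m then \<phi> i else \<psi> (i - m)) ` {..m + l}"
  proof cases
    case 1
    then show ?thesis by (intro image_eqI[of _ _ i]) auto
  next
    case 2
    then show ?thesis using assms by (intro image_eqI[of _ _ "m + i"]) auto
  qed
qed auto

text \<open>The composite takes its 1-target from \<open>y\<close> and its 1-source from
  \<open>x\<close>. For \<open>j = 1\<close> the 1-target of \<open>x\<close> is the 1-source of
  \<open>y\<close>; for \<open>j \<ge> 2\<close> the two cells have the same 1-source and the same
  1-target.\<close>

lemma supp_icmp_pos:
  assumes c: "composable (oriental n) j k y x" and j: "j \<ge> 1"
  shows "supp (icmp (oriental n) j k y x) = supp y" "ssupp (icmp (oriental n) j k y x) = ssupp x"
    "supp x = (if j = 1 then ssupp y else supp y)" "j \<noteq> 1 \<Longrightarrow> ssupp x = ssupp y"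
proof -
  have x: "x \<in> ocells n k" and y: "y \<in> ocells n k" and jk: "j < k"
    and e: "sto (oriental n) j k y = tto (oriental n) j k x"
    using c by (auto simp: composable_def)
  have k: "k \<ge> 1" using j jk by simp
  note z = ocells_cmp[OF c]
  have "tto (oriental n) 1 k (icmp (oriental n) j k y x) = tto (oriental n) 1 k y"
    using tto_icmp[OF strict_icat_oriental c] tto_tto[of 1 j k "oriental n"] j jk by (metis less_imp_le)
  then show "supp (icmp (oriental n) j k y x) = supp y" by (rule supp_eqI_target[OF z y k k])
  have "sto (oriental n) 1 k (icmp (oriental n) j k y x) = sto (oriental n) 1 k x"
    using sto_icmp[OF strict_icat_oriental c] sto_sto[of 1 j k "oriental n"] j jk by (metis less_imp_le)
  then show "ssupp (icmp (oriental n) j k y x) = ssupp x" by (rule supp_eqI_source[OF z x k k])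
  show "supp x = (if j = 1 then ssupp y else supp y)"
  proof (cases "j = 1")
    case True
    then show ?thesis using e supp_target[OF x k] supp_target_source(2)[OF y k] by simp
  next
    case False
    have "tto (oriental n) 1 k x = tto (oriental n) 1 j (tto (oriental n) j k x)"
      using j jk by (simp add: tto_tto)
    also have "\<dots> = tto (oriental n) 1 j (sto (oriental n) j k y)" by (simp add: e)
    also have "\<dots> = tto (oriental n) 1 k y"
      using tto_sto[OF strict_icat_oriental, of y n k 1 j] y j jk False by simp
    finally show ?thesis using supp_eqI_target[OF x y k k] False by simp
  qed
  assume False: "j \<noteq> 1"
  have "sto (oriental n) 1 k y = sto (oriental n) 1 j (sto (oriental n) j k y)"
    using j jk by (simp add: sto_sto)
  also have "\<dots> = sto (oriental n) 1 j (tto (oriental n) j k x)" by (simp add: e)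
  also have "\<dots> = sto (oriental n) 1 k x"
    using sto_tto[OF strict_icat_oriental, of x n k 1 j] x j jk False by simp
  finally show "ssupp x = ssupp y" using supp_eqI_source[OF y x k k] by simp
qed

lemma vset_pos_Un: "c \<in> pos_chains n p \<Longrightarrow> d \<in> pos_chains n p \<Longrightarrow> vset (c + d) = vset c \<union> vset d"
  using vset_add_nonneg pos_chains_nonneg by blast

text \<open>The entries of degree one are added, without cancellation as they are positive. The end
  vertices lost in degree zero coincide and lie on the 1-source and on the 1-target of
  \<open>x\<close>.\<close>

lemma supp_icmp_0:
  assumes c: "composable (oriental n) 0 k y x"
  shows "supp (icmp (oriental n) 0 k y x) = supp x \<union> supp y"
    "ssupp (icmp (oriental n) 0 k y x) = ssupp x \<union> ssupp y"
    "Max (supp x) = Min (supp y)" "Max (ssupp x) = Min (ssupp y)"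
proof -
  have x: "x \<in> ocells n k" and y: "y \<in> ocells n k" and k: "k \<ge> 1" and e: "y 0 False = x 0 True"
    using c by (auto simp: oriental_composable)
  note z = ocells_cmp[OF c]
  have fin: "finite (supp x)" "finite (supp y)" "finite (ssupp x)" "finite (ssupp y)" using x y by auto
  show "Max (supp x) = Min (supp y)" "Max (ssupp x) = Min (ssupp y)"
    using ends_supp[OF x] ends_supp[OF y] e k by (simp_all add: frag_of_eq)
  have s: "supp w = vset (w 0 False) \<union> vset (w 1 True)" if "w \<in> ocells n k" for w
    using supp_target[OF that k] supp_target_source(1)[OF that k] by simp
  have "vset (y 0 False) \<subseteq> supp x" by (auto simp: e supp_def)
  moreover have "supp (icmp (oriental n) 0 k y x) = vset (x 0 False) \<union> (vset (y 1 True) \<union> vset (x 1 True))"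
    unfolding s[OF z] using vset_pos_Un[OF ocells_pos[OF y] ocells_pos[OF x]] by (simp add: oriental_simps)
  ultimately show "supp (icmp (oriental n) 0 k y x) = supp x \<union> supp y"
    using s[OF x] s[OF y] by auto
  have "vset (y 0 False) \<subseteq> ssupp x"
    using ends_supp(4)[OF x k] Max_in[OF fin(3)] x by (simp add: e)
  moreover have "ssupp (icmp (oriental n) 0 k y x) = vset (x 0 False) \<union> (vset (y 1 False) \<union> vset (x 1 False))"
    unfolding ssupp_def using vset_pos_Un[OF ocells_pos[OF y] ocells_pos[OF x]] by (simp add: oriental_simps)
  ultimately show "ssupp (icmp (oriental n) 0 k y x) = ssupp x \<union> ssupp y"
    by (auto simp: ssupp_def)
qed

section \<open>The action of monotone maps on cells\<close>

lemma omap_cong: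
  assumes "\<And>v. v \<in> supp x \<Longrightarrow> \<phi> v = \<psi> v"
  shows "omap \<phi> x = omap \<psi> x"
proof (intro ext)
  fix p \<epsilon>
  show "omap \<phi> x p \<epsilon> = omap \<psi> x p \<epsilon>"
    unfolding omap_push
  proof (rule frag_extend_eq)
    fix t assume "t \<in> Poly_Mapping.keys (x p \<epsilon>)"
    then have "v \<in> supp x" if "v \<in> set t" for v
      using that unfolding supp_def vset_def by blast
    then have "map \<phi> t = map \<psi> t" using assms by simp
    then show "push \<phi> t = push \<psi> t" unfolding push_def by (rule ssubst) simp
  qed
qed

text \<open>A tuple on which \<open>\<phi>\<close> repeats a vertex also repeats one under the
  composite, so both sides send it to \<open>0\<close>. Unlike in \<open>omap_compose\<close>, the
  maps are arbitrary, so no restriction to an initial segment intervenes.\<close>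

lemma omap_omap: "omap \<psi> (omap \<phi> x) = omap (\<lambda>i. \<psi> (\<phi> i)) x"
proof -
  have "frag_extend (push \<psi>) (push \<phi> t) = push (\<lambda>i. \<psi> (\<phi> i)) t" for t
  proof (cases "distinct (map \<phi> t)")
    case True
    then show ?thesis by (simp add: push_def comp_def)
  next
    case False
    then have "\<not> distinct (map (\<lambda>i. \<psi> (\<phi> i)) t)"
      using distinct_map[of \<psi> "map \<phi> t"] by (simp add: comp_def)
    then show ?thesis using False by (simp add: push_def)
  qed
  then show ?thesis by (intro ext) (simp add: omap_push frag_extend_extend)
qed

lemma omap_ident:
  assumes "x \<in> ocells n k" "\<And>v. v \<in> supp x \<Longrightarrow> \<phi> v = v"
  shows "omap \<phi> x = x"
proof -
  have "omap \<phi> x = omap (restrict id {..n}) x"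
    using assms(2) supp_subset[OF assms(1)] by (intro omap_cong) auto
  then show ?thesis using omap_id[of x n k] assms(1) by simp
qed

lemma delta_restrict: "mono_on {..m} \<phi> \<Longrightarrow> \<phi> ` {..m} \<subseteq> {..n} \<Longrightarrow> restrict \<phi> {..m} \<in> delta m n"
  by (auto simp: delta_def mono_on_def)

lemma omap_restrict: "x \<in> ocells m k \<Longrightarrow> omap (restrict \<phi> {..m}) x = omap \<phi> x"
  using supp_subset by (intro omap_cong) fastforce

lemma omap_ocells:
  assumes "mono_on {..m} \<phi>" "\<phi> ` {..m} \<subseteq> {..n}" "x \<in> ocells m k"
  shows "omap \<phi> x \<in> ocells n k"
  using omap_cells[OF delta_restrict[OF assms(1,2)], of x k] assms(3) by (simp add: omap_restrict)

text \<open>The formulas for the operations of \<open>oriental n\<close> do not refer to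
  \<open>n\<close>, so the index on the right is free and can be chosen at each use.\<close>

lemma omap_ops:
  "omap \<phi> (icmp (oriental m) j k y x) = icmp (oriental n) j k (omap \<phi> y) (omap \<phi> x)"
  "omap \<phi> (isrc (oriental m) k x) = isrc (oriental n) k (omap \<phi> x)"
  "omap \<phi> (itgt (oriental m) k x) = itgt (oriental n) k (omap \<phi> x)"
  by (intro ext; simp add: oriental_simps omap_push frag_extend_add)+

lemma omap_composable:
  assumes "mono_on {..m} \<phi>" "\<phi> ` {..m} \<subseteq> {..n}" "composable (oriental m) j k y x"
  shows "composable (oriental n) j k (omap \<phi> y) (omap \<phi> x)"
  using assms omap_ocells[OF assms(1,2)] by (auto simp: oriental_composable omap_push)

text \<open>An edge collapsed by \<open>\<theta>\<close> disappears, but its two vertices then have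
  the same image. Adjoining the initial vertex accounts for a path that is collapsed
  altogether.\<close>

lemma omap_edges_vset:
  "{\<theta> (\<phi> 0)} \<union> vset (frag_extend (push \<theta>) (edges m \<phi>)) = (\<lambda>i. \<theta> (\<phi> i)) ` {..m}"
proof (induction m)
  case (Suc m)
  have nn: "nonneg (frag_extend (push \<theta>) (edges m \<phi>))" "nonneg (push \<theta> [\<phi> m, \<phi> (Suc m)])" for m
    by (auto simp: edges_def frag_extend_sum comp_def push_def intro!: nonneg_sum)
  show ?case
    unfolding edges_simps frag_extend_add frag_extend_of vset_add_nonneg[OF nn] Un_assoc[symmetric] Suc
    by (auto simp: push_def atMost_Suc intro: image_eqI[of _ _ m])
qed (simp add: edges_simps)

lemma supp_omap_1:
  assumes "x \<in> ocells m 1"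
  shows "vset (omap \<theta> x 0 False) \<union> vset (omap \<theta> x 1 True) = \<theta> ` supp x"
proof -
  obtain l \<phi> where l: "x = obr l \<phi>" using ocells_1_obr[OF assms] by blast
  have "omap \<theta> x 0 False = frag_of [\<theta> (\<phi> 0)]" by (simp add: l omap_push obr_edges push_def)
  then show ?thesis using omap_edges_vset[of \<theta> \<phi> l] by (simp add: l omap_push obr_edges image_image)
qed

text \<open>As \<open>omap\<close> discards collapsed tuples, it might seem to lose vertices. But
  \<open>supp\<close> and \<open>ssupp\<close> are read off the 1-target and the 1-source, which are
  paths, and there \<open>omap_edges_vset\<close> shows that nothing is lost.\<close>

lemma supp_omap:
  assumes \<theta>: "mono_on {..m} \<theta>" "\<theta> ` {..m} \<subseteq> {..n}" and x: "x \<in> ocells m k"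
  shows "supp (omap \<theta> x) = \<theta> ` supp x" and "ssupp (omap \<theta> x) = \<theta> ` ssupp x"
proof -
  have pos: "supp (omap \<theta> x) = \<theta> ` supp x \<and> ssupp (omap \<theta> x) = \<theta> ` ssupp x"
    if k: "k \<ge> 1" and x: "x \<in> ocells m k" for k
  proof
    have y: "omap \<theta> x \<in> ocells n k" by (rule omap_ocells[OF \<theta> x])
    note t = tto_ocells[OF x k] and s = sto_ocells[OF x k]
    have "supp (omap \<theta> x) = vset (omap \<theta> x 0 False) \<union> vset (omap \<theta> x 1 True)"
      using supp_target[OF y k] supp_target_source(1)[OF y k] by simp
    also have "\<dots> = vset (omap \<theta> (tto (oriental m) 1 k x) 0 False) \<union>
        vset (omap \<theta> (tto (oriental m) 1 k x) 1 True)"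
      unfolding omap_push oriental_tto[OF x k] by simp
    also have "\<dots> = \<theta> ` supp x" unfolding supp_omap_1[OF t] supp_target[OF x k] ..
    finally show "supp (omap \<theta> x) = \<theta> ` supp x" .
    have "ssupp (omap \<theta> x) = vset (omap \<theta> (sto (oriental m) 1 k x) 0 False) \<union>
        vset (omap \<theta> (sto (oriental m) 1 k x) 1 True)"
      unfolding ssupp_def omap_push oriental_sto[OF x k] by simp
    also have "\<dots> = \<theta> ` ssupp x" unfolding supp_omap_1[OF s] supp_target_source(2)[OF x k] ..
    finally show "ssupp (omap \<theta> x) = \<theta> ` ssupp x" .
  qed
  have "supp (omap \<theta> x) = \<theta> ` supp x \<and> ssupp (omap \<theta> x) = \<theta> ` ssupp x"
    using pos[OF _ x] pos[of 1] ocells_idt[of x m 0] x by (cases "k = 0") auto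
  then show "supp (omap \<theta> x) = \<theta> ` supp x" "ssupp (omap \<theta> x) = \<theta> ` ssupp x" by blast+
qed

lemma ssupp_ends:
  assumes "x \<in> ocells n k" "k \<ge> 1"
  shows "Min (ssupp x) = Min (supp x)" "Max (ssupp x) = Max (supp x)"
  using ends_supp[OF assms(1)] assms(2) by (simp_all add: frag_of_eq)

section \<open>Paths in a split-free category\<close>

lemma categoryD:
  assumes "category A"
  shows "f \<in> arr A \<Longrightarrow> cdom A f \<in> obj A" "f \<in> arr A \<Longrightarrow> ccod A f \<in> obj A"
    "a \<in> obj A \<Longrightarrow> cone A a \<in> arr A" "a \<in> obj A \<Longrightarrow> cdom A (cone A a) = a"
    "a \<in> obj A \<Longrightarrow> ccod A (cone A a) = a"
    "f \<in> arr A \<Longrightarrow> g \<in> arr A \<Longrightarrow> cdom A g = ccod A f \<Longrightarrow> ccmp A g f \<in> arr A"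
    "f \<in> arr A \<Longrightarrow> g \<in> arr A \<Longrightarrow> cdom A g = ccod A f \<Longrightarrow> cdom A (ccmp A g f) = cdom A f"
    "f \<in> arr A \<Longrightarrow> g \<in> arr A \<Longrightarrow> cdom A g = ccod A f \<Longrightarrow> ccod A (ccmp A g f) = ccod A g"
    "f \<in> arr A \<Longrightarrow> ccmp A f (cone A (cdom A f)) = f" "f \<in> arr A \<Longrightarrow> ccmp A (cone A (ccod A f)) f = f"
    "f \<in> arr A \<Longrightarrow> g \<in> arr A \<Longrightarrow> h \<in> arr A \<Longrightarrow> cdom A g = ccod A f \<Longrightarrow> cdom A h = ccod A g \<Longrightarrow>
      ccmp A (ccmp A h g) f = ccmp A h (ccmp A g f)"
  using assms unfolding category_def by blast+

text \<open>A functor to \<open>A\<close> from the ordered set \<open>{..n}\<close>, that is, a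
  simplex of the usual nerve; \<open>r i j\<close> is the image of \<open>i \<le> j\<close>. Values
  at other arguments are unconstrained.\<close>

definition simplex_data :: "('o, 'a) cat \<Rightarrow> nat \<Rightarrow> (nat \<Rightarrow> 'o) \<Rightarrow> (nat \<Rightarrow> nat \<Rightarrow> 'a) \<Rightarrow> bool" where
  "simplex_data A n ob r \<longleftrightarrow>
    (\<forall>i\<le>n. ob i \<in> obj A \<and> r i i = cone A (ob i)) \<and>
    (\<forall>i j. i \<le> j \<and> j \<le> n \<longrightarrow> r i j \<in> arr A \<and> cdom A (r i j) = ob i \<and> ccod A (r i j) = ob j) \<and>
    (\<forall>i j k. i \<le> j \<and> j \<le> k \<and> k \<le> n \<longrightarrow> r i k = ccmp A (r j k) (r i j))"

lemma simplex_dataD: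
  assumes "simplex_data A n ob r"
  shows "i \<le> n \<Longrightarrow> ob i \<in> obj A" "i \<le> n \<Longrightarrow> r i i = cone A (ob i)"
    "i \<le> j \<Longrightarrow> j \<le> n \<Longrightarrow> r i j \<in> arr A" "i \<le> j \<Longrightarrow> j \<le> n \<Longrightarrow> cdom A (r i j) = ob i"
    "i \<le> j \<Longrightarrow> j \<le> n \<Longrightarrow> ccod A (r i j) = ob j"
    "i \<le> j \<Longrightarrow> j \<le> k \<Longrightarrow> k \<le> n \<Longrightarrow> r i k = ccmp A (r j k) (r i j)"
  using assms unfolding simplex_data_def by blast+

lemma simplex_data_comp:
  assumes "simplex_data A n ob r" "mono_on {..m} \<theta>" "\<theta> ` {..m} \<subseteq> {..n}"
  shows "simplex_data A m (\<lambda>i. ob (\<theta> i)) (\<lambda>i j. r (\<theta> i) (\<theta> j))"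
proof -
  have le: "\<theta> i \<le> n" if "i \<le> m" for i using assms(3) that by auto
  have mono: "\<theta> i \<le> \<theta> j" if "i \<le> j" "j \<le> m" for i j
    using mono_onD[OF assms(2), of i j] that by auto
  show ?thesis
    unfolding simplex_data_def
  proof (intro conjI allI impI)
    fix i j assume "i \<le> j \<and> j \<le> m"
    then show "r (\<theta> i) (\<theta> j) \<in> arr A" "cdom A (r (\<theta> i) (\<theta> j)) = ob (\<theta> i)"
      "ccod A (r (\<theta> i) (\<theta> j)) = ob (\<theta> j)"
      using simplex_dataD(3-5)[OF assms(1) mono[of i j] le[of j]] by blast+
  next
    fix i j k assume "i \<le> j \<and> j \<le> k \<and> k \<le> m"
    then show "r (\<theta> i) (\<theta> k) = ccmp A (r (\<theta> j) (\<theta> k)) (r (\<theta> i) (\<theta> j))"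
      by (intro simplex_dataD(6)[OF assms(1)] mono le) auto
  qed (use simplex_dataD(1,2)[OF assms(1)] le in blast)+
qed

definition pob :: "('o, 'a) cat \<Rightarrow> 'o \<times> 'a list \<Rightarrow> nat \<Rightarrow> 'o" where
  "pob A z i = path_end A (fst z, take i (snd z))"

text \<open>Together with \<open>pob\<close> this is the simplex given by the path \<open>z\<close>.
  The identities need a separate clause because \<open>arr_composite\<close> is unspecified on the
  empty list.\<close>

definition par :: "('o, 'a) cat \<Rightarrow> 'o \<times> 'a list \<Rightarrow> nat \<Rightarrow> nat \<Rightarrow> 'a" where
  "par A z i j = (if i < j then arr_composite A (map ((!) (snd z)) [i..<j]) else cone A (pob A z i))"

locale split_free_cat =
  fixes A :: "('o, 'a) cat"
  assumes cat: "category A" and sf: "split_free A"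
begin

lemmas catD = categoryD[OF cat]

lemma path_obj: "is_path A a fs \<Longrightarrow> a \<in> obj A"
  using catD by (cases fs) auto

lemma path_end_Cons: "path_end A (a, f # fs) = path_end A (ccod A f, fs)"
  by simp

lemma is_path_append:
  "is_path A a (fs @ gs) \<longleftrightarrow> is_path A a fs \<and> is_path A (path_end A (a, fs)) gs"
proof (induction fs arbitrary: a)
  case Nil
  then show ?case using path_obj by auto
next
  case (Cons f fs)
  then show ?case unfolding append_Cons is_path.simps path_end_Cons by blast
qed

lemma path_end_append: "path_end A (a, fs @ gs) = path_end A (path_end A (a, fs), gs)"
  by simp

lemma arr_composite_path:
  assumes "is_path A a fs" "fs \<noteq> []"
  shows "arr_composite A fs \<in> arr A" "cdom A (arr_composite A fs) = a"
    "ccod A (arr_composite A fs) = path_end A (a, fs)"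
proof -
  have "arr_composite A fs \<in> arr A \<and> cdom A (arr_composite A fs) = a \<and>
    ccod A (arr_composite A fs) = path_end A (a, fs)"
    using assms
  proof (induction fs arbitrary: a)
    case (Cons f fs)
    show ?case
    proof (cases fs)
      case (Cons g gs)
      have f: "f \<in> arr A" "cdom A f = a" "is_path A (ccod A f) fs" using Cons.prems by auto
      have ih: "arr_composite A fs \<in> arr A" "cdom A (arr_composite A fs) = ccod A f"
        "ccod A (arr_composite A fs) = path_end A (ccod A f, fs)"
        using Cons.IH[OF f(3)] Cons by auto
      have "arr_composite A (f # fs) = ccmp A (arr_composite A fs) f" by (simp add: Cons)
      then show ?thesis unfolding path_end_Cons using catD(6-8)[OF f(1) ih(1,2)] ih(3) f(2) by simp
    qed (use Cons.prems in auto)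
  qed simp
  then show "arr_composite A fs \<in> arr A" "cdom A (arr_composite A fs) = a"
    "ccod A (arr_composite A fs) = path_end A (a, fs)" by blast+
qed

lemma arr_composite_append:
  assumes "is_path A a (fs @ gs)" "fs \<noteq> []" "gs \<noteq> []"
  shows "arr_composite A (fs @ gs) = ccmp A (arr_composite A gs) (arr_composite A fs)"
  using assms
proof (induction fs arbitrary: a)
  case (Cons f fs)
  show ?case
  proof (cases fs)
    case Nil
    then show ?thesis using Cons.prems(3) by (cases gs) auto
  next
    case (Cons f' fs')
    have f: "f \<in> arr A" "cdom A f = a" and p: "is_path A (ccod A f) (fs @ gs)"
      using Cons.prems by auto
    have ih: "arr_composite A (fs @ gs) = ccmp A (arr_composite A gs) (arr_composite A fs)"
      using Cons.IH[OF p] Cons Cons.prems(3) by simp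
    have p': "is_path A (ccod A f) fs" "is_path A (path_end A (ccod A f, fs)) gs"
      using p is_path_append by blast+
    have "fs \<noteq> []" using Cons by simp
    note F = arr_composite_path[OF p'(1) this] and G = arr_composite_path[OF p'(2) Cons.prems(3)]
    have "arr_composite A ((f # fs) @ gs) = ccmp A (arr_composite A (fs @ gs)) f"
      by (simp add: Cons)
    also have "\<dots> = ccmp A (arr_composite A gs) (ccmp A (arr_composite A fs) f)"
      unfolding ih using F G f by (intro catD(11)) auto
    finally show ?thesis by (simp add: Cons)
  qed
qed simp

text \<open>If a composite \<open>G \<circ> f\<close> is an identity then \<open>f\<close> is a split monomorphism, hence an identity.\<close>

lemma arr_composite_not_identity:
  assumes "is_path A a fs" "fs \<noteq> []"
  shows "\<not> is_identity A (arr_composite A fs)"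
proof (cases fs)
  case (Cons f gs)
  show ?thesis
  proof (cases "gs = []")
    case False
    have f: "f \<in> arr A" "cdom A f = a" "\<not> is_identity A f" "is_path A (ccod A f) gs"
      using assms Cons by auto
    let ?G = "arr_composite A gs"
    note G = arr_composite_path[OF f(4) False]
    have eq: "arr_composite A fs = ccmp A ?G f" using Cons False by (cases gs) auto
    show ?thesis
    proof
      assume "is_identity A (arr_composite A fs)"
      then obtain b where b: "b \<in> obj A" "ccmp A ?G f = cone A b"
        unfolding is_identity_def eq by blast
      have "b = a" using catD(7)[OF f(1) G(1,2)] catD(4)[OF b(1)] b(2) f(2) by simp
      moreover have "b = ccod A ?G" using catD(8)[OF f(1) G(1,2)] catD(5)[OF b(1)] b(2) by simp
      ultimately have "split_mono A f" unfolding split_mono_def using f G b(2) by auto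
      then show False using sf f(3) unfolding split_free_def by blast
    qed
  qed (use assms Cons in auto)
qed (use assms in simp)

lemma paths_is_path: "z \<in> paths A \<Longrightarrow> is_path A (fst z) (snd z)"
  by (auto simp: paths_def)

lemma take_segment: "i \<le> j \<Longrightarrow> j \<le> length fs \<Longrightarrow> take j fs = take i fs @ map ((!) fs) [i..<j]"
  by (rule nth_equalityI) (auto simp: nth_append)

lemma path_segment:
  assumes "z \<in> paths A" "i \<le> j" "j \<le> plen z"
  shows "is_path A (pob A z i) (map ((!) (snd z)) [i..<j])"
    and "path_end A (pob A z i, map ((!) (snd z)) [i..<j]) = pob A z j"
proof -
  have "is_path A (fst z) (take j (snd z))"
    using paths_is_path[OF assms(1)] is_path_append[of "fst z" "take j (snd z)" "drop j (snd z)"] by simp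
  then show "is_path A (pob A z i) (map ((!) (snd z)) [i..<j])"
    unfolding take_segment[OF assms(2,3)] is_path_append pob_def by blast
  show "path_end A (pob A z i, map ((!) (snd z)) [i..<j]) = pob A z j"
    unfolding pob_def take_segment[OF assms(2,3)] path_end_append ..
qed

lemma pob_obj: "z \<in> paths A \<Longrightarrow> i \<le> plen z \<Longrightarrow> pob A z i \<in> obj A"
  using path_segment(1)[of z i i] by simp

lemma path_simplex_data:
  assumes z: "z \<in> paths A"
  shows "simplex_data A (plen z) (pob A z) (par A z)"
  unfolding simplex_data_def
proof (intro conjI allI impI)
  fix i assume "i \<le> plen z"
  then show "pob A z i \<in> obj A" by (rule pob_obj[OF z])
  show "par A z i i = cone A (pob A z i)" by (simp add: par_def)
next
  fix i j assume ij: "i \<le> j \<and> j \<le> plen z"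
  have o: "pob A z i \<in> obj A" using ij by (intro pob_obj[OF z]) simp
  have "par A z i j \<in> arr A \<and> cdom A (par A z i j) = pob A z i \<and> ccod A (par A z i j) = pob A z j"
  proof (cases "i < j")
    case True
    then show ?thesis
      using arr_composite_path[OF path_segment(1)[OF z, of i j]] path_segment(2)[OF z, of i j] ij
      by (simp add: par_def del: path_end.simps)
  next
    case False
    then have "i = j" using ij by simp
    then show ?thesis using catD(3-5)[OF o] by (simp add: par_def)
  qed
  then show "par A z i j \<in> arr A" "cdom A (par A z i j) = pob A z i" "ccod A (par A z i j) = pob A z j"
    by blast+
next
  fix i j k assume ijk: "i \<le> j \<and> j \<le> k \<and> k \<le> plen z"
  let ?s = "\<lambda>i j. map ((!) (snd z)) [i..<j]"
  have arrs: "par A z i k \<in> arr A \<and> cdom A (par A z i k) = pob A z i \<and> ccod A (par A z i k) = pob A z k"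
    if "i \<le> k" "k \<le> plen z" for i k
  proof (cases "i < k")
    case True
    then show ?thesis
      using arr_composite_path[OF path_segment(1)[OF z, of i k]] path_segment(2)[OF z, of i k] that
      by (simp add: par_def del: path_end.simps)
  next
    case False
    then have "i = k" "pob A z i \<in> obj A" using that pob_obj[OF z] by auto
    then show ?thesis using catD(3-5) by (simp add: par_def)
  qed
  consider "i = j" | "j = k" | "i < j" "j < k" using ijk by linarith
  then show "par A z i k = ccmp A (par A z j k) (par A z i j)"
  proof cases
    case 1
    then show ?thesis using arrs[of i k] catD(9)[of "par A z i k"] ijk by (simp add: par_def)
  next
    case 2
    have "par A z k k = cone A (pob A z k)" by (simp add: par_def)
    then show ?thesis using arrs[of i k] catD(10)[of "par A z i k"] ijk 2 by simp
  next
    case 3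
    have s: "?s i k = ?s i j @ ?s j k"
      using upt_add_eq_append[of i j "k - j"] ijk by (simp flip: map_append)
    have "is_path A (pob A z i) (?s i j @ ?s j k)"
      using path_segment(1)[OF z, of i k] ijk unfolding s by simp
    then have "arr_composite A (?s i k) = ccmp A (arr_composite A (?s j k)) (arr_composite A (?s i j))"
      unfolding s by (rule arr_composite_append) (use 3 in auto)
    then show ?thesis using 3 by (simp add: par_def)
  qed
qed

lemma par_not_identity:
  assumes "z \<in> paths A" "i < j" "j \<le> plen z"
  shows "\<not> is_identity A (par A z i j)"
  using arr_composite_not_identity[OF path_segment(1)[OF assms(1), of i j]] assms(2,3)
  by (simp add: par_def)

text \<open>This is how split-freeness is used later: whether two vertices of a simplex are sent to
  the same position of a path can be read off the arrows of the simplex.\<close>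

lemma par_identity_iff:
  assumes "z \<in> paths A" "i \<le> j" "j \<le> plen z"
  shows "is_identity A (par A z i j) \<longleftrightarrow> i = j"
  using par_not_identity[OF assms(1) _ assms(3), of i] pob_obj[OF assms(1), of i] assms(2,3)
  by (auto simp: par_def is_identity_def)

lemma par_Suc: "i < plen z \<Longrightarrow> par A z i (Suc i) = snd z ! i"
  by (simp add: par_def)

lemma pob_0 [simp]: "pob A z 0 = fst z"
  by (simp add: pob_def)

lemma pob_plen: "pob A z (plen z) = path_end A z"
  by (cases z) (simp add: pob_def)

section \<open>Paths from simplex data, and the restriction of a path to a set of vertices\<close>

definition steps :: "nat \<Rightarrow> (nat \<Rightarrow> 'o) \<Rightarrow> (nat \<Rightarrow> nat \<Rightarrow> 'a) \<Rightarrow> 'o \<times> 'a list" where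
  "steps n ob r = (ob 0, map (\<lambda>i. r i (Suc i)) [0..<n])"

lemma plen_steps [simp]: "plen (steps n ob r) = n" and fst_steps [simp]: "fst (steps n ob r) = ob 0"
  by (simp_all add: steps_def)

lemma steps_path:
  assumes d: "simplex_data A n ob r" and ni: "\<And>i. i < n \<Longrightarrow> \<not> is_identity A (r i (Suc i))"
  shows "steps n ob r \<in> paths A" "i \<le> n \<Longrightarrow> pob A (steps n ob r) i = ob i"
    "i \<le> j \<Longrightarrow> j \<le> n \<Longrightarrow> par A (steps n ob r) i j = r i j"
proof -
  let ?z = "steps n ob r"
  have pe: "path_end A (ob 0, map (\<lambda>i. r i (Suc i)) [0..<k]) = ob k" if "k \<le> n" for k
    using that simplex_dataD(5)[OF d, of "k - 1" k] by (cases k) auto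
  have "is_path A (ob 0) (map (\<lambda>i. r i (Suc i)) [0..<k])" if "k \<le> n" for k
    using that
  proof (induction k)
    case 0
    then show ?case using simplex_dataD(1)[OF d] by simp
  next
    case (Suc k)
    then show ?case
      using is_path_append[of "ob 0" "map (\<lambda>i. r i (Suc i)) [0..<k]" "[r k (Suc k)]"] pe[of k]
        simplex_dataD(3-5)[OF d, of k "Suc k"] ni[of k] simplex_dataD(1)[OF d, of "Suc k"]
      by (simp del: path_end.simps)
  qed
  then show z: "?z \<in> paths A" by (simp add: paths_def steps_def)
  show o: "pob A ?z i = ob i" if "i \<le> n" for i
    using pe[OF that] that by (simp add: pob_def steps_def take_map del: path_end.simps)
  have "par A ?z i (i + k) = r i (i + k)" if "i + k \<le> n" for k
    using that
  proof (induction k)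
    case 0
    then show ?case using simplex_dataD(2)[OF d, of i] o[of i] by (simp add: par_def)
  next
    case (Suc k)
    have "par A ?z i (i + Suc k) = ccmp A (par A ?z (i + k) (Suc (i + k))) (par A ?z i (i + k))"
      using simplex_dataD(6)[OF path_simplex_data[OF z], of i "i + k" "i + Suc k"] Suc.prems by simp
    also have "par A ?z (i + k) (Suc (i + k)) = r (i + k) (Suc (i + k))"
      using par_Suc[of "i + k" ?z] Suc.prems by (simp add: steps_def)
    also have "par A ?z i (i + k) = r i (i + k)" using Suc by simp
    also have "ccmp A (r (i + k) (Suc (i + k))) (r i (i + k)) = r i (i + Suc k)"
      using simplex_dataD(6)[OF d, of i "i + k" "i + Suc k"] Suc.prems by simp
    finally show ?case .
  qed
  then show "i \<le> j \<Longrightarrow> j \<le> n \<Longrightarrow> par A ?z i j = r i j" by (metis le_add_diff_inverse)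
qed

lemma path_eqI:
  assumes "fst y = fst z" "plen y = plen z" "\<And>i. i < plen z \<Longrightarrow> par A y i (Suc i) = par A z i (Suc i)"
  shows "y = z"
  using assms par_Suc by (intro prod_eqI nth_equalityI) auto

text \<open>The face of the simplex of \<open>z\<close> spanned by \<open>W\<close>, read as a path
  again; for a singleton it is the empty path at the corresponding object.\<close>

definition prestr :: "'o \<times> 'a list \<Rightarrow> nat set \<Rightarrow> 'o \<times> 'a list" where
  "prestr z W = steps (card W - 1) (\<lambda>i. pob A z (enum W i)) (\<lambda>i j. par A z (enum W i) (enum W j))"

lemma plen_prestr [simp]: "plen (prestr z W) = card W - 1"
  by (simp add: prestr_def)

lemma fst_prestr: "finite W \<Longrightarrow> W \<noteq> {} \<Longrightarrow> fst (prestr z W) = pob A z (Min W)"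
  by (simp add: prestr_def enum_0)

lemma prestr_path:
  assumes z: "z \<in> paths A" and W: "W \<subseteq> {..plen z}" "W \<noteq> {}"
  shows "prestr z W \<in> paths A" "i \<le> card W - 1 \<Longrightarrow> pob A (prestr z W) i = pob A z (enum W i)"
    "i \<le> j \<Longrightarrow> j \<le> card W - 1 \<Longrightarrow> par A (prestr z W) i j = par A z (enum W i) (enum W j)"
proof -
  have fin: "finite W" using W(1) finite_subset by blast
  obtain m where m: "card W = Suc m" "strict_mono_on {..m} (enum W)" "enum W ` {..m} = W"
    using enumE[OF fin W(2)] .
  have "simplex_data A m (\<lambda>i. pob A z (enum W i)) (\<lambda>i j. par A z (enum W i) (enum W j))"
    using m W(1) by (intro simplex_data_comp[OF path_simplex_data[OF z]] strict_mono_on_imp_mono_on) auto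
  moreover have "\<not> is_identity A (par A z (enum W i) (enum W (Suc i)))" if "i < m" for i
    using m(3) W(1) that by (intro par_not_identity[OF z] strict_mono_onD[OF m(2)]) auto
  ultimately show "prestr z W \<in> paths A" "i \<le> card W - 1 \<Longrightarrow> pob A (prestr z W) i = pob A z (enum W i)"
    "i \<le> j \<Longrightarrow> j \<le> card W - 1 \<Longrightarrow> par A (prestr z W) i j = par A z (enum W i) (enum W j)"
    unfolding prestr_def m(1) diff_Suc_1 using steps_path[of m] by simp_all
qed

lemma path_end_prestr:
  assumes z: "z \<in> paths A" and W: "W \<subseteq> {..plen z}" "W \<noteq> {}"
  shows "path_end A (prestr z W) = pob A z (Max W)"
proof -
  have fin: "finite W" using W(1) finite_subset by blast
  show ?thesis
    using pob_plen[of "prestr z W"] prestr_path(2)[OF z W, of "card W - 1"] enum_last[OF fin W(2)] by simp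
qed

lemma prestr_all: "prestr z {..plen z} = z"
  by (rule path_eqI) (auto simp: prestr_def enum_atMost par_Suc steps_def nth_append intro!: par_Suc[symmetric])

end

section \<open>From orientals to \<open>\<tilde>A\<close>\<close>

lemma card_image_kernel_eq:
  assumes "\<And>u v. u \<in> S \<Longrightarrow> v \<in> S \<Longrightarrow> f u = f v \<longleftrightarrow> g u = g v"
  shows "card (f ` S) = card (g ` S)"
proof -
  define e where "e y = g (SOME u. u \<in> S \<and> f u = y)" for y
  have e: "e (f u) = g u" if "u \<in> S" for u
  proof -
    have "(SOME v. v \<in> S \<and> f v = f u) \<in> S \<and> f (SOME v. v \<in> S \<and> f v = f u) = f u"
      using that by (intro someI[of "\<lambda>v. v \<in> S \<and> f v = f u"]) simp
    then show ?thesis using assms that unfolding e_def by blast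
  qed
  have "bij_betw e (f ` S) (g ` S)"
    by (rule bij_betw_imageI) (auto simp: inj_on_def e assms image_image)
  then show ?thesis by (rule bij_betw_same_card)
qed

text \<open>The rank of \<open>f v\<close> among the values of \<open>f\<close> counts classes of
  the preorder that \<open>f\<close> induces on \<open>V\<close>, so it depends on this preorder
  only. It serves to compare two degeneracies of the same cell.\<close>

lemma rank_kernel_eq:
  assumes "v \<in> V" "\<And>u v. u \<in> V \<Longrightarrow> v \<in> V \<Longrightarrow> f u \<le> f v \<longleftrightarrow> g u \<le> (g v :: nat)"
  shows "rank (f ` V) (f v) = rank (g ` V) (g v)"
proof -
  let ?S = "{u \<in> V. f u \<le> f v}"
  have "{w \<in> f ` V. w \<le> f v} = f ` ?S" by auto
  moreover have "{w \<in> g ` V. w \<le> g v} = g ` ?S" using assms by auto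
  moreover have "card (f ` ?S) = card (g ` ?S)"
  proof (rule card_image_kernel_eq)
    fix u w assume "u \<in> ?S" "w \<in> ?S"
    then show "f u = f w \<longleftrightarrow> g u = g w" using assms(2)[of u w] assms(2)[of w u] by auto
  qed
  ultimately show ?thesis by (simp add: rank_def)
qed

text \<open>The inclusion of the vertices of the 1-source into those of the 1-target, expressed by
  positions. It is made extensional to match the function space in
  \<open>refinements\<close>.\<close>

definition refinement :: "ocell \<Rightarrow> nat \<Rightarrow> nat" where
  "refinement \<alpha> = (\<lambda>i\<in>{..card (ssupp \<alpha>) - 1}. rank (supp \<alpha>) (enum (ssupp \<alpha>) i))"

lemma refinement_le: "finite (supp \<alpha>) \<Longrightarrow> i \<le> card (ssupp \<alpha>) - 1 \<Longrightarrow> refinement \<alpha> i \<le> card (supp \<alpha>) - 1"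
  using rank_le[of "supp \<alpha>"] by (simp add: refinement_def)

lemma enum_ssupp_in:
  assumes "\<alpha> \<in> ocells n k" "i \<le> card (ssupp \<alpha>) - 1"
  shows "enum (ssupp \<alpha>) i \<in> ssupp \<alpha>"
proof -
  have "card (ssupp \<alpha>) > 0" using assms(1) by (simp add: card_gt_0_iff)
  then show ?thesis using enum_in[of "ssupp \<alpha>" i] assms by simp
qed

lemma hom_cells: "x \<in> icells (hom_icat X u v) j \<longleftrightarrow>
    x \<in> icells X (j + 2) \<and> sto X 1 (j + 2) x = u \<and> tto X 1 (j + 2) x = v"
  by (simp add: hom_icat_def)

context split_free_cat
begin

text \<open>The index \<open>k\<close> cannot be recovered from \<alpha>, since identities of
  orientals do not change the family. For \<open>k = 0\<close> the support is a single vertex, and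
  the first component of the restricted path is its object.\<close>

definition tcell :: "'o \<times> 'a list \<Rightarrow> nat \<Rightarrow> ocell \<Rightarrow> ('o, 'a) tcell" where
  "tcell z k \<alpha> =
    (if k = 0 then TObj (fst (prestr z (supp \<alpha>)))
     else if k = 1 then TOne (prestr z (supp \<alpha>))
     else THi (prestr z (ssupp \<alpha>)) (prestr z (supp \<alpha>)) (refinement \<alpha>) (omap (rank (supp \<alpha>)) \<alpha>))"

text \<open>Two descriptions of one simplex, by paths and monotone maps, yield the same cells. By
  \<open>par_identity_iff\<close> the arrows determine which vertices \<open>\<theta>\<close>
  identifies, hence the preorder that it induces; this fixes all ranks and cardinalities, and with
  the objects and arrows also the restricted paths.\<close>

lemma tcell_omap_cong:
  assumes z: "z \<in> paths A" "mono_on {..m} \<theta>" "\<theta> ` {..m} \<subseteq> {..plen z}"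
    and z': "z' \<in> paths A" "mono_on {..m} \<theta>'" "\<theta>' ` {..m} \<subseteq> {..plen z'}"
    and ob: "\<And>i. i \<le> m \<Longrightarrow> pob A z (\<theta> i) = pob A z' (\<theta>' i)"
    and ar: "\<And>i j. i \<le> j \<Longrightarrow> j \<le> m \<Longrightarrow> par A z (\<theta> i) (\<theta> j) = par A z' (\<theta>' i) (\<theta>' j)"
    and \<alpha>: "\<alpha> \<in> ocells m k"
  shows "tcell z k (omap \<theta> \<alpha>) = tcell z' k (omap \<theta>' \<alpha>)"
proof -
  have eq: "\<theta> i = \<theta> j \<longleftrightarrow> \<theta>' i = \<theta>' j" if "i \<le> j" "j \<le> m" for i j
  proof -
    have "\<theta> i \<le> \<theta> j" "\<theta> j \<le> plen z" "\<theta>' i \<le> \<theta>' j" "\<theta>' j \<le> plen z'"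
      using mono_onD[OF z(2), of i j] mono_onD[OF z'(2), of i j] z(3) z'(3) that by auto
    then show ?thesis 
      using par_identity_iff[OF z(1), of "\<theta> i" "\<theta> j"] par_identity_iff[OF z'(1), of "\<theta>' i" "\<theta>' j"] ar[OF that]
      by simp
  qed
  have le: "\<theta> i \<le> \<theta> j \<longleftrightarrow> \<theta>' i \<le> \<theta>' j" if "i \<le> m" "j \<le> m" for i j
  proof (cases "i \<le> j")
    case True
    then show ?thesis using mono_onD[OF z(2), of i j] mono_onD[OF z'(2), of i j] that by simp
  next
    case False
    then have "\<theta> j \<le> \<theta> i" "\<theta>' j \<le> \<theta>' i" "\<theta> j = \<theta> i \<longleftrightarrow> \<theta>' j = \<theta>' i"
      using mono_onD[OF z(2), of j i] mono_onD[OF z'(2), of j i] eq[of j i] that by simp_all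
    then show ?thesis by linarith
  qed
  have sub: "V \<subseteq> {..m} \<Longrightarrow> finite V" for V using finite_subset by blast
  have rk: "rank (\<theta> ` V) (\<theta> v) = rank (\<theta>' ` V) (\<theta>' v)" if "V \<subseteq> {..m}" "v \<in> V" for V v
    using that le by (intro rank_kernel_eq) auto
  have cd: "card (\<theta> ` V) = card (\<theta>' ` V)" if "V \<subseteq> {..m}" for V
  proof (rule card_image_kernel_eq)
    fix u v assume "u \<in> V" "v \<in> V"
    then show "\<theta> u = \<theta> v \<longleftrightarrow> \<theta>' u = \<theta>' v" using le[of u v] le[of v u] that
      by (auto simp: eq_iff subset_iff)
  qed
  \<comment> \<open>The \<open>i\<close>-th elements of both images come from one and the same
    vertex of \<open>V\<close>, because their ranks agree.\<close>
  have en: "\<exists>v\<in>V. enum (\<theta> ` V) i = \<theta> v \<and> enum (\<theta>' ` V) i = \<theta>' v"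
    if "V \<subseteq> {..m}" "i < card (\<theta> ` V)" for V i
  proof -
    have fin: "finite (\<theta> ` V)" "finite (\<theta>' ` V)" using sub[OF that(1)] by auto
    have "enum (\<theta> ` V) i \<in> \<theta> ` V" using enum_in[OF fin(1) that(2)] .
    then obtain v where v: "v \<in> V" "enum (\<theta> ` V) i = \<theta> v" by auto
    then have "rank (\<theta>' ` V) (\<theta>' v) = i"
      using rk[OF that(1) v(1)] rank_enum[OF fin(1) that(2)] by simp
    then show ?thesis using v enum_rank[OF fin(2), of "\<theta>' v"] by auto
  qed
  have pr: "prestr z (\<theta> ` V) = prestr z' (\<theta>' ` V)" if V: "V \<subseteq> {..m}" "V \<noteq> {}" for V
  proof (rule path_eqI)
    have fin: "finite (\<theta> ` V)" using sub[OF V(1)] by auto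
    have c: "card (\<theta> ` V) > 0" using fin V(2) by (simp add: card_gt_0_iff)
    show "fst (prestr z (\<theta> ` V)) = fst (prestr z' (\<theta>' ` V))"
      using en[OF V(1) c] ob V(1) by (auto simp: prestr_def)
    show "plen (prestr z (\<theta> ` V)) = plen (prestr z' (\<theta>' ` V))" by (simp add: cd[OF V(1)])
    fix i assume "i < plen (prestr z' (\<theta>' ` V))"
    then have i: "i < card (\<theta> ` V)" "Suc i < card (\<theta> ` V)" "i < card (\<theta>' ` V) - 1"
      "i < card (\<theta> ` V) - 1" by (simp_all add: cd[OF V(1)])
    obtain u where u: "u \<in> V" "enum (\<theta> ` V) i = \<theta> u" "enum (\<theta>' ` V) i = \<theta>' u"
      using en[OF V(1) i(1)] by blast
    obtain v where v: "v \<in> V" "enum (\<theta> ` V) (Suc i) = \<theta> v" "enum (\<theta>' ` V) (Suc i) = \<theta>' v"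
      using en[OF V(1) i(2)] by blast
    have "\<theta> u < \<theta> v"
      using rank_enum[OF fin i(1)] rank_enum[OF fin i(2)] 
        rank_mono[OF fin, of "\<theta> v" "\<theta> u"] u(2) v(2)
      by (metis Suc_n_not_le_n not_le_imp_less)
    then have "u \<le> v" using mono_onD[OF z(2), of v u] u(1) v(1) V(1) by (metis in_mono linorder_le_cases not_le)
    then have "par A z (\<theta> u) (\<theta> v) = par A z' (\<theta>' u) (\<theta>' v)" using ar v(1) V(1) by auto
    then show "par A (prestr z (\<theta> ` V)) i (Suc i) = par A (prestr z' (\<theta>' ` V)) i (Suc i)"
      using i by (simp add: par_Suc) (simp add: prestr_def steps_def u v)
  qed
  note s = supp_omap[OF z(2,3) \<alpha>] and s' = supp_omap[OF z'(2,3) \<alpha>]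
  have W: "supp \<alpha> \<subseteq> {..m}" "supp \<alpha> \<noteq> {}" and U: "ssupp \<alpha> \<subseteq> {..m}" "ssupp \<alpha> \<noteq> {}"
    using supp_subset[OF \<alpha>] ssupp_subset_supp[of \<alpha>] \<alpha> by auto
  have "rank (\<theta> ` supp \<alpha>) (enum (\<theta> ` ssupp \<alpha>) i) = rank (\<theta>' ` supp \<alpha>) (enum (\<theta>' ` ssupp \<alpha>) i)"
    if "i \<le> card (\<theta> ` ssupp \<alpha>) - 1" for i
  proof -
    have "card (\<theta> ` ssupp \<alpha>) > 0" using sub[OF U(1)] U(2) by (simp add: card_gt_0_iff)
    then have "i < card (\<theta> ` ssupp \<alpha>)" using that by simp
    from en[OF U(1) this] show ?thesis using rk[OF W(1)] ssupp_subset_supp[of \<alpha>] by auto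
  qed
  moreover have "omap (rank (\<theta> ` supp \<alpha>)) (omap \<theta> \<alpha>) = omap (rank (\<theta>' ` supp \<alpha>)) (omap \<theta>' \<alpha>)"
    unfolding omap_omap using rk[OF W(1)] by (rule omap_cong)
  ultimately show ?thesis
    unfolding tcell_def refinement_def s s' pr[OF W] pr[OF U] using cd[OF U(1)] by (simp add: restrict_def fun_eq_iff)
qed

lemma tcell_prestr:
  assumes z: "z \<in> paths A" and W: "W \<subseteq> {..plen z}" "W \<noteq> {}" and \<alpha>: "\<alpha> \<in> ocells (card W - 1) k"
  shows "tcell (prestr z W) k \<alpha> = tcell z k (omap (enum W) \<alpha>)"
proof -
  have fin: "finite W" using W(1) finite_subset by blast
  obtain m where m: "card W = Suc m" "strict_mono_on {..m} (enum W)" "enum W ` {..m} = W"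
    using enumE[OF fin W(2)] .
  have "mono_on {..m} (enum W)" by (rule strict_mono_on_imp_mono_on[OF m(2)])
  then have "tcell (prestr z W) k (omap (\<lambda>i. i) \<alpha>) = tcell z k (omap (enum W) \<alpha>)"
    by (intro tcell_omap_cong[of _ m])
      (use prestr_path[OF z W] z W m \<alpha> in \<open>auto intro!: mono_onI\<close>)
  then show ?thesis using omap_ident[OF \<alpha>] by simp
qed

text \<open>After relabelling by \<open>rank\<close>, the vertices fill an initial segment, so the
  1-target has the support of the maximal 1-cell and equals it, 1-cells being determined by their
  supports; the 1-source is treated likewise. The refinement preserves both ends because
  \<open>supp\<close> and \<open>ssupp\<close> have the same minimum and maximum.\<close>

lemma tcell_THi_props:
  assumes z: "z \<in> paths A" and \<alpha>: "\<alpha> \<in> ocells (plen z) k" and k: "k \<ge> 2"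
  shows "refinement \<alpha> \<in> refinements A (prestr z (ssupp \<alpha>)) (prestr z (supp \<alpha>))"
    and "omap (rank (supp \<alpha>)) \<alpha> \<in> icells (hom_icat (oriental (card (supp \<alpha>) - 1))
      (obr (card (ssupp \<alpha>) - 1) (refinement \<alpha>)) (obr (card (supp \<alpha>) - 1) id)) (k - 2)"
proof -
  let ?U = "ssupp \<alpha>" and ?W = "supp \<alpha>"
  let ?p = "card ?W - 1" and ?m = "card ?U - 1"
  let ?\<phi> = "\<lambda>i\<in>{..?m}. rank ?W (enum ?U i)"
  have k1: "k \<ge> 1" using k by simp
  have W: "?W \<subseteq> {..plen z}" "?W \<noteq> {}" "finite ?W" and U: "?U \<subseteq> {..plen z}" "?U \<noteq> {}" "finite ?U"
    and UW: "?U \<subseteq> ?W"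
    using supp_subset[OF \<alpha>] ssupp_subset_supp[of \<alpha>] \<alpha> by auto
  have cU: "card ?U > 0" using U by (simp add: card_gt_0_iff)
  note r = rank_strict_mono_on[OF W(3) UW U(2)]
  have eW: "enum ?U i \<in> ?W" if "i \<le> ?m" for i
  proof -
    have "i < card ?U" using that cU by simp
    then show ?thesis using enum_in[OF U(3)] UW by blast
  qed
  have sm: "strict_mono_on {..?m} ?\<phi>" using r(1) by (simp add: strict_mono_on_def)
  have im: "?\<phi> ` {..?m} = rank ?W ` ?U" using r(2) by (metis image_restrict_eq)
  have le: "?\<phi> i \<le> ?p" if "i \<le> ?m" for i using rank_le[OF W(3)] that by simp
  show "refinement \<alpha> \<in> refinements A (prestr z ?U) (prestr z ?W)"
    unfolding refinements_def mem_Collect_eq plen_prestr refinement_def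
  proof (intro conjI ballI)
    show "?\<phi> \<in> {..?m} \<rightarrow>\<^sub>E {..?p}" using rank_le[OF W(3)] by auto
    show "strict_mono_on {..?m} ?\<phi>" by (rule sm)
    show "?\<phi> 0 = 0" using enum_0[OF U(3,2)] ssupp_ends(1)[OF \<alpha> k1] rank_Min[OF W(3,2)] by simp
    show "?\<phi> ?m = ?p" using enum_last[OF U(3,2)] ssupp_ends(2)[OF \<alpha> k1] rank_Max[OF W(3,2)] by simp
    fix i assume i: "i \<in> {1..?m}"
    then have lt: "?\<phi> (i - 1) < ?\<phi> i" by (intro strict_mono_onD[OF sm]) auto
    have "arr_composite A (map ((!) (snd (prestr z ?W))) [?\<phi> (i - 1)..<?\<phi> i]) =
        par A (prestr z ?W) (?\<phi> (i - 1)) (?\<phi> i)" using lt by (simp add: par_def)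
    also have "\<dots> = par A z (enum ?W (?\<phi> (i - 1))) (enum ?W (?\<phi> i))"
      using lt le[of i] i by (intro prestr_path(3)[OF z W(1,2)]) auto
    also have "\<dots> = par A z (enum ?U (i - 1)) (enum ?U i)"
      using i enum_rank[OF W(3) eW[of i]] enum_rank[OF W(3) eW[of "i - 1"]] by (auto simp: le_diff_conv)
    also have "\<dots> = snd (prestr z ?U) ! (i - 1)"
    proof -
      have "i - 1 < plen (prestr z ?U)" "Suc (i - 1) = i" using i by auto
      then show ?thesis
        using i par_Suc[of "i - 1" "prestr z ?U"] prestr_path(3)[OF z U(1,2), of "i - 1" i] by simp
    qed
    finally show "arr_composite A (map ((!) (snd (prestr z ?W))) [?\<phi> (i - 1)..<?\<phi> i]) =
        snd (prestr z ?U) ! (i - 1)" .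
  qed
  note rp = rank_props[OF W(3), of "plen z"]
  have oc: "omap (rank ?W) \<alpha> \<in> ocells ?p k" by (rule omap_ocells[OF rp \<alpha>])
  note so = supp_omap[OF rp \<alpha>]
  have o1: "obr ?m ?\<phi> \<in> ocells ?p 1" using le by (intro obr_cells[OF sm]) auto
  have o2: "obr ?p id \<in> ocells ?p 1" by (intro obr_cells) (auto simp: strict_mono_on_def)
  have "sto (oriental ?p) 1 k (omap (rank ?W) \<alpha>) = obr ?m ?\<phi>"
    by (rule ocells_1_eqI[OF sto_ocells[OF oc k1] o1])
      (use supp_target_source(2)[OF oc k1] so(2) im in simp)
  moreover have "tto (oriental ?p) 1 k (omap (rank ?W) \<alpha>) = obr ?p id"
    by (rule ocells_1_eqI[OF tto_ocells[OF oc k1] o2])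
      (use supp_target[OF oc k1] so(1) rank_image_self[OF W(3,2)] in simp)
  moreover have "k - 2 + 2 = k" using k by simp
  ultimately show "omap (rank ?W) \<alpha> \<in> icells (hom_icat (oriental ?p) (obr ?m (refinement \<alpha>)) (obr ?p id)) (k - 2)"
    using oc unfolding hom_cells refinement_def by (simp only: oriental_cells_simps)
qed

lemma tcell_cells:
  assumes z: "z \<in> paths A" and \<alpha>: "\<alpha> \<in> ocells (plen z) k"
  shows "tcell z k \<alpha> \<in> tilde_cells A k"
proof -
  let ?U = "ssupp \<alpha>" and ?W = "supp \<alpha>"
  have W: "?W \<subseteq> {..plen z}" "?W \<noteq> {}" "finite ?W" and U: "?U \<subseteq> {..plen z}" "?U \<noteq> {}" "finite ?U"
    using supp_subset[OF \<alpha>] ssupp_subset_supp[of \<alpha>] \<alpha> by auto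
  note pW = prestr_path(1)[OF z W(1,2)] and pU = prestr_path(1)[OF z U(1,2)]
  consider "k = 0" | "k = 1" | "k \<ge> 2" by linarith
  then show ?thesis
  proof cases
    case 1
    then show ?thesis using pob_obj[OF pW, of 0] by (simp add: tcell_def)
  next
    case 2
    then show ?thesis using pW by (simp add: tcell_def)
  next
    case 3
    then have k1: "k \<ge> 1" by simp
    obtain j where j: "k = Suc (Suc j)" using 3 by (metis Suc_le_D numeral_2_eq_2 Suc_le_mono)
    have "fst (prestr z ?U) = fst (prestr z ?W)" "path_end A (prestr z ?U) = path_end A (prestr z ?W)"
      using ssupp_ends[OF \<alpha> k1] fst_prestr[OF W(3,2)] fst_prestr[OF U(3,2)]
        path_end_prestr[OF z W(1,2)] path_end_prestr[OF z U(1,2)] by simp_all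
    then show ?thesis
      using tcell_THi_props[OF z \<alpha> 3] pW pU unfolding tcell_def j
      by (simp del: path_end.simps split_paired_Ex)
  qed
qed

end

text \<open>Gluing the two enumerations at the common vertex \<open>Max V = Min W\<close> gives a
  strictly increasing map onto the union, and such a map is unique. The shared vertex is counted
  once, so that the numbers of steps, not of vertices, add up.\<close>

lemma enum_rank_union:
  assumes V: "finite V" "V \<noteq> {}" and W: "finite W" "W \<noteq> {}" and eq: "Max V = Min W"
  shows "card (V \<union> W) - 1 = (card V - 1) + (card W - 1)"
    and "i \<le> card V - 1 \<Longrightarrow> enum (V \<union> W) i = enum V i"
    and "i \<le> card W - 1 \<Longrightarrow> enum (V \<union> W) (card V - 1 + i) = enum W i"
    and "v \<in> V \<Longrightarrow> rank (V \<union> W) v = rank V v"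
    and "w \<in> W \<Longrightarrow> rank (V \<union> W) w = card V - 1 + rank W w"
proof -
  obtain p where p: "card V = Suc p" "strict_mono_on {..p} (enum V)" "enum V ` {..p} = V"
    using enumE[OF V] .
  obtain q where q: "card W = Suc q" "strict_mono_on {..q} (enum W)" "enum W ` {..q} = W"
    using enumE[OF W] .
  let ?c = "\<lambda>i. if i \<le> p then enum V i else enum W (i - p)"
  have e: "enum W 0 = enum V p" using enum_0[OF W] enum_last[OF V] eq p(1) by simp
  have sm: "strict_mono_on {..p + q} ?c"
  proof (rule strict_mono_onI)
    fix r s assume rs: "r \<in> {..p + q}" "s \<in> {..p + q}" "r < s"
    consider "s \<le> p" | "r \<le> p" "p < s" | "p < r" using rs by linarith
    then show "?c r < ?c s"
    proof cases
      case 1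
      then show ?thesis using rs strict_mono_onD[OF p(2), of r s] by simp
    next
      case 2
      have "enum V r \<le> enum V p" using 2 by (intro strict_mono_on_leD[OF p(2)]) auto
      moreover have "enum W 0 < enum W (s - p)" using 2 rs by (intro strict_mono_onD[OF q(2)]) auto
      ultimately show ?thesis using 2 e by simp
    next
      case 3
      then show ?thesis using rs strict_mono_onD[OF q(2), of "r - p" "s - p"] by auto
    qed
  qed
  have im: "?c ` {..p + q} = V \<union> W" 
    using concat_image[where \<phi> = "enum V" and \<psi> = "enum W", OF e, of q] unfolding p(3) q(3) .
  have 1: "?c (p + i) = enum W i" for i using e by (cases i) auto
  show c: "card (V \<union> W) - 1 = (card V - 1) + (card W - 1)"
    using card_image_strict_mono[OF sm] p(1) q(1) unfolding im by simp
  have en: "enum (V \<union> W) i = ?c i" "rank (V \<union> W) (?c i) = i" if "i \<le> p + q" for i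
    using enum_image[OF sm that] rank_image[OF sm that] unfolding im by blast+
  show "i \<le> card V - 1 \<Longrightarrow> enum (V \<union> W) i = enum V i" using en(1)[of i] p(1) by simp
  show "i \<le> card W - 1 \<Longrightarrow> enum (V \<union> W) (card V - 1 + i) = enum W i"
    using en(1)[of "p + i"] 1 p(1) q(1) by simp
  show "rank (V \<union> W) v = rank V v" if "v \<in> V"
    using en(2)[of "rank V v"] rank_le[OF V(1), of v] enum_rank[OF V(1) that] p(1) by simp
  show "rank (V \<union> W) w = card V - 1 + rank W w" if "w \<in> W"
    using en(2)[of "p + rank W w"] rank_le[OF W(1), of w] enum_rank[OF W(1) that] p(1) q(1)
    unfolding 1 by simp
qed

section \<open>Compatibility of \<open>tcell\<close> with the operations\<close>

context split_free_cat
begin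

lemma tilde_simps [simp]:
  "icells (tilde A) = tilde_cells A" "isrc (tilde A) = tilde_src A" "itgt (tilde A) = tilde_tgt A"
  "iidt (tilde A) = tilde_idt A" "icmp (tilde A) = tilde_cmp A"
  by (simp_all add: tilde_def)

definition tfun :: "'o \<times> 'a list \<Rightarrow> nat \<Rightarrow> ocell \<Rightarrow> ('o, 'a) tcell" where
  "tfun z = (\<lambda>k. \<lambda>\<alpha>\<in>ocells (plen z) k. tcell z k \<alpha>)"

lemma tfun_apply: "\<alpha> \<in> ocells (plen z) k \<Longrightarrow> tfun z k \<alpha> = tcell z k \<alpha>"
  by (simp add: tfun_def)

lemma prestr_union:
  assumes V: "finite V" "V \<noteq> {}" and W: "finite W" "W \<noteq> {}" and eq: "Max V = Min W"
  shows "prestr z (V \<union> W) = pconcat (prestr z V) (prestr z W)"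
proof -
  define p q where pq: "p = card V - 1" "q = card W - 1"
  note u = enum_rank_union[OF V W eq, folded pq]
  have "map (\<lambda>i. par A z (enum (V \<union> W) i) (enum (V \<union> W) (Suc i))) [0..<p + q] =
    map (\<lambda>i. par A z (enum V i) (enum V (Suc i))) [0..<p] @
    map (\<lambda>i. par A z (enum W i) (enum W (Suc i))) [0..<q]" (is "?L = ?R")
  proof (rule nth_equalityI)
    fix i assume "i < length ?L"
    then have i: "i < p + q" by simp
    show "?L ! i = ?R ! i"
    proof (cases "i < p")
      case True
      then show ?thesis using u(2)[of i] u(2)[of "Suc i"] i by (simp add: nth_append)
    next
      case False
      then obtain k where k: "i = p + k" using le_Suc_ex not_less by blast
      then show ?thesis using u(3)[of k] u(3)[of "Suc k"] i by (simp add: nth_append)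
    qed
  qed simp
  moreover have "enum (V \<union> W) 0 = enum V 0" using u(2)[of 0] by simp
  ultimately show ?thesis unfolding prestr_def steps_def pconcat_def u(1) pq[symmetric] by simp
qed

text \<open>The same \<alpha> stands on both sides because identities of orientals are invisible. A
  0-cell has one vertex and gives an empty path; a 1-cell has \<open>ssupp = supp\<close>, so its
  refinement is an identity and its relabelling is the maximal 1-cell.\<close>

lemma tcell_idt:
  assumes z: "z \<in> paths A" and \<alpha>: "\<alpha> \<in> ocells (plen z) k"
  shows "tcell z (Suc k) \<alpha> = tilde_idt A k (tcell z k \<alpha>)"
proof -
  consider "k = 0" | "k = 1" | "k \<ge> 2" by linarith
  then show ?thesis
  proof cases
    case 1
    obtain v where "\<alpha> 0 False = frag_of [v]" using ocells_vertex[OF \<alpha>] by blast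
    moreover have "supp \<alpha> = vset (\<alpha> 0 False)"
    proof -
      have "\<alpha> p \<epsilon> = (if p = 0 then \<alpha> 0 False else 0)" for p \<epsilon>
        using ocells_above[OF \<alpha>, of p] ocells_top[OF \<alpha>] 1 by (cases "p = 0"; cases \<epsilon>) auto
      then have "vset (\<alpha> p \<epsilon>) \<subseteq> vset (\<alpha> 0 False)" for p \<epsilon> by (rule ssubst) simp
      then show ?thesis unfolding supp_def by (intro equalityI UN_least) auto
    qed
    ultimately have "supp \<alpha> = {v}" by simp
    then show ?thesis by (simp add: tcell_def 1 prestr_def steps_def)
  next
    case 2
    note fs = finite_supp[OF \<alpha>] and ne = supp_nonempty[OF \<alpha>]
    have s: "ssupp \<alpha> = supp \<alpha>" using ssupp_ocells_1 \<alpha> 2 by simp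
    have c: "i \<le> card (supp \<alpha>) - 1 \<Longrightarrow> i < card (supp \<alpha>)" for i
      using fs ne by (simp add: card_gt_0_iff)  (metis card_gt_0_iff Suc_pred le_imp_less_Suc One_nat_def)
    have r: "refinement \<alpha> = restrict id {..card (supp \<alpha>) - 1}"
      using rank_enum[OF fs] c by (intro ext) (simp add: refinement_def s restrict_def)
    have \<alpha>1: "\<alpha> \<in> ocells (plen z) 1" using \<alpha> 2 by simp
    note rp = rank_props[OF fs, of "plen z"]
    have "omap (rank (supp \<alpha>)) \<alpha> = obr (card (supp \<alpha>) - 1) id"
      by (rule ocells_1_eqI[OF omap_ocells[OF rp \<alpha>1] obr_cells])
        (use supp_omap(1)[OF rp \<alpha>] rank_image_self[OF fs ne] in \<open>auto simp: strict_mono_on_def\<close>)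
    then show ?thesis using 2 r by (simp add: tcell_def s oriental_simps)
  next
    case 3
    then show ?thesis by (simp add: tcell_def oriental_simps)
  qed
qed

lemma tcell_src:
  assumes z: "z \<in> paths A" and \<alpha>: "\<alpha> \<in> ocells (plen z) (Suc k)"
  shows "tcell z k (isrc (oriental (plen z)) k \<alpha>) = tilde_src A k (tcell z (Suc k) \<alpha>)"
proof -
  have W: "supp \<alpha> \<subseteq> {..plen z}" "supp \<alpha> \<noteq> {}" "finite (supp \<alpha>)" using supp_subset[OF \<alpha>] \<alpha> by auto
  note s = ocells_src[OF \<alpha>]
  consider "k = 0" | "k = 1" | "k \<ge> 2" by linarith
  then show ?thesis
  proof cases
    case 1
    have "frag_of [Min (supp (isrc (oriental (plen z)) k \<alpha>))] = frag_of [Min (supp \<alpha>)]"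
      using ends_supp(1)[OF s] ends_supp(1)[OF \<alpha>] 1 by (simp add: oriental_simps)
    then show ?thesis
      using 1 fst_prestr[OF W(3,2)] fst_prestr[of "supp (isrc (oriental (plen z)) k \<alpha>)" z] s
      by (simp add: tcell_def frag_of_eq)
  next
    case 2
    then show ?thesis using supp_isrc(1)[OF \<alpha>] by (simp add: tcell_def)
  next
    case 3
    then show ?thesis using supp_isrc[OF \<alpha>] omap_ops(2)
      by (simp add: tcell_def refinement_def)
  qed
qed

lemma tcell_tgt:
  assumes z: "z \<in> paths A" and \<alpha>: "\<alpha> \<in> ocells (plen z) (Suc k)"
  shows "tcell z k (itgt (oriental (plen z)) k \<alpha>) = tilde_tgt A k (tcell z (Suc k) \<alpha>)"
proof -
  have W: "supp \<alpha> \<subseteq> {..plen z}" "supp \<alpha> \<noteq> {}" "finite (supp \<alpha>)" using supp_subset[OF \<alpha>] \<alpha> by auto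
  note s = ocells_tgt[OF \<alpha>]
  consider "k = 0" | "k = 1" | "k \<ge> 2" by linarith
  then show ?thesis
  proof cases
    case 1
    have "frag_of [Min (supp (itgt (oriental (plen z)) k \<alpha>))] = frag_of [Max (supp \<alpha>)]"
      using ends_supp(1)[OF s] ends_supp(3)[OF \<alpha>] 1 by (simp add: oriental_simps)
    then show ?thesis
      using 1 path_end_prestr[OF z W(1,2)] fst_prestr[of "supp (itgt (oriental (plen z)) k \<alpha>)" z] s
      by (simp add: tcell_def frag_of_eq del: path_end.simps)
  next
    case 2
    then show ?thesis using supp_itgt(1)[OF \<alpha>] by (simp add: tcell_def)
  next
    case 3
    then show ?thesis using supp_itgt[OF \<alpha>] omap_ops(3)
      by (simp add: tcell_def refinement_def)
  qed
qed

text \<open>The three clauses of \<open>tilde_cmp\<close> reflect how the supports are related. For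
  \<open>j = 0\<close> they overlap in one vertex and positions in \<beta> are shifted by the length
  of the path of \<alpha>; for \<open>j = 1\<close> the support of \<alpha> is the vertex set of the
  1-source of \<beta>; for \<open>j \<ge> 2\<close> the supports agree, and so do the
  1-sources.\<close>

lemma tcell_cmp:
  assumes z: "z \<in> paths A" and c: "composable (oriental (plen z)) j k \<beta> \<alpha>"
  shows "tcell z k (icmp (oriental (plen z)) j k \<beta> \<alpha>) = tilde_cmp A j k (tcell z k \<beta>) (tcell z k \<alpha>)"
proof -
  let ?n = "plen z"
  have \<alpha>: "\<alpha> \<in> ocells ?n k" and \<beta>: "\<beta> \<in> ocells ?n k" and jk: "j < k"
    using c by (auto simp: composable_def)
  note fin = finite_supp[OF \<alpha>] finite_supp[OF \<beta>] finite_ssupp[OF \<alpha>] finite_ssupp[OF \<beta>]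
  note ne = supp_nonempty[OF \<alpha>] supp_nonempty[OF \<beta>] ssupp_nonempty[OF \<alpha>] ssupp_nonempty[OF \<beta>]
  show ?thesis
  proof (cases "j = 0")
    case True
    note c0 = c[unfolded True]
    note s = supp_icmp_0[OF c0]
    note uW = enum_rank_union[OF fin(1) ne(1) fin(2) ne(2) s(3)]
      and uU = enum_rank_union[OF fin(3) ne(3) fin(4) ne(4) s(4)]
    have pW: "prestr z (supp \<alpha> \<union> supp \<beta>) = pconcat (prestr z (supp \<alpha>)) (prestr z (supp \<beta>))"
      by (rule prestr_union[OF fin(1) ne(1) fin(2) ne(2) s(3)])
    have pU: "prestr z (ssupp \<alpha> \<union> ssupp \<beta>) = pconcat (prestr z (ssupp \<alpha>)) (prestr z (ssupp \<beta>))"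
      by (rule prestr_union[OF fin(3) ne(3) fin(4) ne(4) s(4)])
    show ?thesis
    proof (cases "k = 1")
      case k1: True
      then show ?thesis unfolding True using s(1) pW by (simp add: tcell_def)
    next
      case False
      let ?l = "card (ssupp \<alpha>) - 1" and ?l' = "card (ssupp \<beta>) - 1" and ?p = "card (supp \<alpha>) - 1"
      have r: "refinement (icmp (oriental ?n) 0 k \<beta> \<alpha>) = map_concat ?l ?l' ?p (refinement \<alpha>) (refinement \<beta>)"
      proof
        fix i
        consider "i \<le> ?l" | "?l < i" "i \<le> ?l + ?l'" | "i > ?l + ?l'" by linarith
        then show "refinement (icmp (oriental ?n) 0 k \<beta> \<alpha>) i =
            map_concat ?l ?l' ?p (refinement \<alpha>) (refinement \<beta>) i"
        proof cases
          case 1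
          have "enum (ssupp \<alpha>) i \<in> supp \<alpha>" using enum_ssupp_in[OF \<alpha> 1] ssupp_subset_supp by blast
          then show ?thesis using 1 uU(2)[OF 1] uW(4)
            unfolding refinement_def map_concat_def s(1,2) uU(1) by simp
        next
          case 2
          then obtain i' where i': "i = ?l + i'" using le_Suc_ex less_imp_le by blast
          then have i2: "i' \<le> ?l'" using 2 by simp
          have "enum (ssupp \<beta>) i' \<in> supp \<beta>" using enum_ssupp_in[OF \<beta> i2] ssupp_subset_supp by blast
          then show ?thesis using 2 i2 i' uU(3)[OF i2] uW(5)
            unfolding refinement_def map_concat_def s(1,2) uU(1) by simp
        next
          case 3
          then show ?thesis unfolding refinement_def map_concat_def s(1,2) uU(1) by simp
        qed
      qed
      let ?m = "card (supp \<alpha>) - 1 + (card (supp \<beta>) - 1)"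
      have o1: "omap (rank (supp \<alpha> \<union> supp \<beta>)) \<beta> = omap (\<lambda>i. ?p + i) (omap (rank (supp \<beta>)) \<beta>)"
        unfolding omap_omap using uW(5) by (rule omap_cong)
      have o2: "omap (rank (supp \<alpha> \<union> supp \<beta>)) \<alpha> = omap (\<lambda>i. i) (omap (rank (supp \<alpha>)) \<alpha>)"
        unfolding omap_omap using uW(4) by (rule omap_cong)
      have "omap (rank (supp \<alpha> \<union> supp \<beta>)) (icmp (oriental ?n) 0 k \<beta> \<alpha>) =
          icmp (oriental ?m) 0 k (omap (\<lambda>i. ?p + i) (omap (rank (supp \<beta>)) \<beta>))
            (omap (\<lambda>i. i) (omap (rank (supp \<alpha>)) \<alpha>))"
        unfolding omap_ops(1)[where n = ?m] o1 o2 ..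
      then show ?thesis unfolding True using False jk r pW pU s(1,2) by (simp add: tcell_def)
    qed
  next
    case False
    then have j1: "j \<ge> 1" and k2: "k \<noteq> 0" "k \<noteq> 1" using jk by auto
    note s = supp_icmp_pos[OF c j1]
    show ?thesis
    proof (cases "j = 1")
      case True
      have sx: "supp \<alpha> = ssupp \<beta>" using s(3) True by simp
      have r: "compose {..card (ssupp \<alpha>) - 1} (refinement \<beta>) (refinement \<alpha>) =
          refinement (icmp (oriental ?n) j k \<beta> \<alpha>)"
      proof
        fix i
        show "compose {..card (ssupp \<alpha>) - 1} (refinement \<beta>) (refinement \<alpha>) i =
          refinement (icmp (oriental ?n) j k \<beta> \<alpha>) i"
        proof (cases "i \<le> card (ssupp \<alpha>) - 1")
          case i: True
          have "refinement \<alpha> i \<le> card (ssupp \<beta>) - 1" using refinement_le[OF fin(1) i] by (simp add: sx)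
          moreover have "enum (ssupp \<beta>) (refinement \<alpha> i) = enum (ssupp \<alpha>) i"
            using enum_rank[OF fin(1), of "enum (ssupp \<alpha>) i"] enum_ssupp_in[OF \<alpha> i] ssupp_subset_supp[of \<alpha>] i
            by (auto simp: refinement_def sx)
          ultimately show ?thesis using i s(1,2) by (simp add: compose_def refinement_def[of \<beta>])
              (simp add: refinement_def)
        qed (simp add: compose_def refinement_def s(2))
      qed
      \<comment> \<open>As \<open>supp \<alpha> = ssupp \<beta>\<close>,
        \<open>refinement \<beta>\<close> turns positions in \<open>supp \<alpha>\<close> into
        positions in \<open>supp \<beta>\<close>.\<close>
      have o: "omap (refinement \<beta>) (omap (rank (supp \<alpha>)) \<alpha>) = omap (rank (supp \<beta>)) \<alpha>"
        unfolding omap_omap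
      proof (rule omap_cong)
        fix v assume v: "v \<in> supp \<alpha>"
        then show "refinement \<beta> (rank (supp \<alpha>) v) = rank (supp \<beta>) v"
          using enum_rank[OF fin(1) v] rank_le[OF fin(1), of v] by (simp add: refinement_def sx)
      qed
      show ?thesis
        using k2 r o s(1,2) omap_ops(1) True by (simp add: tcell_def)
    next
      case j2: False
      then have sx: "supp \<alpha> = supp \<beta>" "ssupp \<alpha> = ssupp \<beta>" using s(3,4) by simp_all
      have "refinement (icmp (oriental ?n) j k \<beta> \<alpha>) = refinement \<alpha>"
        unfolding refinement_def s(1,2) sx ..
      moreover have "omap (rank (supp \<beta>)) (icmp (oriental ?n) j k \<beta> \<alpha>) =
          icmp (oriental (card (supp \<beta>) - 1)) j k (omap (rank (supp \<beta>)) \<beta>) (omap (rank (supp \<beta>)) \<alpha>)"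
        by (rule omap_ops(1))
      ultimately show ?thesis
        using k2 False j2 s(1,2) sx by (simp add: tcell_def)
    qed
  qed
qed

lemma ifunctor_tfun:
  assumes z: "z \<in> paths A"
  shows "ifunctor (oriental (plen z)) (tilde A) (tfun z)"
  unfolding ifunctor_def oriental_cells_simps tilde_simps
proof (intro conjI allI ballI impI)
  fix k show "tfun z k \<in> ocells (plen z) k \<rightarrow>\<^sub>E tilde_cells A k"
    using tcell_cells[OF z] by (auto simp: tfun_def)
next
  fix k x assume x: "x \<in> ocells (plen z) (Suc k)"
  show "tfun z k (isrc (oriental (plen z)) k x) = tilde_src A k (tfun z (Suc k) x)"
    using tcell_src[OF z x] tfun_apply[OF x] tfun_apply[OF ocells_src[OF x]] by simp
  show "tfun z k (itgt (oriental (plen z)) k x) = tilde_tgt A k (tfun z (Suc k) x)"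
    using tcell_tgt[OF z x] tfun_apply[OF x] tfun_apply[OF ocells_tgt[OF x]] by simp
next
  fix k x assume x: "x \<in> ocells (plen z) k"
  show "tfun z (Suc k) (iidt (oriental (plen z)) k x) = tilde_idt A k (tfun z k x)"
    using tcell_idt[OF z x] tfun_apply[OF x] tfun_apply[OF ocells_idt[OF x]] by (simp add: oriental_simps)
next
  fix j k y x assume c: "composable (oriental (plen z)) j k y x"
  then have "x \<in> ocells (plen z) k" "y \<in> ocells (plen z) k" by (auto simp: composable_def)
  then show "tfun z k (icmp (oriental (plen z)) j k y x) = tilde_cmp A j k (tfun z k y) (tfun z k x)"
    using tcell_cmp[OF z c] tfun_apply ocells_cmp[OF c] by simp
qed

end

section \<open>\<open>\<tilde>A\<close> is a strict \<open>\<infinity>\<close>-category\<close>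

lemma ocells_mono: "x \<in> ocells n j \<Longrightarrow> j \<le> k \<Longrightarrow> x \<in> ocells n k"
  by (induction k) (auto simp: le_Suc_eq intro: ocells_idt)

lemma supp_sto_tto:
  assumes x: "x \<in> ocells n k" and j: "1 \<le> j" "j \<le> k"
  shows "supp (tto (oriental n) j k x) = supp x"
    and "2 \<le> j \<Longrightarrow> supp (sto (oriental n) j k x) = supp x"
    and "j = 1 \<Longrightarrow> supp (sto (oriental n) j k x) = ssupp x"
proof -
  have k: "1 \<le> k" using j by simp
  show "supp (tto (oriental n) j k x) = supp x"
    by (rule supp_eqI_target[OF tto_ocells[OF x j(2)] x j(1) k]) (rule tto_tto[OF j])
  show "supp (sto (oriental n) j k x) = supp x" if "2 \<le> j"
    by (rule supp_eqI_target[OF sto_ocells[OF x j(2)] x j(1) k])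
      (rule tto_sto[OF strict_icat_oriental], use x that j in auto)
  show "j = 1 \<Longrightarrow> supp (sto (oriental n) j k x) = ssupp x"
    using supp_target_source(2)[OF x k] by blast
qed

context split_free_cat
begin

lemma tcell_sto:
  assumes "z \<in> paths A" "\<alpha> \<in> ocells (plen z) k" "j \<le> k"
  shows "sto (tilde A) j k (tcell z k \<alpha>) = tcell z j (sto (oriental (plen z)) j k \<alpha>)"
  using ifunctor_sto[OF strict_icat_oriental ifunctor_tfun[OF assms(1)], of \<alpha> k j] assms
  by (simp add: tfun_apply sto_ocells)

lemma tcell_tto:
  assumes "z \<in> paths A" "\<alpha> \<in> ocells (plen z) k" "j \<le> k"
  shows "tto (tilde A) j k (tcell z k \<alpha>) = tcell z j (tto (oriental (plen z)) j k \<alpha>)"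
  using ifunctor_tto[OF strict_icat_oriental ifunctor_tfun[OF assms(1)], of \<alpha> k j] assms
  by (simp add: tfun_apply tto_ocells)

lemma tcell_ito:
  assumes "z \<in> paths A" "\<alpha> \<in> ocells (plen z) j" "j \<le> k"
  shows "ito (tilde A) j k (tcell z j \<alpha>) = tcell z k \<alpha>"
  using assms(3)
proof (induction k)
  case (Suc k)
  show ?case
  proof (cases "j = Suc k")
    case False
    then have "j \<le> k" using Suc.prems by simp
    then show ?thesis using Suc.IH tcell_idt[OF assms(1) ocells_mono[OF assms(2)]] by simp
  qed simp
qed simp

text \<open>Given the support, \<open>enum\<close> undoes the relabelling by \<open>rank\<close>.
  Equality of supports is essential: if \<open>z\<close> repeats an arrow, the corresponding edges
  of the oriental have the same image.\<close>

lemma tcell_inj: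
  assumes \<alpha>: "\<alpha> \<in> ocells (plen z) k" and \<beta>: "\<beta> \<in> ocells (plen z) k" and k: "k \<ge> 1"
    and s: "supp \<alpha> = supp \<beta>" and eq: "tcell z k \<alpha> = tcell z k \<beta>"
  shows "\<alpha> = \<beta>"
proof (cases "k = 1")
  case True
  then show ?thesis using ocells_1_eqI[of \<alpha> _ \<beta>] \<alpha> \<beta> s by simp
next
  case False
  have unrank: "omap (enum (supp \<gamma>)) (omap (rank (supp \<gamma>)) \<gamma>) = \<gamma>" if "\<gamma> \<in> ocells (plen z) k" for \<gamma>
    unfolding omap_omap using enum_rank[OF finite_supp[OF that]] by (intro omap_ident[OF that])
  have "omap (rank (supp \<alpha>)) \<alpha> = omap (rank (supp \<beta>)) \<beta>"
    using eq False k by (simp add: tcell_def)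
  then show ?thesis using unrank[OF \<alpha>] unrank[OF \<beta>] s by metis
qed

section \<open>Lifting cells and composable configurations to orientals\<close>

lemma tcell_0:
  assumes "\<alpha> \<in> ocells n 0" "\<alpha> 0 False = frag_of [v]"
  shows "tcell z 0 \<alpha> = TObj (pob A z v)"
  using ends_supp(1)[OF assms(1)] assms fst_prestr[of "supp \<alpha>" z] by (simp add: tcell_def frag_of_eq)

text \<open>The 1-target of \<alpha> is maximal, so all vertices of \<open>y\<close> occur and the
  relabelling changes nothing; the 1-source \<open>[\<phi>]\<close> has the image of \<phi> as
  vertices, from which \<open>x\<close> and \<phi> are recovered. Thus a cell is its own lift over
  its 1-target.\<close>

lemma tcell_THi:
  assumes "THi x y \<phi> \<alpha> \<in> tilde_cells A k"
  shows "k \<ge> 2" "y \<in> paths A" "\<alpha> \<in> ocells (plen y) k" "supp \<alpha> = {..plen y}"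
    "tcell y k \<alpha> = THi x y \<phi> \<alpha>"
proof -
  obtain j where j: "k = j + 2"
    using assms by (cases "(A, k)" rule: tilde_cells.cases) auto
  then have k: "k = Suc (Suc j)" by simp
  have *: "x \<in> paths A" "y \<in> paths A" "fst x = fst y" "\<phi> \<in> refinements A x y"
    "\<alpha> \<in> icells (hom_icat (oriental (plen y)) (obr (plen x) \<phi>) (obr (plen y) id)) j"
    using assms unfolding k by auto
  show k2: "k \<ge> 2" by (simp add: j)
  then have k1: "k \<ge> 1" by simp
  show y: "y \<in> paths A" by fact
  let ?n = "plen y" and ?m = "plen x"
  have \<phi>: "\<phi> \<in> {..?m} \<rightarrow>\<^sub>E {..?n}" "strict_mono_on {..?m} \<phi>" "\<phi> 0 = 0"
    "\<And>i. i \<in> {1..?m} \<Longrightarrow> arr_composite A (map ((!) (snd y)) [\<phi> (i - 1)..<\<phi> i]) = snd x ! (i - 1)"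
    using *(4) unfolding refinements_def by auto
  show \<alpha>: "\<alpha> \<in> ocells ?n k"
    and st: "supp \<alpha> = {..plen y}"
  proof -
    show "\<alpha> \<in> ocells ?n k" using *(5) unfolding hom_cells j[symmetric] by simp
    then show "supp \<alpha> = {..plen y}"
      using *(5) supp_target[OF _ k1, of \<alpha> ?n] unfolding hom_cells j[symmetric] by simp
  qed
  have ss: "ssupp \<alpha> = \<phi> ` {..?m}"
    using *(5) supp_target_source(2)[OF \<alpha> k1] unfolding hom_cells j[symmetric] by simp
  note c = card_image_strict_mono[OF \<phi>(2)] and e = enum_image[OF \<phi>(2)]
  have le: "\<phi> i \<le> ?n" if "i \<le> ?m" for i using \<phi>(1) that by auto
  have "prestr y (ssupp \<alpha>) = x"
  proof (rule path_eqI)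
    show "fst (prestr y (ssupp \<alpha>)) = fst x" using e[of 0] \<phi>(3) *(3) by (simp add: prestr_def ss)
    show "plen (prestr y (ssupp \<alpha>)) = plen x" by (simp add: ss c)
    fix i assume i: "i < plen x"
    have "\<phi> i < \<phi> (Suc i)" using i by (intro strict_mono_onD[OF \<phi>(2)]) auto
    then have "snd x ! i = par A y (\<phi> i) (\<phi> (Suc i))" using \<phi>(4)[of "Suc i"] i by (simp add: par_def)
    moreover have "snd (prestr y (ssupp \<alpha>)) ! i = par A y (\<phi> i) (\<phi> (Suc i))"
      using i e[of i] e[of "Suc i"] by (simp add: prestr_def steps_def ss c)
    ultimately show "par A (prestr y (ssupp \<alpha>)) i (Suc i) = par A x i (Suc i)"
      using i by (simp add: par_Suc ss c)
  qed
  moreover have "refinement \<alpha> = \<phi>"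
  proof
    fix i show "refinement \<alpha> i = \<phi> i"
    proof (cases "i \<le> ?m")
      case True
      then show ?thesis using e[OF True] rank_atMost[OF le[OF True]] by (simp add: refinement_def ss st c)
    next
      case False
      then show ?thesis using \<phi>(1) by (auto simp: refinement_def ss c PiE_def extensional_def)
    qed
  qed
  moreover have "omap (rank (supp \<alpha>)) \<alpha> = \<alpha>"
    using rank_atMost by (intro omap_ident[OF \<alpha>]) (simp add: st)
  ultimately show "tcell y k \<alpha> = THi x y \<phi> \<alpha>"
    using k2 by (simp add: tcell_def st prestr_all)
qed

text \<open>The two conditions on the ends say that the lift spans all of \<open>z\<close>; they are
  what allows two lifts to be glued on a concatenated path.\<close>

lemma tcell_lift:
  assumes "X \<in> tilde_cells A k"
  obtains z \<alpha> where "z \<in> paths A" "\<alpha> \<in> ocells (plen z) k" "X = tcell z k \<alpha>"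
    "\<alpha> 0 False = frag_of [0]" "\<alpha> 0 True = frag_of [plen z]"
proof (cases X)
  case (TObj a)
  then have k: "k = 0" and a: "a \<in> obj A"
    using assms by (cases "(A, k)" rule: tilde_cells.cases; auto)+
  let ?\<alpha> = "obr 0 (\<lambda>_. 0)"
  have "?\<alpha> \<in> ocells 0 1" by (rule obr_cells) (auto simp: strict_mono_on_def)
  then have \<alpha>: "?\<alpha> \<in> ocells 0 0" by (auto simp: ocells_def obr_edges edges_simps le_Suc_eq)
  show thesis
    using that[of "(a, [])" ?\<alpha>] a k \<alpha> tcell_0[OF \<alpha>, of 0 "(a, [])"] TObj
    by (simp add: paths_def obr_edges)
next
  case (TOne y)
  then have k: "k = 1" and y: "y \<in> paths A"
    using assms by (cases "(A, k)" rule: tilde_cells.cases; auto)+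
  have "obr (plen y) id \<in> ocells (plen y) 1" by (rule obr_cells) (auto simp: strict_mono_on_def)
  then show thesis using that[of y "obr (plen y) id"] y k TOne
    by (simp add: tcell_def prestr_all obr_edges)
next
  case (THi x y \<phi> \<alpha>)
  note t = tcell_THi[OF assms[unfolded THi]]
  have "\<alpha> 0 False = frag_of [0]" "\<alpha> 0 True = frag_of [plen y]"
    using ends_supp(1,3)[OF t(3)] t(1) Min_eqI[of "{..plen y}" 0] Max_eqI[of "{..plen y}" "plen y"]
    unfolding t(4) by auto
  then show thesis using that[OF t(2,3)] t(5) THi by simp
qed

text \<open>The lift of the left factor is kept. \<open>X\<close> lifts over its own 1-target
  \<open>y\<close>, and the boundary equation identifies \<open>y\<close> with the restriction of
  \<open>z\<close> to the vertices \<open>V\<close> of the \<open>j\<close>-source of \<beta>; hence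
  \<open>X\<close> also lifts over \<open>z\<close>, along \<open>enum V\<close>.\<close>

lemma tcell_lift_left:
  assumes z: "z \<in> paths A" and \<beta>: "\<beta> \<in> ocells (plen z) k" and j: "1 \<le> j"
    and c: "composable (tilde A) j k (tcell z k \<beta>) X"
  obtains \<alpha> where "composable (oriental (plen z)) j k \<beta> \<alpha>" "X = tcell z k \<alpha>"
proof -
  have jk: "j < k" and X: "X \<in> tilde_cells A k"
    and eq: "sto (tilde A) j k (tcell z k \<beta>) = tto (tilde A) j k X"
    using c by (auto simp: composable_def)
  obtain i where i: "k = Suc (Suc i)" 
    using j jk that[of "k - 2"] by simp
  obtain x y \<phi> a where Xe: "X = THi x y \<phi> a" using X unfolding i by auto
  note t = tcell_THi[OF X[unfolded Xe]]
  let ?n = "plen z"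
  define V where "V = supp (sto (oriental ?n) j k \<beta>)"
  have sc: "sto (oriental ?n) j k \<beta> \<in> ocells ?n j" using sto_ocells[OF \<beta>] jk by simp
  have tc: "tto (oriental (plen y)) j k a \<in> ocells (plen y) j" using tto_ocells[OF t(3)] jk by simp
  have V: "V \<subseteq> {..?n}" "V \<noteq> {}" unfolding V_def using supp_subset[OF sc] supp_nonempty[OF sc] by auto
  have eq': "tcell z j (sto (oriental ?n) j k \<beta>) = tcell y j (tto (oriental (plen y)) j k a)"
    using eq tcell_sto[OF z \<beta>, of j] tcell_tto[OF t(2,3), of j] jk unfolding Xe t(5) by simp
  have "supp (tto (oriental (plen y)) j k a) = {..plen y}"
    using supp_sto_tto(1)[OF t(3) j] jk t(4) by simp
  \<comment> \<open>The path is read off the equation in dimension \<open>j\<close>: it is the whole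
    cell for \<open>j = 1\<close>, and the 1-target component for \<open>j \<ge> 2\<close>.\<close>
  then have y: "prestr z V = y"
    using eq' j by (cases "j = 1") (auto simp: tcell_def V_def prestr_all)
  have cV: "card V - 1 = plen y" using y by (metis plen_prestr)
  then have cV': "card V = Suc (plen y)" 
    using V(2) card_gt_0_iff[of V] finite_subset[OF V(1) finite_atMost] by linarith
  note e = enum_strict_mono[OF finite_subset[OF V(1) finite_atMost] cV']
  define \<alpha> where "\<alpha> = omap (enum V) a"
  have m: "mono_on {..plen y} (enum V)" "enum V ` {..plen y} \<subseteq> {..?n}"
    using strict_mono_on_imp_mono_on[OF e(1)] e(2) V(1) by auto
  have \<alpha>: "\<alpha> \<in> ocells ?n k" unfolding \<alpha>_def by (rule omap_ocells[OF m t(3)])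
  have ta: "tcell z k \<alpha> = X"
    using tcell_prestr[OF z V, of a k] t(3,5) unfolding cV y \<alpha>_def Xe by simp
  have "supp \<alpha> = V" unfolding \<alpha>_def supp_omap(1)[OF m t(3)] t(4) e(2) ..
  then have sup: "supp (tto (oriental ?n) j k \<alpha>) = V" using supp_sto_tto(1)[OF \<alpha> j] jk by simp
  \<comment> \<open>So far these agree only after applying \<open>tcell z\<close>; both have support
    \<open>V\<close>, so \<open>tcell_inj\<close> applies.\<close>
  have "sto (oriental ?n) j k \<beta> = tto (oriental ?n) j k \<alpha>"
  proof (rule tcell_inj[OF sc _ j])
    show "tto (oriental ?n) j k \<alpha> \<in> ocells ?n j" using tto_ocells[OF \<alpha>] jk by simp
    show "supp (sto (oriental ?n) j k \<beta>) = supp (tto (oriental ?n) j k \<alpha>)" by (simp add: sup V_def)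
    show "tcell z j (sto (oriental ?n) j k \<beta>) = tcell z j (tto (oriental ?n) j k \<alpha>)"
      using eq tcell_sto[OF z \<beta>, of j] tcell_tto[OF z \<alpha>, of j] jk ta by simp
  qed
  then have "composable (oriental ?n) j k \<beta> \<alpha>" using jk \<alpha> \<beta> by (simp add: composable_def)
  then show thesis using that ta by simp
qed

lemma pconcat_simplex:
  assumes z1: "z1 \<in> paths A" and z2: "z2 \<in> paths A" and e: "path_end A z1 = fst z2"
  shows "pconcat z1 z2 \<in> paths A" "plen (pconcat z1 z2) = plen z1 + plen z2"
    "i \<le> plen z1 \<Longrightarrow> pob A (pconcat z1 z2) i = pob A z1 i"
    "i \<le> j \<Longrightarrow> j \<le> plen z1 \<Longrightarrow> par A (pconcat z1 z2) i j = par A z1 i j"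
    "pob A (pconcat z1 z2) (plen z1 + i) = pob A z2 i"
    "i \<le> j \<Longrightarrow> j \<le> plen z2 \<Longrightarrow> par A (pconcat z1 z2) (plen z1 + i) (plen z1 + j) = par A z2 i j"
proof -
  obtain a fs b gs where z: "z1 = (a, fs)" "z2 = (b, gs)" by (cases z1, cases z2)
  have b: "path_end A (a, fs) = b" using e z by simp
  show "pconcat z1 z2 \<in> paths A"
    using z1 z2 b unfolding z by (simp add: paths_def pconcat_def is_path_append del: path_end.simps)
  show "plen (pconcat z1 z2) = plen z1 + plen z2" by (simp add: pconcat_def)
  have p1: "pob A (pconcat z1 z2) i = pob A z1 i" if "i \<le> plen z1" for i
    using that by (simp add: pob_def pconcat_def z del: path_end.simps)
  then show "i \<le> plen z1 \<Longrightarrow> pob A (pconcat z1 z2) i = pob A z1 i" .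
  have p2: "pob A (pconcat z1 z2) (plen z1 + i) = pob A z2 i" for i
    by (simp add: pob_def pconcat_def z path_end_append b del: path_end.simps)
  then show "pob A (pconcat z1 z2) (plen z1 + i) = pob A z2 i" .
  show "par A (pconcat z1 z2) i j = par A z1 i j" if "i \<le> j" "j \<le> plen z1"
  proof -
    have "map ((!) (fs @ gs)) [i..<j] = map ((!) fs) [i..<j]"
      using that by (intro map_cong) (auto simp: nth_append z)
    then show ?thesis using p1[of i] that by (auto simp: par_def pconcat_def z simp del: map_eq_conv)
  qed
  show "par A (pconcat z1 z2) (plen z1 + i) (plen z1 + j) = par A z2 i j" if "i \<le> j" "j \<le> plen z2"
  proof -
    have "map ((!) (fs @ gs)) [length fs + i..<length fs + j] = map ((!) gs) [i..<j]"
      by (rule nth_equalityI) (auto simp: nth_append)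
    then show ?thesis using p2[of i] by (simp add: par_def pconcat_def z del: map_eq_conv)
  qed
qed

text \<open>Either path is a face of the concatenation, included by the identity or by a shift, so
  these are instances of \<open>tcell_omap_cong\<close>.\<close>

lemma tcell_pconcat:
  assumes z1: "z1 \<in> paths A" and z2: "z2 \<in> paths A" and e: "path_end A z1 = fst z2"
  shows "\<alpha> \<in> ocells (plen z1) k \<Longrightarrow> \<alpha> \<in> ocells (plen (pconcat z1 z2)) k"
    "\<alpha> \<in> ocells (plen z1) k \<Longrightarrow> tcell (pconcat z1 z2) k \<alpha> = tcell z1 k \<alpha>"
    "\<beta> \<in> ocells (plen z2) k \<Longrightarrow> tcell (pconcat z1 z2) k (omap ((+) (plen z1)) \<beta>) = tcell z2 k \<beta>"
proof -
  note p = pconcat_simplex[OF assms]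
  have m: "mono_on {..plen z1} (\<lambda>i. i)" "(\<lambda>i. i) ` {..plen z1} \<subseteq> {..plen (pconcat z1 z2)}"
    and m2: "mono_on {..plen z2} ((+) (plen z1))" "(+) (plen z1) ` {..plen z2} \<subseteq> {..plen (pconcat z1 z2)}"
    and m3: "mono_on {..plen z2} (\<lambda>i. i)" "(\<lambda>i. i) ` {..plen z2} \<subseteq> {..plen z2}"
    and m4: "(\<lambda>i. i) ` {..plen z1} \<subseteq> {..plen z1}"
    by (auto simp: p(2) mono_on_def)
  show "\<alpha> \<in> ocells (plen (pconcat z1 z2)) k" if \<alpha>: "\<alpha> \<in> ocells (plen z1) k"
    using omap_ocells[OF m \<alpha>] omap_ident[OF \<alpha>] by simp
  show "tcell (pconcat z1 z2) k \<alpha> = tcell z1 k \<alpha>" if \<alpha>: "\<alpha> \<in> ocells (plen z1) k"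
    using tcell_omap_cong[OF p(1) m z1 m(1) m4 p(3,4) \<alpha>] omap_ident[OF \<alpha>] by simp
  show "tcell (pconcat z1 z2) k (omap ((+) (plen z1)) \<beta>) = tcell z2 k \<beta>" if \<beta>: "\<beta> \<in> ocells (plen z2) k"
    using tcell_omap_cong[OF p(1) m2 z2 m3 p(5,6) \<beta>] omap_ident[OF \<beta>] by simp
qed

lemma composable_shift:
  assumes "\<alpha> \<in> ocells p k" "\<beta> \<in> ocells q k" "\<alpha> 0 True = frag_of [p]" "\<beta> 0 False = frag_of [0]" "0 < k"
  shows "composable (oriental (p + q)) 0 k (omap ((+) p) \<beta>) \<alpha>"
proof -
  have "mono_on {..q} ((+) p)" "(+) p ` {..q} \<subseteq> {..p + q}"
    "mono_on {..p} (\<lambda>i. i)" "(\<lambda>i. i) ` {..p} \<subseteq> {..p + q}" by (auto simp: mono_on_def)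
  then have "omap ((+) p) \<beta> \<in> ocells (p + q) k" "\<alpha> \<in> ocells (p + q) k"
    using omap_ocells[of q "(+) p" "p + q" \<beta> k] omap_ocells[of p "\<lambda>i. i" "p + q" \<alpha> k] assms(1,2)
      omap_ident[OF assms(1)] by simp_all
  moreover have "omap ((+) p) \<beta> 0 False = frag_of [p]" using assms(4) by (simp add: omap_push push_def)
  ultimately show ?thesis using assms(3,5) by (simp add: oriental_composable)
qed

lemma composable_0_ends:
  assumes z1: "z1 \<in> paths A" and z2: "z2 \<in> paths A"
    and \<alpha>: "\<alpha> \<in> ocells (plen z1) k" "\<alpha> 0 True = frag_of [plen z1]"
    and \<beta>: "\<beta> \<in> ocells (plen z2) k" "\<beta> 0 False = frag_of [0]"
    and c: "composable (tilde A) 0 k (tcell z2 k \<beta>) (tcell z1 k \<alpha>)"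
  shows "path_end A z1 = fst z2"
proof -
  have s: "sto (oriental (plen z2)) 0 k \<beta> \<in> ocells (plen z2) 0"
    "tto (oriental (plen z1)) 0 k \<alpha> \<in> ocells (plen z1) 0"
    using sto_ocells[OF \<beta>(1)] tto_ocells[OF \<alpha>(1)] by simp_all
  have "tcell z2 0 (sto (oriental (plen z2)) 0 k \<beta>) = TObj (pob A z2 0)"
    by (rule tcell_0[OF s(1)]) (simp add: oriental_sto[OF \<beta>(1)] \<beta>(2))
  moreover have "tcell z1 0 (tto (oriental (plen z1)) 0 k \<alpha>) = TObj (pob A z1 (plen z1))"
    by (rule tcell_0[OF s(2)]) (simp add: oriental_tto[OF \<alpha>(1)] \<alpha>(2))
  ultimately show ?thesis
    using c tcell_sto[OF z2 \<beta>(1), of 0] tcell_tto[OF z1 \<alpha>(1), of 0]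
    by (simp add: composable_def pob_plen del: path_end.simps)
qed

lemma composable_ends:
  assumes "composable (oriental n) j k \<beta> \<alpha>" "1 \<le> j"
  shows "\<alpha> 0 \<epsilon> = \<beta> 0 \<epsilon>"
  using assms by (simp add: oriental_composable)

text \<open>For \<open>j \<ge> 1\<close> the right factor is moved to the path of the left one; for
  \<open>j = 0\<close> the paths are concatenated and the left factor is shifted. The exported ends
  permit further concatenation in the lifts of larger configurations.\<close>

lemma tcell_lift2:
  assumes c: "composable (tilde A) j k Y X"
  obtains z \<beta> \<alpha> where "z \<in> paths A" "composable (oriental (plen z)) j k \<beta> \<alpha>"
    "Y = tcell z k \<beta>" "X = tcell z k \<alpha>" "\<alpha> 0 False = frag_of [0]" "\<beta> 0 True = frag_of [plen z]"
proof -
  have X: "X \<in> tilde_cells A k" and Y: "Y \<in> tilde_cells A k" and jk: "j < k"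
    using c by (auto simp: composable_def)
  obtain z2 \<beta> where z2: "z2 \<in> paths A" and \<beta>: "\<beta> \<in> ocells (plen z2) k" "Y = tcell z2 k \<beta>"
    "\<beta> 0 False = frag_of [0]" "\<beta> 0 True = frag_of [plen z2]" using tcell_lift[OF Y] .
  show thesis
  proof (cases "j = 0")
    case False
    then have j: "1 \<le> j" by simp
    obtain \<alpha> where a: "composable (oriental (plen z2)) j k \<beta> \<alpha>" "X = tcell z2 k \<alpha>"
      using tcell_lift_left[OF z2 \<beta>(1) j c[unfolded \<beta>(2)]] .
    then show thesis using that[OF z2 a(1) \<beta>(2) a(2)] composable_ends[OF a(1) j] \<beta>(3,4) by simp
  next
    case True
    obtain z1 \<alpha> where z1: "z1 \<in> paths A" and \<alpha>: "\<alpha> \<in> ocells (plen z1) k" "X = tcell z1 k \<alpha>"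
      "\<alpha> 0 False = frag_of [0]" "\<alpha> 0 True = frag_of [plen z1]" using tcell_lift[OF X] .
    have e: "path_end A z1 = fst z2"
      using composable_0_ends[OF z1 z2 \<alpha>(1,4) \<beta>(1,3)] c unfolding True \<alpha>(2) \<beta>(2) by blast
    note p = pconcat_simplex[OF z1 z2 e] and t = tcell_pconcat[OF z1 z2 e]
    show thesis
    proof (rule that[OF p(1)])
      show "composable (oriental (plen (pconcat z1 z2))) j k (omap ((+) (plen z1)) \<beta>) \<alpha>"
        unfolding p(2) True using \<alpha> \<beta> jk by (intro composable_shift) auto
      show "omap ((+) (plen z1)) \<beta> 0 True = frag_of [plen (pconcat z1 z2)]"
        by (simp add: omap_push push_def \<beta>(4) p(2))
    qed (use \<alpha> \<beta> t in simp_all)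
  qed
qed

lemma tcell_lift3:
  assumes c: "composable (tilde A) j k Z Y" "composable (tilde A) j k Y X"
  obtains z \<gamma> \<beta> \<alpha> where "z \<in> paths A" "composable (oriental (plen z)) j k \<gamma> \<beta>"
    "composable (oriental (plen z)) j k \<beta> \<alpha>"
    "Z = tcell z k \<gamma>" "Y = tcell z k \<beta>" "X = tcell z k \<alpha>"
proof -
  obtain z2 \<gamma> \<beta> where z2: "z2 \<in> paths A" and gb: "composable (oriental (plen z2)) j k \<gamma> \<beta>"
    "Z = tcell z2 k \<gamma>" "Y = tcell z2 k \<beta>" "\<beta> 0 False = frag_of [0]"
    using tcell_lift2[OF c(1)] by metis
  have \<gamma>: "\<gamma> \<in> ocells (plen z2) k" and \<beta>: "\<beta> \<in> ocells (plen z2) k" and jk: "j < k"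
    using gb(1) by (auto simp: composable_def)
  show thesis
  proof (cases "j = 0")
    case False
    then have "1 \<le> j" by simp
    then show thesis using tcell_lift_left[OF z2 \<beta> _ c(2)[unfolded gb(3)]] that[OF z2 gb(1) _ gb(2,3)] by blast
  next
    case True
    have X: "X \<in> tilde_cells A k" using c(2) by (simp add: composable_def)
    obtain z1 \<alpha> where z1: "z1 \<in> paths A" and \<alpha>: "\<alpha> \<in> ocells (plen z1) k" "X = tcell z1 k \<alpha>"
      "\<alpha> 0 False = frag_of [0]" "\<alpha> 0 True = frag_of [plen z1]" using tcell_lift[OF X] .
    have e: "path_end A z1 = fst z2"
      using composable_0_ends[OF z1 z2 \<alpha>(1,4) \<beta> gb(4)] c(2) unfolding True \<alpha>(2) gb(3) by blast
    note p = pconcat_simplex[OF z1 z2 e] and t = tcell_pconcat[OF z1 z2 e]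
    let ?s = "omap ((+) (plen z1))"
    have m: "mono_on {..plen z2} ((+) (plen z1))" "(+) (plen z1) ` {..plen z2} \<subseteq> {..plen (pconcat z1 z2)}"
      by (auto simp: p(2) mono_on_def)
    show thesis
    proof (rule that[OF p(1)])
      show "composable (oriental (plen (pconcat z1 z2))) j k (?s \<gamma>) (?s \<beta>)"
        by (rule omap_composable[OF m gb(1)])
      show "composable (oriental (plen (pconcat z1 z2))) j k (?s \<beta>) \<alpha>"
        unfolding p(2) True using \<alpha> \<beta> gb jk by (intro composable_shift) auto
    qed (use \<alpha> \<beta> \<gamma> gb t in simp_all)
  qed
qed

text \<open>For \<open>i = 0\<close> the pairs \<open>Y', Y\<close> and \<open>X', X\<close> are
  lifted separately and placed on a concatenated path. For \<open>i \<ge> 1\<close> a common path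
  carries \<open>Y', Y\<close>; then \<open>X'\<close> and \<open>X\<close> are lifted over it one
  by one, and their composability along \<open>j\<close> has to be recovered.\<close>

lemma tcell_lift4:
  assumes ij: "i < j" and c: "composable (tilde A) j k Y' Y" "composable (tilde A) j k X' X"
    "composable (tilde A) i k Y' X'" "composable (tilde A) i k Y X"
  obtains z b' b a' a where "z \<in> paths A" "composable (oriental (plen z)) j k b' b"
    "composable (oriental (plen z)) j k a' a" "composable (oriental (plen z)) i k b' a'"
    "composable (oriental (plen z)) i k b a"
    "Y' = tcell z k b'" "Y = tcell z k b" "X' = tcell z k a'" "X = tcell z k a"
proof -
  obtain z2 b' b where z2: "z2 \<in> paths A" and bb: "composable (oriental (plen z2)) j k b' b"
    "Y' = tcell z2 k b'" "Y = tcell z2 k b" "b 0 False = frag_of [0]"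
    using tcell_lift2[OF c(1)] by metis
  have b': "b' \<in> ocells (plen z2) k" and b: "b \<in> ocells (plen z2) k" and jk: "j < k"
    using bb(1) by (auto simp: composable_def)
  have j1: "1 \<le> j" using ij by simp
  show thesis
  proof (cases "i = 0")
    case False
    then have i1: "1 \<le> i" and j2: "2 \<le> j" "j \<noteq> 1" using ij by auto
    obtain a' where a': "composable (oriental (plen z2)) i k b' a'" "X' = tcell z2 k a'"
      using tcell_lift_left[OF z2 b' i1 c(3)[unfolded bb(2)]] .
    obtain a where a: "composable (oriental (plen z2)) i k b a" "X = tcell z2 k a"
      using tcell_lift_left[OF z2 b i1 c(4)[unfolded bb(3)]] .
    let ?O = "oriental (plen z2)"
    have o: "a' \<in> ocells (plen z2) k" "a \<in> ocells (plen z2) k" using a' a by (auto simp: composable_def)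
    \<comment> \<open>As \<open>j \<ge> 2\<close>, \<open>b'\<close> and \<open>b\<close> have the
      same \<open>supp\<close> and the same \<open>ssupp\<close>, and one of these two sets is the
      support of \<open>a'\<close> and of \<open>a\<close>. This supplies the hypothesis of
      \<open>tcell_inj\<close>.\<close>
    have "supp a = supp a'"
      using supp_icmp_pos(3)[OF a'(1) i1] supp_icmp_pos(3)[OF a(1) i1]
        supp_icmp_pos(3,4)[OF bb(1) j1] j2 by simp
    then have s: "supp (sto ?O j k a') = supp (tto ?O j k a)"
      using supp_sto_tto(2)[OF o(1) j1 _ j2(1)] supp_sto_tto(1)[OF o(2) j1] jk by simp
    have "tcell z2 j (sto ?O j k a') = tcell z2 j (tto ?O j k a)"
      using c(2) tcell_sto[OF z2 o(1), of j] tcell_tto[OF z2 o(2), of j] jk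
      unfolding a'(2) a(2) by (simp add: composable_def)
    then have "sto ?O j k a' = tto ?O j k a"
      using tcell_inj[OF sto_ocells[OF o(1)] tto_ocells[OF o(2)] j1 s] jk by simp
    then have "composable ?O j k a' a" using o jk by (simp add: composable_def)
    then show thesis using that[OF z2 bb(1) _ a'(1) a(1) bb(2,3) a'(2) a(2)] by blast
  next
    case True
    obtain z1 a' a where z1: "z1 \<in> paths A" and aa: "composable (oriental (plen z1)) j k a' a"
      "X' = tcell z1 k a'" "X = tcell z1 k a" "a' 0 True = frag_of [plen z1]"
      using tcell_lift2[OF c(2)] by metis
    have a': "a' \<in> ocells (plen z1) k" and a: "a \<in> ocells (plen z1) k"
      using aa(1) by (auto simp: composable_def)
    have b0: "b' 0 False = frag_of [0]" using composable_ends[OF bb(1) j1] bb(4) by simp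
    have a0: "a 0 True = frag_of [plen z1]" using composable_ends[OF aa(1) j1] aa(4) by simp
    have e: "path_end A z1 = fst z2"
      using composable_0_ends[OF z1 z2 a' aa(4) b' b0] c(3) unfolding True aa(2) bb(2) by blast
    note p = pconcat_simplex[OF z1 z2 e] and t = tcell_pconcat[OF z1 z2 e]
    let ?s = "omap ((+) (plen z1))"
    have m: "mono_on {..plen z2} ((+) (plen z1))" "(+) (plen z1) ` {..plen z2} \<subseteq> {..plen (pconcat z1 z2)}"
      by (auto simp: p(2) mono_on_def)
    have m': "mono_on {..plen z1} (\<lambda>i. i)" "(\<lambda>i. i) ` {..plen z1} \<subseteq> {..plen (pconcat z1 z2)}"
      by (auto simp: p(2) mono_on_def)
    show thesis
    proof (rule that[OF p(1)])
      show "composable (oriental (plen (pconcat z1 z2))) j k (?s b') (?s b)"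
        by (rule omap_composable[OF m bb(1)])
      show "composable (oriental (plen (pconcat z1 z2))) j k a' a"
        using omap_composable[OF m' aa(1)] omap_ident[OF a'] omap_ident[OF a] by simp
      show "composable (oriental (plen (pconcat z1 z2))) i k (?s b') a'"
        "composable (oriental (plen (pconcat z1 z2))) i k (?s b) a"
        unfolding p(2) True using a a' b b' b0 a0 aa(4) bb(4) jk by (auto intro: composable_shift)
    qed (use a a' b b' aa bb t in simp_all)
  qed
qed

section \<open>Transport of the axioms from orientals\<close>

theorem strict_icat_tilde: "strict_icat (tilde A)"
proof -
  note SO = strict_icatD[OF strict_icat_oriental]
  have cmp_cells: "icmp (tilde A) j k Y X \<in> tilde_cells A k" if "composable (tilde A) j k Y X" for j k Y X
  proof -
    from that obtain z \<beta> \<alpha> where "z \<in> paths A" "composable (oriental (plen z)) j k \<beta> \<alpha>"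
      "Y = tcell z k \<beta>" "X = tcell z k \<alpha>" by (rule tcell_lift2)
    then show ?thesis using tcell_cmp tcell_cells ocells_cmp by (metis tilde_simps(5))
  qed
  show ?thesis
    unfolding strict_icat_def tilde_simps(1)
  proof (intro conjI allI ballI impI)
    fix k X assume "X \<in> tilde_cells A (Suc k)"
    then obtain z \<alpha> where z: "z \<in> paths A" and \<alpha>: "\<alpha> \<in> ocells (plen z) (Suc k)" "X = tcell z (Suc k) \<alpha>"
      by (rule tcell_lift)
    show "isrc (tilde A) k X \<in> tilde_cells A k" "itgt (tilde A) k X \<in> tilde_cells A k"
      using tcell_src[OF z \<alpha>(1)] tcell_tgt[OF z \<alpha>(1)] tcell_cells[OF z ocells_src[OF \<alpha>(1)]]
        tcell_cells[OF z ocells_tgt[OF \<alpha>(1)]] \<alpha>(2) by simp_all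
  next
    fix k X assume "X \<in> tilde_cells A k"
    then obtain z \<alpha> where z: "z \<in> paths A" and \<alpha>: "\<alpha> \<in> ocells (plen z) k" "X = tcell z k \<alpha>"
      by (rule tcell_lift)
    note id = tcell_idt[OF z \<alpha>(1)] and \<alpha>' = ocells_idt[OF \<alpha>(1)]
    show "iidt (tilde A) k X \<in> tilde_cells A (Suc k)" using id tcell_cells[OF z \<alpha>'] \<alpha>(2) by simp
    have "isrc (oriental (plen z)) k \<alpha> = \<alpha>" "itgt (oriental (plen z)) k \<alpha> = \<alpha>"
      using SO(7,8)[of \<alpha> "plen z" k] \<alpha>(1) by (simp_all add: oriental_simps)
    then show "isrc (tilde A) k (iidt (tilde A) k X) = X" "itgt (tilde A) k (iidt (tilde A) k X) = X"
      using tcell_src[OF z \<alpha>'] tcell_tgt[OF z \<alpha>'] id \<alpha>(2) by simp_all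
  next
    fix j k Y X assume c: "composable (tilde A) j k Y X"
    then show "icmp (tilde A) j k Y X \<in> tilde_cells A k" by (rule cmp_cells)
    obtain z \<beta> \<alpha> where z: "z \<in> paths A" and ba: "composable (oriental (plen z)) j k \<beta> \<alpha>"
      "Y = tcell z k \<beta>" "X = tcell z k \<alpha>" using tcell_lift2[OF c] by metis
    have o: "\<alpha> \<in> ocells (plen z) k" "\<beta> \<in> ocells (plen z) k" using ba by (auto simp: composable_def)
    \<comment> \<open>Identities leave the families unchanged, so the same pair is composable one
      dimension higher.\<close>
    have ba': "composable (oriental (plen z)) j (Suc k) \<beta> \<alpha>"
      using ba(1) ocells_idt by (simp add: oriental_composable)
    show "iidt (tilde A) k (icmp (tilde A) j k Y X) =
        icmp (tilde A) j (Suc k) (iidt (tilde A) k Y) (iidt (tilde A) k X)"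
      using tcell_cmp[OF z ba(1)] tcell_idt[OF z ocells_cmp[OF ba(1)]] tcell_idt[OF z o(1)]
        tcell_idt[OF z o(2)] tcell_cmp[OF z ba'] ba(2,3) by (simp add: oriental_simps oriental_def)
  next
    fix k X assume "X \<in> tilde_cells A (Suc (Suc k))"
    then obtain z \<alpha> where z: "z \<in> paths A" and \<alpha>: "\<alpha> \<in> ocells (plen z) (Suc (Suc k))"
      "X = tcell z (Suc (Suc k)) \<alpha>" by (rule tcell_lift)
    show "isrc (tilde A) k (isrc (tilde A) (Suc k) X) = isrc (tilde A) k (itgt (tilde A) (Suc k) X)"
      "itgt (tilde A) k (isrc (tilde A) (Suc k) X) = itgt (tilde A) k (itgt (tilde A) (Suc k) X)"
      using tcell_src[OF z \<alpha>(1)] tcell_tgt[OF z \<alpha>(1)] tcell_src[OF z ocells_src[OF \<alpha>(1)]]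
        tcell_src[OF z ocells_tgt[OF \<alpha>(1)]] tcell_tgt[OF z ocells_src[OF \<alpha>(1)]]
        tcell_tgt[OF z ocells_tgt[OF \<alpha>(1)]] SO(5,6)[of \<alpha> "plen z" k] \<alpha> by simp_all
  next
    fix k Y X assume c: "composable (tilde A) k (Suc k) Y X"
    obtain z \<beta> \<alpha> where z: "z \<in> paths A" and ba: "composable (oriental (plen z)) k (Suc k) \<beta> \<alpha>"
      "Y = tcell z (Suc k) \<beta>" "X = tcell z (Suc k) \<alpha>" using tcell_lift2[OF c] by metis
    have o: "\<alpha> \<in> ocells (plen z) (Suc k)" "\<beta> \<in> ocells (plen z) (Suc k)" using ba by (auto simp: composable_def)
    show "isrc (tilde A) k (icmp (tilde A) k (Suc k) Y X) = isrc (tilde A) k X"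
      "itgt (tilde A) k (icmp (tilde A) k (Suc k) Y X) = itgt (tilde A) k Y"
      using tcell_cmp[OF z ba(1)] tcell_src[OF z ocells_cmp[OF ba(1)]] tcell_tgt[OF z ocells_cmp[OF ba(1)]]
        tcell_src[OF z o(1)] tcell_tgt[OF z o(2)] SO(9,10)[OF ba(1)] ba(2,3) by simp_all
  next
    fix j k Y X assume "j < k \<and> composable (tilde A) j (Suc k) Y X"
    then have jk: "j < k" and c: "composable (tilde A) j (Suc k) Y X" by blast+
    obtain z \<beta> \<alpha> where z: "z \<in> paths A" and ba: "composable (oriental (plen z)) j (Suc k) \<beta> \<alpha>"
      "Y = tcell z (Suc k) \<beta>" "X = tcell z (Suc k) \<alpha>" using tcell_lift2[OF c] by metis
    have o: "\<alpha> \<in> ocells (plen z) (Suc k)" "\<beta> \<in> ocells (plen z) (Suc k)" using ba by (auto simp: composable_def)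
    note cs = composable_src_tgt[OF strict_icat_oriental jk ba(1)]
    show "isrc (tilde A) k (icmp (tilde A) j (Suc k) Y X) =
        icmp (tilde A) j k (isrc (tilde A) k Y) (isrc (tilde A) k X)"
      using tcell_cmp[OF z ba(1)] tcell_src[OF z ocells_cmp[OF ba(1)]] tcell_src[OF z o(1)]
        tcell_src[OF z o(2)] SO(11)[OF jk ba(1)] tcell_cmp[OF z cs(1)] ba(2,3) by simp
    show "itgt (tilde A) k (icmp (tilde A) j (Suc k) Y X) =
        icmp (tilde A) j k (itgt (tilde A) k Y) (itgt (tilde A) k X)"
      using tcell_cmp[OF z ba(1)] tcell_tgt[OF z ocells_cmp[OF ba(1)]] tcell_tgt[OF z o(1)]
        tcell_tgt[OF z o(2)] SO(12)[OF jk ba(1)] tcell_cmp[OF z cs(2)] ba(2,3) by simp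
  next
    fix j k Z Y X assume "composable (tilde A) j k Z Y \<and> composable (tilde A) j k Y X"
    then have c: "composable (tilde A) j k Z Y" "composable (tilde A) j k Y X" by blast+
    obtain z \<gamma> \<beta> \<alpha> where z: "z \<in> paths A" and cc: "composable (oriental (plen z)) j k \<gamma> \<beta>"
      "composable (oriental (plen z)) j k \<beta> \<alpha>"
      and e: "Z = tcell z k \<gamma>" "Y = tcell z k \<beta>" "X = tcell z k \<alpha>" using tcell_lift3[OF c] .
    let ?O = "oriental (plen z)"
    have c1: "composable ?O j k (icmp ?O j k \<gamma> \<beta>) \<alpha>" "composable ?O j k \<gamma> (icmp ?O j k \<beta> \<alpha>)"
      using cc sto_icmp[OF strict_icat_oriental cc(1)] tto_icmp[OF strict_icat_oriental cc(2)]
        ocells_cmp[OF cc(1)] ocells_cmp[OF cc(2)] by (simp_all add: composable_def)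
    show "icmp (tilde A) j k (icmp (tilde A) j k Z Y) X = icmp (tilde A) j k Z (icmp (tilde A) j k Y X)"
      using tcell_cmp[OF z cc(1)] tcell_cmp[OF z cc(2)] tcell_cmp[OF z c1(1)] tcell_cmp[OF z c1(2)]
        SO(13)[OF cc] e by simp
  next
    fix j k X assume jk: "j < k" and X: "X \<in> tilde_cells A k"
    obtain z \<alpha> where z: "z \<in> paths A" and \<alpha>: "\<alpha> \<in> ocells (plen z) k" "X = tcell z k \<alpha>"
      using tcell_lift[OF X] by metis
    let ?O = "oriental (plen z)"
    have jk': "j \<le> k" using jk by simp
    note s = sto_ocells[OF \<alpha>(1) jk'] and t = tto_ocells[OF \<alpha>(1) jk']
    note s' = ocells_mono[OF s jk'] and t' = ocells_mono[OF t jk']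
    have c: "composable ?O j k \<alpha> (sto ?O j k \<alpha>)" "composable ?O j k (tto ?O j k \<alpha>) \<alpha>"
      using jk \<alpha>(1) s' t' by (simp_all add: oriental_composable)
        (simp_all add: oriental_sto[OF \<alpha>(1) jk'] oriental_tto[OF \<alpha>(1) jk'])
    have u: "icmp ?O j k \<alpha> (sto ?O j k \<alpha>) = \<alpha>" "icmp ?O j k (tto ?O j k \<alpha>) \<alpha> = \<alpha>"
      using SO(14,15)[OF jk, of \<alpha> "plen z"] \<alpha>(1) by (simp_all add: oriental_ito)
    show "icmp (tilde A) j k X (ito (tilde A) j k (sto (tilde A) j k X)) = X"
      "icmp (tilde A) j k (ito (tilde A) j k (tto (tilde A) j k X)) X = X"
      using tcell_cmp[OF z c(1)] tcell_cmp[OF z c(2)] u tcell_ito[OF z s jk'] tcell_ito[OF z t jk']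
        tcell_sto[OF z \<alpha>(1) jk'] tcell_tto[OF z \<alpha>(1) jk'] \<alpha>(2) by simp_all
  next
    fix i j k Y' Y X' X
    assume "i < j \<and> composable (tilde A) j k Y' Y \<and> composable (tilde A) j k X' X \<and>
      composable (tilde A) i k Y' X' \<and> composable (tilde A) i k Y X"
    then have ij: "i < j" and c: "composable (tilde A) j k Y' Y" "composable (tilde A) j k X' X"
      "composable (tilde A) i k Y' X'" "composable (tilde A) i k Y X" by blast+
    obtain z b' b a' a where z: "z \<in> paths A" and cc: "composable (oriental (plen z)) j k b' b"
      "composable (oriental (plen z)) j k a' a" "composable (oriental (plen z)) i k b' a'"
      "composable (oriental (plen z)) i k b a"
      and e: "Y' = tcell z k b'" "Y = tcell z k b" "X' = tcell z k a'" "X = tcell z k a"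
      using tcell_lift4[OF ij c] .
    let ?O = "oriental (plen z)"
    have c1: "composable ?O i k (icmp ?O j k b' b) (icmp ?O j k a' a)"
      by (rule interchange_composable[OF strict_icat_oriental ij cc])
    have c2: "composable ?O j k (icmp ?O i k b' a') (icmp ?O i k b a)"
      unfolding oriental_composable
      using cc ij ocells_cmp[OF cc(3)] ocells_cmp[OF cc(4)]
      by (auto simp: oriental_composable) (auto simp: oriental_simps)
    show "icmp (tilde A) i k (icmp (tilde A) j k Y' Y) (icmp (tilde A) j k X' X) =
       icmp (tilde A) j k (icmp (tilde A) i k Y' X') (icmp (tilde A) i k Y X)"
      using tcell_cmp[OF z cc(1)] tcell_cmp[OF z cc(2)] tcell_cmp[OF z cc(3)] tcell_cmp[OF z cc(4)]
        tcell_cmp[OF z c1] tcell_cmp[OF z c2] SO(17)[OF ij cc] e by simp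
  qed
qed

end

section \<open>Simplices of the nerve\<close>

lemma ocells_ends:
  assumes "\<alpha> \<in> ocells n k"
  obtains u v where "u \<le> v" "v \<le> n" "\<alpha> 0 False = frag_of [u]" "\<alpha> 0 True = frag_of [v]"
proof (cases "k = 0")
  case True
  obtain v where "v \<le> n" "\<alpha> 0 False = frag_of [v]" using ocells_vertex[OF assms] .
  then show thesis using that[of v v] ocells_top[OF assms] True by simp
next
  case False
  then have "k \<ge> 1" by simp
  then show thesis
    using that[of "Min (supp \<alpha>)" "Max (supp \<alpha>)"] ends_supp(1,3)[OF assms] supp_subset[OF assms]
      finite_supp[OF assms] supp_nonempty[OF assms] False by (auto simp: subset_iff)
qed

lemma ocells_0_obr:
  assumes "\<alpha> \<in> ocells n 0" "\<alpha> 0 False = frag_of [u]"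
  shows "\<alpha> = obr 0 (\<lambda>_. u)"
proof (intro ext)
  fix p \<epsilon>
  show "\<alpha> p \<epsilon> = obr 0 (\<lambda>_. u) p \<epsilon>"
    using assms(2) ocells_top[OF assms(1)] ocells_above[OF assms(1), of p \<epsilon>]
    by (cases "p = 0"; cases \<epsilon>) (simp_all add: obr_edges edges_simps)
qed

lemma obr_0_cells: "u \<le> n \<Longrightarrow> obr 0 (\<lambda>_. u) \<in> ocells n 0"
proof -
  assume u: "u \<le> n"
  then have "obr 0 (\<lambda>_. u) \<in> ocells n 1" by (intro obr_cells) (auto simp: strict_mono_on_def)
  then show ?thesis by (auto simp: ocells_def obr_edges edges_simps le_Suc_eq)
qed

text \<open>Recovers the vertex from a chain \<open>frag_of [v]\<close>; by
  \<open>ocells_vertex\<close> the degree-zero entries of a cell have this form.\<close>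

definition vtx :: "chain \<Rightarrow> nat" where
  "vtx c = hd (the_elem (Poly_Mapping.keys c))"

lemma vtx_frag_of [simp]: "vtx (frag_of [v]) = v"
  by (simp add: vtx_def keys_frag_of)

text \<open>The functor from the oriental given by a simplex of \<open>A\<close>. As cells of
  \<open>A\<close> above dimension one are identities, the value on a cell of positive dimension
  depends on its two end vertices only.\<close>

definition nsimp :: "nat \<Rightarrow> (nat \<Rightarrow> 'o) \<Rightarrow> (nat \<Rightarrow> nat \<Rightarrow> 'a) \<Rightarrow> nat \<Rightarrow> ocell \<Rightarrow> 'o + 'a" where
  "nsimp n ob r = (\<lambda>k. \<lambda>\<alpha>\<in>ocells n k.
    if k = 0 then Inl (ob (vtx (\<alpha> 0 False))) else Inr (r (vtx (\<alpha> 0 False)) (vtx (\<alpha> 0 True))))"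

lemma nsimp_apply:
  assumes "\<alpha> \<in> ocells n k" "\<alpha> 0 False = frag_of [u]" "\<alpha> 0 True = frag_of [v]"
  shows "nsimp n ob r k \<alpha> = (if k = 0 then Inl (ob u) else Inr (r u v))"
  using assms by (simp add: nsimp_def)

lemma nsimp_cong:
  assumes "\<And>i. i \<le> n \<Longrightarrow> ob i = ob' i" "\<And>i j. i \<le> j \<Longrightarrow> j \<le> n \<Longrightarrow> r i j = r' i j"
  shows "nsimp n ob r = nsimp n ob' r'"
proof (intro ext)
  fix k \<alpha>
  show "nsimp n ob r k \<alpha> = nsimp n ob' r' k \<alpha>"
  proof (cases "\<alpha> \<in> ocells n k")
    case True
    obtain u v where uv: "u \<le> v" "v \<le> n" "\<alpha> 0 False = frag_of [u]" "\<alpha> 0 True = frag_of [v]"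
      using ocells_ends[OF True] .
    then show ?thesis
      using assms(1)[of u] assms(2)[of u v] nsimp_apply[where ob = ob and r = r, OF True uv(3,4)]
        nsimp_apply[where ob = ob' and r = r', OF True uv(3,4)] by simp
  qed (simp add: nsimp_def)
qed

text \<open>For \<open>i = j\<close> the path must have length zero, as the repeated pair
  \<open>[i, i]\<close> is not a basis element; the result is then the identity of the
  vertex.\<close>

definition edge :: "nat \<Rightarrow> nat \<Rightarrow> ocell" where
  "edge i j = obr (if i < j then 1 else 0) (\<lambda>l. if l = 0 then i else j)"

lemma edge_cells: "i \<le> j \<Longrightarrow> j \<le> n \<Longrightarrow> edge i j \<in> ocells n 1"
  unfolding edge_def by (intro obr_cells) (auto simp: strict_mono_on_def)

lemma edge_ends: "i \<le> j \<Longrightarrow> edge i j 0 False = frag_of [i]" "i \<le> j \<Longrightarrow> edge i j 0 True = frag_of [j]"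
  by (auto simp: edge_def obr_edges)

lemma edge_refl: "edge i i = obr 0 (\<lambda>_. i)"
  unfolding edge_def by (intro ext) (simp add: obr_edges edges_simps)

lemma nsimp_data_eq:
  assumes "nsimp n ob r = nsimp n ob' r'"
  shows "i \<le> n \<Longrightarrow> ob i = ob' i" "i \<le> j \<Longrightarrow> j \<le> n \<Longrightarrow> r i j = r' i j"
proof -
  assume i: "i \<le> n"
  show "ob i = ob' i"
    using fun_cong[OF fun_cong[OF assms, of 0], of "obr 0 (\<lambda>_. i)"] 
      nsimp_apply[where ob = ob and r = r, OF obr_0_cells[OF i], of i i]
      nsimp_apply[where ob = ob' and r = r', OF obr_0_cells[OF i], of i i]
    by (simp add: obr_edges)
next
  assume "i \<le> j" "j \<le> n"
  then show "r i j = r' i j"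
    using fun_cong[OF fun_cong[OF assms, of 1], of "edge i j"] 
      nsimp_apply[where ob = ob and r = r, OF edge_cells, of i j n i j]
      nsimp_apply[where ob = ob' and r = r', OF edge_cells, of i j n i j]
    by (simp add: edge_ends)
qed

text \<open>The basic 2-cell, from the long edge to the composite of the short ones. Its image in
  \<open>A\<close> is an identity, which yields the composition law of a simplex.\<close>

definition triangle :: "nat \<Rightarrow> nat \<Rightarrow> nat \<Rightarrow> ocell" where
  "triangle i j l = (\<lambda>p \<epsilon>. if p = 0 then frag_of [if \<epsilon> then l else i]
    else if p = 1 then (if \<epsilon> then frag_of [j, l] + frag_of [i, j] else frag_of [i, l])
    else if p = 2 then frag_of [i, j, l] else 0)"

lemma triangle_cells:
  assumes "i < j" "j < l" "l \<le> n"
  shows "triangle i j l \<in> ocells n 2"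
proof -
  have t: "[i] \<in> tuples n 0" "[l] \<in> tuples n 0" "[i, j] \<in> tuples n 1" "[j, l] \<in> tuples n 1"
    "[i, l] \<in> tuples n 1" "[i, j, l] \<in> tuples n 2" using assms by (auto simp: tuples_def)
  have "triangle i j l p \<epsilon> \<in> pos_chains n p" for p \<epsilon>
    using t frag_of_pos_chains pos_chains_add by (simp add: triangle_def)
  moreover have "bdry (triangle i j l p \<epsilon>) = triangle i j l (p - 1) True - triangle i j l (p - 1) False"
    if "p \<le> 2" "0 < p" for p \<epsilon>
  proof -
    have "bdry (frag_of [i, j, l]) = frag_of [j, l] - frag_of [i, l] + frag_of [i, j]"
      by (simp add: bdry_def lessThan_Suc)
    moreover have "p = 1 \<or> p = 2" using that by auto
    ultimately show ?thesis by (auto simp: triangle_def bdry_add bdry_edge)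
  qed
  moreover have "augm (triangle i j l 0 \<epsilon>) = 1" for \<epsilon>
    by (simp add: triangle_def augm_def keys_frag_of)
  moreover have "triangle i j l p \<epsilon> = 0" if "p > 2" for p \<epsilon> using that by (simp add: triangle_def)
  moreover have "triangle i j l 2 False = triangle i j l 2 True" by (simp add: triangle_def)
  ultimately show ?thesis unfolding ocells_def mem_Collect_eq by blast
qed

lemma triangle_ends:
  assumes "i < j" "j < l"
  shows "isrc (oriental n) 1 (triangle i j l) = edge i l"
    "itgt (oriental n) 1 (triangle i j l) = icmp (oriental n) 0 1 (edge j l) (edge i j)"
  using assms by (intro ext; simp add: oriental_simps triangle_def edge_def obr_edges edges_simps)+

lemma obr_Suc:
  assumes "strict_mono_on {..Suc m} \<phi>"
  shows "obr (Suc m) \<phi> = icmp (oriental n) 0 1 (edge (\<phi> m) (\<phi> (Suc m))) (obr m \<phi>)"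
proof -
  have "\<phi> m < \<phi> (Suc m)" by (rule strict_mono_onD[OF assms]) auto
  then show ?thesis
    by (intro ext) (simp add: oriental_simps edge_def obr_edges edges_simps)
qed

lemma omap_vertex: "\<alpha> 0 \<epsilon> = frag_of [u] \<Longrightarrow> omap \<phi> \<alpha> 0 \<epsilon> = frag_of [\<phi> u]"
  by (simp add: omap_push push_def)

section \<open>Functors from orientals to \<open>A\<close> as simplices of \<open>A\<close>\<close>

lemma icat_of_cat_simps:
  "icells (icat_of_cat A) k = (if k = 0 then Inl ` obj A else Inr ` arr A)"
  "isrc (icat_of_cat A) k x = (if k = 0 then Inl (cdom A (projr x)) else x)"
  "itgt (icat_of_cat A) k x = (if k = 0 then Inl (ccod A (projr x)) else x)"
  "iidt (icat_of_cat A) k x = (if k = 0 then Inr (cone A (projl x)) else x)"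
  "icmp (icat_of_cat A) j k y x = (if j = 0 then Inr (ccmp A (projr y) (projr x)) else x)"
  by (simp_all add: icat_of_cat_def)

lemma icat_of_cat_sto: "1 \<le> j \<Longrightarrow> sto (icat_of_cat A) j k x = x"
  by (induction k arbitrary: x) (auto simp: icat_of_cat_simps)

context split_free_cat
begin

abbreviation S :: "(nat \<Rightarrow> ocell \<Rightarrow> 'o + 'a) sset" where
  "S \<equiv> nerve (icat_of_cat A)"

lemma simp_S: "F \<in> simp S n \<longleftrightarrow> ifunctor (oriental n) (icat_of_cat A) F"
  by (simp add: nerve_def)

lemma nsimp_simp:
  assumes d: "simplex_data A n ob r"
  shows "nsimp n ob r \<in> simp S n"
  unfolding simp_S ifunctor_def oriental_cells_simps
proof (intro conjI allI ballI impI)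
  fix k
  have "nsimp n ob r k \<alpha> \<in> icells (icat_of_cat A) k" if \<alpha>: "\<alpha> \<in> ocells n k" for \<alpha>
  proof -
    obtain u v where uv: "u \<le> v" "v \<le> n" "\<alpha> 0 False = frag_of [u]" "\<alpha> 0 True = frag_of [v]"
      using ocells_ends[OF \<alpha>] .
    then show ?thesis
      using simplex_dataD(1)[OF d, of u] simplex_dataD(3)[OF d, of u v] nsimp_apply[where ob = ob and r = r, OF \<alpha> uv(3,4)]
      by (auto simp: icat_of_cat_simps)
  qed
  then show "nsimp n ob r k \<in> ocells n k \<rightarrow>\<^sub>E icells (icat_of_cat A) k" by (auto simp: nsimp_def)
next
  fix k \<alpha> assume \<alpha>: "\<alpha> \<in> ocells n (Suc k)"
  obtain u v where uv: "u \<le> v" "v \<le> n" "\<alpha> 0 False = frag_of [u]" "\<alpha> 0 True = frag_of [v]"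
    using ocells_ends[OF \<alpha>] .
  have s: "isrc (oriental n) k \<alpha> 0 False = frag_of [u]"
    "isrc (oriental n) k \<alpha> 0 True = frag_of [if k = 0 then u else v]"
    "itgt (oriental n) k \<alpha> 0 False = frag_of [if k = 0 then v else u]"
    "itgt (oriental n) k \<alpha> 0 True = frag_of [v]"
    using uv by (auto simp: oriental_simps)
  show "nsimp n ob r k (isrc (oriental n) k \<alpha>) = isrc (icat_of_cat A) k (nsimp n ob r (Suc k) \<alpha>)"
    "nsimp n ob r k (itgt (oriental n) k \<alpha>) = itgt (icat_of_cat A) k (nsimp n ob r (Suc k) \<alpha>)"
    using nsimp_apply[where ob = ob and r = r, OF ocells_src[OF \<alpha>] s(1,2)]
      nsimp_apply[where ob = ob and r = r, OF ocells_tgt[OF \<alpha>] s(3,4)]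
      nsimp_apply[where ob = ob and r = r, OF \<alpha> uv(3,4)] simplex_dataD(4,5)[OF d uv(1,2)]
    by (simp_all add: icat_of_cat_simps)
next
  fix k \<alpha> assume \<alpha>: "\<alpha> \<in> ocells n k"
  obtain u v where uv: "u \<le> v" "v \<le> n" "\<alpha> 0 False = frag_of [u]" "\<alpha> 0 True = frag_of [v]"
    using ocells_ends[OF \<alpha>] .
  have e: "k = 0 \<Longrightarrow> u = v" using ocells_top[OF \<alpha>] uv by (auto simp: frag_of_eq)
  show "nsimp n ob r (Suc k) (iidt (oriental n) k \<alpha>) = iidt (icat_of_cat A) k (nsimp n ob r k \<alpha>)"
    using nsimp_apply[where ob = ob and r = r, OF \<alpha> uv(3,4)]
      nsimp_apply[where ob = ob and r = r, OF ocells_idt[OF \<alpha>] uv(3,4)] e uv(2)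
      simplex_dataD(2)[OF d, of v] by (simp add: icat_of_cat_simps oriental_simps)
next
  fix j k \<beta> \<alpha> assume c: "composable (oriental n) j k \<beta> \<alpha>"
  then have \<alpha>: "\<alpha> \<in> ocells n k" and \<beta>: "\<beta> \<in> ocells n k" and jk: "j < k" by (auto simp: composable_def)
  obtain u v where uv: "u \<le> v" "v \<le> n" "\<alpha> 0 False = frag_of [u]" "\<alpha> 0 True = frag_of [v]"
    using ocells_ends[OF \<alpha>] .
  obtain u' v' where uv': "u' \<le> v'" "v' \<le> n" "\<beta> 0 False = frag_of [u']" "\<beta> 0 True = frag_of [v']"
    using ocells_ends[OF \<beta>] .
  have e: "if j = 0 then u' = v else u' = u \<and> v' = v"
    using c uv uv' by (auto simp: oriental_composable frag_of_eq)
  have "icmp (oriental n) j k \<beta> \<alpha> 0 False = frag_of [u]" "icmp (oriental n) j k \<beta> \<alpha> 0 True = frag_of [v']"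
    using uv uv' by (simp_all add: oriental_simps)
  from nsimp_apply[where ob = ob and r = r, OF ocells_cmp[OF c] this]
  show "nsimp n ob r k (icmp (oriental n) j k \<beta> \<alpha>) =
      icmp (icat_of_cat A) j k (nsimp n ob r k \<beta>) (nsimp n ob r k \<alpha>)"
    using nsimp_apply[where ob = ob and r = r, OF \<alpha> uv(3,4)] nsimp_apply[where ob = ob and r = r, OF \<beta> uv'(3,4)] jk e
      simplex_dataD(6)[OF d, of u v v'] uv uv' by (auto simp: icat_of_cat_simps split: if_splits)
qed

lemma nsimp_act:
  assumes \<phi>: "\<phi> \<in> delta m n"
  shows "sact S m n \<phi> (nsimp n ob r) = nsimp m (\<lambda>i. ob (\<phi> i)) (\<lambda>i j. r (\<phi> i) (\<phi> j))"
proof (intro ext)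
  fix k \<alpha>
  show "sact S m n \<phi> (nsimp n ob r) k \<alpha> = nsimp m (\<lambda>i. ob (\<phi> i)) (\<lambda>i j. r (\<phi> i) (\<phi> j)) k \<alpha>"
  proof (cases "\<alpha> \<in> ocells m k")
    case True
    obtain u v where "u \<le> v" "v \<le> m" and uv: "\<alpha> 0 False = frag_of [u]" "\<alpha> 0 True = frag_of [v]"
      using ocells_ends[OF True] .
    have o: "omap \<phi> \<alpha> \<in> ocells n k" using omap_cells[OF \<phi>, of \<alpha> k] True by simp
    have ov: "omap \<phi> \<alpha> 0 False = frag_of [\<phi> u]" "omap \<phi> \<alpha> 0 True = frag_of [\<phi> v]"
      using omap_vertex uv by blast+
    have "sact S m n \<phi> (nsimp n ob r) k \<alpha> = nsimp n ob r k (omap \<phi> \<alpha>)"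
      using True by (simp add: nerve_def fcomp_def compose_def)
    then show ?thesis
      
        using nsimp_apply[where ob = "\<lambda>i. ob (\<phi> i)" and r = "\<lambda>i j. r (\<phi> i) (\<phi> j)", OF True uv]
          nsimp_apply[where ob = ob and r = r, OF o ov] by simp
  qed (simp add: nerve_def fcomp_def compose_def nsimp_def)
qed

text \<open>The data are the values on vertices and edges. Triangles give the composition law, paths
  are composites of edges, and a cell of higher dimension has the same value as its 1-source because
  sources in \<open>A\<close> are trivial there.\<close>

lemma simplex_cases:
  assumes F: "F \<in> simp S n"
  obtains ob r where "simplex_data A n ob r" "F = nsimp n ob r"
proof -
  note f = ifunctorD[OF F[unfolded simp_S]]
  define ob where "ob i = projl (F 0 (obr 0 (\<lambda>_. i)))" for i
  define r where "r i j = projr (F 1 (edge i j))" for i j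
  have F0: "F 0 (obr 0 (\<lambda>_. i)) = Inl (ob i) \<and> ob i \<in> obj A" if "i \<le> n" for i
    using f(2)[of "obr 0 (\<lambda>_. i)" 0] obr_0_cells[OF that] by (auto simp: icat_of_cat_simps ob_def)
  have F1: "\<exists>a\<in>arr A. F 1 \<alpha> = Inr a" if "\<alpha> \<in> ocells n 1" for \<alpha>
    using f(2)[of \<alpha> 1] that by (auto simp: icat_of_cat_simps)
  have Fe: "F 1 (edge i j) = Inr (r i j) \<and> r i j \<in> arr A" if "i \<le> j" "j \<le> n" for i j
    using F1[OF edge_cells[OF that]] by (auto simp: r_def)
  have dc: "cdom A (r i j) = ob i \<and> ccod A (r i j) = ob j" if ij: "i \<le> j" "j \<le> n" for i j
  proof -
    have e: "edge i j \<in> ocells n (Suc 0)" using edge_cells[OF ij] by simp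
    have "isrc (oriental n) 0 (edge i j) = obr 0 (\<lambda>_. i)"
      by (rule ocells_0_obr[OF ocells_src[OF e]]) (simp add: oriental_simps edge_ends ij)
    moreover have "itgt (oriental n) 0 (edge i j) = obr 0 (\<lambda>_. j)"
      by (rule ocells_0_obr[OF ocells_tgt[OF e]]) (simp add: oriental_simps edge_ends ij)
    ultimately show ?thesis
      using f(3,4)[of "edge i j" 0] e F0[of i] F0[of j] Fe[OF ij] ij by (simp add: icat_of_cat_simps)
  qed
  have rid: "r i i = cone A (ob i)" if "i \<le> n" for i
    using f(5)[of "obr 0 (\<lambda>_. i)" 0] obr_0_cells[OF that] F0[OF that] Fe[of i i] that
    by (simp add: icat_of_cat_simps oriental_simps edge_refl)
  have comp: "r i l = ccmp A (r j l) (r i j)" if ijl: "i \<le> j" "j \<le> l" "l \<le> n" for i j l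
  proof -
    have jn: "j \<le> n" and il: "i \<le> l" using ijl by auto
    consider "i = j" | "j = l" | "i < j" "j < l" using ijl by linarith
    then show ?thesis
    proof cases
      case 1
      then show ?thesis using rid[OF jn] dc[OF ijl(2,3)] Fe[OF ijl(2,3)] catD(9) by metis
    next
      case 2
      then show ?thesis using rid[OF jn] dc[OF ijl(1) jn] Fe[OF ijl(1) jn] catD(10) by metis
    next
      case 3
      \<comment> \<open>The value on the triangle is both its own source and its own target, so
        \<open>F\<close> agrees on the two boundary 1-cells.\<close>
      note t = triangle_cells[OF 3 ijl(3)] and te = triangle_ends[OF 3, of n]
      have t': "triangle i j l \<in> icells (oriental n) (Suc 1)" using t by (simp add: numeral_2_eq_2)
      have "F 1 (edge i l) = F 1 (icmp (oriental n) 0 1 (edge j l) (edge i j))"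
        using f(3)[OF t'] f(4)[OF t'] unfolding te by (simp add: icat_of_cat_simps)
      also have "\<dots> = icmp (icat_of_cat A) 0 1 (F 1 (edge j l)) (F 1 (edge i j))"
      proof (rule f(6))
        show "composable (oriental n) 0 1 (edge j l) (edge i j)"
          using edge_cells[OF ijl(2,3)] edge_cells[OF ijl(1) jn] ijl
          by (simp add: oriental_composable edge_ends)
      qed
      finally show ?thesis
        using Fe[OF il ijl(3)] Fe[OF ijl(2,3)] Fe[OF ijl(1) jn] by (simp add: icat_of_cat_simps)
    qed
  qed
  have d: "simplex_data A n ob r"
    unfolding simplex_data_def using F0 rid Fe dc comp by blast
  have path: "F 1 (obr m \<phi>) = Inr (r (\<phi> 0) (\<phi> m))"
    if "strict_mono_on {..m} \<phi>" "\<phi> ` {..m} \<subseteq> {..n}" for m \<phi>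
    using that
  proof (induction m)
    case 0
    have "obr 0 \<phi> = edge (\<phi> 0) (\<phi> 0)" unfolding edge_refl by (rule obr_cong) simp
    then show ?case using Fe[of "\<phi> 0" "\<phi> 0"] 0 by simp
  next
    case (Suc m)
    have m: "strict_mono_on {..m} \<phi>" "\<phi> ` {..m} \<subseteq> {..n}"
      using Suc.prems by (auto simp: strict_mono_on_def image_subset_iff)
    have le: "\<phi> m \<le> \<phi> (Suc m)" "\<phi> (Suc m) \<le> n" "\<phi> 0 \<le> \<phi> m"
      using strict_mono_on_leD[OF Suc.prems(1), of m "Suc m"] strict_mono_on_leD[OF Suc.prems(1), of 0 m]
        Suc.prems(2) by auto
    have "composable (oriental n) 0 1 (edge (\<phi> m) (\<phi> (Suc m))) (obr m \<phi>)"
      using edge_cells[OF le(1,2)] obr_cells[OF m] le(1)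
      by (simp add: oriental_composable edge_ends) (simp add: obr_edges)
    from f(6)[OF this] show ?case
      using obr_Suc[OF Suc.prems(1), of n] Suc.IH[OF m] Fe[OF le(1,2)] comp[OF le(3,1,2)]
      by (simp add: icat_of_cat_simps)
  qed
  have "F = nsimp n ob r"
  proof (intro ext)
    fix k \<alpha>
    show "F k \<alpha> = nsimp n ob r k \<alpha>"
    proof (cases "\<alpha> \<in> ocells n k")
      case False
      then show ?thesis using f(1)[of k] by (auto simp: nsimp_def PiE_def extensional_def)
    next
      case \<alpha>: True
      obtain u v where uv: "u \<le> v" "v \<le> n" "\<alpha> 0 False = frag_of [u]" "\<alpha> 0 True = frag_of [v]"
        using ocells_ends[OF \<alpha>] .
      show ?thesis
      proof (cases "k = 0")
        case True
        then have "\<alpha> = obr 0 (\<lambda>_. u)" using ocells_0_obr \<alpha> uv(3) by blast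
        then show ?thesis using nsimp_apply[where ob = ob and r = r, OF \<alpha> uv(3,4)] F0[of u] uv True by simp
      next
        case False
        then have k: "1 \<le> k" by simp
        let ?s = "sto (oriental n) 1 k \<alpha>"
        have s: "?s \<in> ocells n 1" by (rule sto_ocells[OF \<alpha> k])
        obtain m \<phi> where m: "strict_mono_on {..m} \<phi>" "\<phi> ` {..m} \<subseteq> {..n}" "?s = obr m \<phi>"
          using ocells_1_obr[OF s] .
        have "?s 0 False = frag_of [u]" "?s 0 True = frag_of [v]"
          using uv by (simp_all add: oriental_sto[OF \<alpha> k] del: One_nat_def)
        then have e: "\<phi> 0 = u" "\<phi> m = v" unfolding m(3) by (simp_all add: obr_edges frag_of_eq)
        \<comment> \<open>Down to dimension one, taking sources in \<open>A\<close> changes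
          nothing.\<close>
        have "F k \<alpha> = sto (icat_of_cat A) 1 k (F k \<alpha>)" by (simp only: icat_of_cat_sto[OF order_refl])
        also have "\<dots> = F 1 ?s"
          using ifunctor_sto[OF strict_icat_oriental F[unfolded simp_S], of \<alpha> k 1] \<alpha> k by simp
        also have "\<dots> = Inr (r u v)" using path[OF m(1,2)] m(3) e by simp
        finally show ?thesis using nsimp_apply[where ob = ob and r = r, OF \<alpha> uv(3,4)] False by simp
      qed
    qed
  qed
  then show thesis using that d by blast
qed

end

section \<open>The isomorphism\<close>

context split_free_cat
begin

section \<open>Simplices of the nerve represented by paths\<close>

definition spath :: "'o \<times> 'a list \<Rightarrow> nat \<Rightarrow> ocell \<Rightarrow> 'o + 'a" where
  "spath z = nsimp (plen z) (pob A z) (par A z)"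

lemma spath_simp: "z \<in> paths A \<Longrightarrow> spath z \<in> simp S (plen z)"
  unfolding spath_def by (intro nsimp_simp path_simplex_data)

text \<open>The map \<sigma> need not be surjective, so a representation is far from unique, but it
  is stable under the simplicial operators with the same \<open>z\<close>; \<open>tcell\<close> does
  not see the choice, by \<open>represents_tcell\<close>.\<close>

definition represents :: "nat \<Rightarrow> (nat \<Rightarrow> ocell \<Rightarrow> 'o + 'a) \<Rightarrow> 'o \<times> 'a list \<Rightarrow> (nat \<Rightarrow> nat) \<Rightarrow> bool" where
  "represents n s z \<sigma> \<longleftrightarrow> z \<in> paths A \<and> mono_on {..n} \<sigma> \<and> \<sigma> ` {..n} \<subseteq> {..plen z} \<and>
    s = nsimp n (\<lambda>i. pob A z (\<sigma> i)) (\<lambda>i j. par A z (\<sigma> i) (\<sigma> j))"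

text \<open>The Eilenberg-Zilber decomposition: the identities among the steps are contracted one by one.\<close>

lemma simplex_data_reduction:
  assumes "simplex_data A n ob r"
  shows "\<exists>z \<sigma>. z \<in> paths A \<and> mono_on {..n} \<sigma> \<and> \<sigma> ` {..n} \<subseteq> {..plen z} \<and> \<sigma> n = plen z \<and>
    (\<forall>i\<le>n. ob i = pob A z (\<sigma> i)) \<and> (\<forall>i j. i \<le> j \<and> j \<le> n \<longrightarrow> r i j = par A z (\<sigma> i) (\<sigma> j))"
  using assms
proof (induction n)
  case 0
  note d = simplex_dataD[OF 0]
  have "(ob 0, []) \<in> paths A" using d(1)[of 0] by (simp add: paths_def)
  then show ?case
    using d(2)[of 0] by (intro exI[of _ "(ob 0, [])"] exI[of _ "\<lambda>_. 0"]) (auto simp: par_def mono_on_def)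
next
  case (Suc n)
  note d = simplex_dataD[OF Suc.prems]
  have "simplex_data A n ob r"
    using simplex_data_comp[OF Suc.prems, of n "\<lambda>i. i"] by (auto simp: mono_on_def)
  from Suc.IH[OF this] obtain z \<sigma> where z: "z \<in> paths A" and \<sigma>: "mono_on {..n} \<sigma>"
    "\<sigma> ` {..n} \<subseteq> {..plen z}" "\<sigma> n = plen z" and o: "\<And>i. i \<le> n \<Longrightarrow> ob i = pob A z (\<sigma> i)"
    and r: "\<And>i j. i \<le> j \<Longrightarrow> j \<le> n \<Longrightarrow> r i j = par A z (\<sigma> i) (\<sigma> j)" by blast
  let ?f = "r n (Suc n)"
  have f: "?f \<in> arr A" "cdom A ?f = ob n" "ccod A ?f = ob (Suc n)"
    using d(3-5)[of n "Suc n"] by auto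
  have \<sigma>m: "\<sigma> i \<le> \<sigma> j" if "i \<le> j" "j \<le> n" for i j using mono_onD[OF \<sigma>(1), of i j] that by simp
  have \<sigma>le: "\<sigma> i \<le> plen z" if "i \<le> n" for i using \<sigma>(2) that by auto
  show ?case
  proof (cases "is_identity A ?f")
    case True
    then obtain a where a: "a \<in> obj A" "?f = cone A a" unfolding is_identity_def by blast
    then have oS: "ob (Suc n) = ob n" "a = ob n" using f catD(4,5) by auto
    have rS: "r i (Suc n) = r i n" if "i \<le> n" for i
      using d(6)[of i n "Suc n"] d(3,5)[of i n] catD(10)[of "r i n"] that a(2) oS(2) by simp
    \<comment> \<open>The last step is an identity, so the new vertex repeats the position of the
      previous one.\<close>
    let ?\<sigma> = "\<lambda>i. \<sigma> (min i n)"
    have "mono_on {..Suc n} ?\<sigma>" using \<sigma>m by (intro mono_onI) (auto simp: min_def)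
    moreover have "?\<sigma> ` {..Suc n} \<subseteq> {..plen z}" using \<sigma>le by auto
    moreover have "ob i = pob A z (?\<sigma> i)" if "i \<le> Suc n" for i
      using o[of i] o[of n] oS that by (cases "i = Suc n") auto
    moreover have "r i j = par A z (?\<sigma> i) (?\<sigma> j)" if "i \<le> j" "j \<le> Suc n" for i j
    proof (cases "j = Suc n")
      case j: True
      have "r (Suc n) (Suc n) = par A z (\<sigma> n) (\<sigma> n)"
        using d(2)[of "Suc n"] oS o[of n] by (simp add: par_def)
      then show ?thesis using rS[of i] r[of i n] that j by (cases "i = Suc n") auto
    qed (use that r[of i j] in auto)
    ultimately show ?thesis using z \<sigma>(3) by (intro exI[of _ z] exI[of _ ?\<sigma>]) auto
  next
    case False
    let ?y = "(ob n, [?f])"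
    have y: "?y \<in> paths A" using f False d(1)[of "Suc n"] by (simp add: paths_def)
    \<comment> \<open>The clause \<open>\<sigma> n = plen z\<close> of the induction hypothesis
      ensures that the new arrow starts at the end of \<open>z\<close>.\<close>
    have e: "path_end A z = fst ?y" using o[of n] \<sigma>(3) pob_plen[of z] by simp
    let ?z = "pconcat z ?y"
    note p = pconcat_simplex[OF z y e]
    have z': "?z \<in> paths A" and pl: "plen ?z = Suc (plen z)" using p(1,2) by simp_all
    let ?\<sigma> = "\<lambda>i. if i \<le> n then \<sigma> i else Suc (plen z)"
    have m: "mono_on {..Suc n} ?\<sigma>"
    proof (rule mono_onI)
      fix i j assume "i \<in> {..Suc n}" "j \<in> {..Suc n}" "i \<le> j"
      then show "?\<sigma> i \<le> ?\<sigma> j" using \<sigma>m[of i j] \<sigma>le[of i] by auto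
    qed
    have im: "?\<sigma> ` {..Suc n} \<subseteq> {..plen ?z}" using \<sigma>le pl by (auto intro: le_SucI)
    have oS: "ob i = pob A ?z (?\<sigma> i)" if "i \<le> Suc n" for i
    proof (cases "i \<le> n")
      case True
      then show ?thesis using o[OF True] p(3)[OF \<sigma>le[OF True]] by simp
    next
      case False
      then have "i = Suc n" using that by simp
      then show ?thesis using p(5)[of 1] f(3) by (simp add: pob_def)
    qed
    have rS: "r i j = par A ?z (?\<sigma> i) (?\<sigma> j)" if ij: "i \<le> j" "j \<le> Suc n" for i j
    proof -
      consider "j \<le> n" | "i \<le> n" "j = Suc n" | "i = Suc n" "j = Suc n" using ij by linarith
      then show ?thesis
      proof cases
        case 1
        then show ?thesis using r[OF ij(1) 1] p(4)[OF \<sigma>m[OF ij(1) 1] \<sigma>le[OF 1]] ij by simp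
      next
        case 2
        have "par A ?z (plen z) (Suc (plen z)) = ?f" using p(6)[of 0 1] by (simp add: par_def)
        moreover have "par A ?z (\<sigma> i) (plen z) = r i n"
          using r[OF 2(1)] \<sigma>(3) p(4)[OF \<sigma>le[OF 2(1)]] by simp
        moreover have "par A ?z (\<sigma> i) (Suc (plen z)) =
            ccmp A (par A ?z (plen z) (Suc (plen z))) (par A ?z (\<sigma> i) (plen z))"
          using simplex_dataD(6)[OF path_simplex_data[OF z'], of "\<sigma> i" "plen z" "Suc (plen z)"] \<sigma>le[OF 2(1)] pl
          by simp
        ultimately show ?thesis using d(6)[of i n "Suc n"] 2 by simp
      next
        case 3
        then show ?thesis using d(2)[of "Suc n"] oS[of "Suc n"] by (simp add: par_def)
      qed
    qed
    show ?thesis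
    proof (intro exI[of _ ?z] exI[of _ ?\<sigma>] conjI allI impI)
      show "?\<sigma> (Suc n) = plen ?z" using pl by simp
      show "r i j = par A ?z (?\<sigma> i) (?\<sigma> j)" if "i \<le> j \<and> j \<le> Suc n" for i j
        using that by (intro rS) auto
    qed (fact z' m im oS)+
  qed
qed

lemma represents_ex:
  assumes "s \<in> simp S n"
  obtains z \<sigma> where "represents n s z \<sigma>"
proof -
  obtain ob r where s: "simplex_data A n ob r" "s = nsimp n ob r" using simplex_cases[OF assms] .
  obtain z \<sigma> where z: "z \<in> paths A" "mono_on {..n} \<sigma>" "\<sigma> ` {..n} \<subseteq> {..plen z}"
    and e: "\<forall>i\<le>n. ob i = pob A z (\<sigma> i)" "\<forall>i j. i \<le> j \<and> j \<le> n \<longrightarrow> r i j = par A z (\<sigma> i) (\<sigma> j)"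
    using simplex_data_reduction[OF s(1)] by blast
  have "s = nsimp n (\<lambda>i. pob A z (\<sigma> i)) (\<lambda>i j. par A z (\<sigma> i) (\<sigma> j))"
    unfolding s(2) using e by (intro nsimp_cong) auto
  then show thesis using z by (intro that[of z \<sigma>]) (simp only: represents_def simp_thms)
qed

lemma represents_act:
  assumes "represents n s z \<sigma>" and \<phi>: "\<phi> \<in> delta m n"
  shows "represents m (sact S m n \<phi> s) z (\<lambda>i. \<sigma> (\<phi> i))"
proof -
  have "mono_on {..m} \<phi>" "\<phi> ` {..m} \<subseteq> {..n}" using \<phi> by (auto simp: delta_def)
  then have "mono_on {..m} (\<lambda>i. \<sigma> (\<phi> i))" "(\<lambda>i. \<sigma> (\<phi> i)) ` {..m} \<subseteq> {..plen z}"
    using assms(1) by (auto simp: represents_def mono_on_def image_subset_iff)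
  then show ?thesis using assms(1) nsimp_act[OF \<phi>] by (simp add: represents_def)
qed

lemma represents_tcell:
  assumes r: "represents n s z \<sigma>" "represents n s z' \<sigma>'" and \<alpha>: "\<alpha> \<in> ocells n k"
  shows "tcell z k (omap \<sigma> \<alpha>) = tcell z' k (omap \<sigma>' \<alpha>)"
proof -
  have e: "nsimp n (\<lambda>i. pob A z (\<sigma> i)) (\<lambda>i j. par A z (\<sigma> i) (\<sigma> j)) =
      nsimp n (\<lambda>i. pob A z' (\<sigma>' i)) (\<lambda>i j. par A z' (\<sigma>' i) (\<sigma>' j))"
    using r by (simp add: represents_def)
  show ?thesis
    using r nsimp_data_eq[OF e] \<alpha> by (intro tcell_omap_cong[of z n \<sigma> z' \<sigma>']) (auto simp: represents_def)
qed

text \<open>The choice is harmless by \<open>represents_tcell\<close>; the restrictions provide the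
  extensionality required of functors and simplicial maps.\<close>

definition cell_map :: "nat \<Rightarrow> (nat \<Rightarrow> ocell \<Rightarrow> 'o + 'a) \<Rightarrow> nat \<Rightarrow> ocell \<Rightarrow> ('o, 'a) tcell" where
  "cell_map n = (\<lambda>s\<in>simp S n. \<lambda>k. \<lambda>\<alpha>\<in>ocells n k. SOME X.
     \<exists>z \<sigma>. represents n s z \<sigma> \<and> X = tcell z k (omap \<sigma> \<alpha>))"

lemma represents_simp: "represents n s z \<sigma> \<Longrightarrow> s \<in> simp S n"
  using nsimp_simp[OF simplex_data_comp[OF path_simplex_data]] by (auto simp: represents_def)

lemma cell_map_eq:
  assumes r: "represents n s z \<sigma>" and \<alpha>: "\<alpha> \<in> ocells n k"
  shows "cell_map n s k \<alpha> = tcell z k (omap \<sigma> \<alpha>)"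
proof -
  have "(SOME X. \<exists>z \<sigma>. represents n s z \<sigma> \<and> X = tcell z k (omap \<sigma> \<alpha>)) = tcell z k (omap \<sigma> \<alpha>)"
    using r represents_tcell[OF _ r \<alpha>] by (intro some_equality) blast+
  then show ?thesis using represents_simp[OF r] \<alpha> by (simp add: cell_map_def)
qed

text \<open>With \<open>s\<close> represented by \<open>z\<close> and \<sigma>, the map is the
  composite of the functor induced by \<sigma> and of \<open>tfun z\<close>. Naturality holds
  because the restriction of \<open>s\<close> along \<phi> is represented over the same
  path.\<close>

lemma smap_cell_map: "smap S (nerve (tilde A)) cell_map"
  unfolding smap_def
proof (intro conjI allI ballI)
  fix n
  have "ifunctor (oriental n) (tilde A) (cell_map n s)" if s: "s \<in> simp S n" for s
  proof -
    obtain z \<sigma> where r: "represents n s z \<sigma>" using represents_ex[OF s] .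
    then have z: "z \<in> paths A" and \<sigma>: "mono_on {..n} \<sigma>" "\<sigma> ` {..n} \<subseteq> {..plen z}"
      by (auto simp: represents_def)
    note f = ifunctor_fcomp[OF strict_icat_oriental ifunctor_omap[OF delta_restrict[OF \<sigma>]] ifunctor_tfun[OF z]]
    have "fcomp (oriental n) (tfun z) (\<lambda>k. \<lambda>x\<in>icells (oriental n) k. omap (restrict \<sigma> {..n}) x) = cell_map n s"
    proof (intro ext)
      fix k \<alpha>
      show "fcomp (oriental n) (tfun z) (\<lambda>k. \<lambda>x\<in>icells (oriental n) k. omap (restrict \<sigma> {..n}) x) k \<alpha> =
          cell_map n s k \<alpha>"
      proof (cases "\<alpha> \<in> ocells n k")
        case True
        then show ?thesis
          using cell_map_eq[OF r True] tfun_apply[OF omap_ocells[OF \<sigma> True]]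
          by (simp add: fcomp_def compose_def omap_restrict)
      next
        case False
        then show ?thesis using s by (simp add: fcomp_def compose_def cell_map_def)
      qed
    qed
    then show ?thesis using f by simp
  qed
  then show "cell_map n \<in> simp S n \<rightarrow>\<^sub>E simp (nerve (tilde A)) n"
    by (intro PiE_I) (simp add: nerve_def, simp add: cell_map_def)
next
  fix m n \<phi> s assume \<phi>: "\<phi> \<in> delta m n" and s: "s \<in> simp S n"
  obtain z \<sigma> where r: "represents n s z \<sigma>" using represents_ex[OF s] .
  note r' = represents_act[OF r \<phi>]
  show "cell_map m (sact S m n \<phi> s) = sact (nerve (tilde A)) m n \<phi> (cell_map n s)"
  proof (intro ext)
    fix k \<alpha>
    show "cell_map m (sact S m n \<phi> s) k \<alpha> = sact (nerve (tilde A)) m n \<phi> (cell_map n s) k \<alpha>"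
    proof (cases "\<alpha> \<in> ocells m k")
      case True
      have o: "omap \<phi> \<alpha> \<in> ocells n k" using omap_cells[OF \<phi>, of \<alpha> k] True by simp
      show ?thesis
        using cell_map_eq[OF r' True] cell_map_eq[OF r o] True
        by (simp add: nerve_def fcomp_def compose_def omap_omap)
    next
      case False
      then show ?thesis using represents_simp[OF r'] by (simp add: nerve_def fcomp_def compose_def cell_map_def)
    qed
  qed
qed

section \<open>The functor from \<open>tilde A\<close> to \<open>c_inf\<close> and its
  inverse\<close>

abbreviation unit_cell :: "'o \<times> 'a list \<Rightarrow> nat \<Rightarrow> ocell \<Rightarrow> (nat \<Rightarrow> ocell \<Rightarrow> 'o + 'a) cterm set" where
  "unit_cell z \<equiv> c_unit S (plen z) (spath z)"

text \<open>This is the relation \<open>gen_act\<close> of the presentation, applied to \<sigma> and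
  the simplex of \<open>z\<close>.\<close>

lemma unit_cell_represents:
  assumes r: "represents n s z \<sigma>" and \<alpha>: "\<alpha> \<in> ocells n k"
  shows "c_unit S n s k \<alpha> = unit_cell z k (omap \<sigma> \<alpha>)"
proof -
  have z: "z \<in> paths A" and \<sigma>: "mono_on {..n} \<sigma>" "\<sigma> ` {..n} \<subseteq> {..plen z}"
    and s: "s = nsimp n (\<lambda>i. pob A z (\<sigma> i)) (\<lambda>i j. par A z (\<sigma> i) (\<sigma> j))"
    using r by (auto simp: represents_def)
  note d = delta_restrict[OF \<sigma>]
  have "sact S n (plen z) (restrict \<sigma> {..n}) (spath z) = s"
    unfolding spath_def nsimp_act[OF d] s by (rule nsimp_cong) auto
  then have "ceq S k (CGen k n s \<alpha>) (CGen k (plen z) (spath z) (omap (restrict \<sigma> {..n}) \<alpha>))"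
    using gen_act[OF d spath_simp[OF z], of \<alpha> k] \<alpha> by simp
  then have "ccls S k (CGen k n s \<alpha>) = ccls S k (CGen k (plen z) (spath z) (omap \<sigma> \<alpha>))"
    unfolding omap_restrict[OF \<alpha>] by (rule ccls_eqI)
  then show ?thesis
    using c_unit_apply[OF represents_simp[OF r], of \<alpha> k] c_unit_apply[OF spath_simp[OF z], of "omap \<sigma> \<alpha>" k]
      omap_ocells[OF \<sigma> \<alpha>] \<alpha> by simp
qed

lemma unit_cell_prestr:
  assumes z: "z \<in> paths A" and W: "W \<subseteq> {..plen z}" "W \<noteq> {}" and \<alpha>: "\<alpha> \<in> ocells (card W - 1) k"
  shows "unit_cell (prestr z W) k \<alpha> = unit_cell z k (omap (enum W) \<alpha>)"
proof (rule unit_cell_represents)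
  have fin: "finite W" using W(1) finite_subset by blast
  obtain m where m: "card W = Suc m" "strict_mono_on {..m} (enum W)" "enum W ` {..m} = W"
    using enumE[OF fin W(2)] .
  have "spath (prestr z W) = nsimp m (\<lambda>i. pob A z (enum W i)) (\<lambda>i j. par A z (enum W i) (enum W j))"
    unfolding spath_def plen_prestr m(1) diff_Suc_1
    using prestr_path(2,3)[OF z W] m(1) by (intro nsimp_cong) auto
  then show "represents (plen (prestr z W)) (spath (prestr z W)) z (enum W)"
    using z W(1) m strict_mono_on_imp_mono_on[OF m(2)] by (simp add: represents_def)
qed (use \<alpha> in simp)

text \<open>Every cell is sent to the generator given by its canonical lift, the one constructed in
  \<open>tcell_lift\<close>.\<close>

definition gen_cell :: "nat \<Rightarrow> ('o, 'a) tcell \<Rightarrow> (nat \<Rightarrow> ocell \<Rightarrow> 'o + 'a) cterm set" where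
  "gen_cell k = (\<lambda>X\<in>tilde_cells A k. case X of
     TObj a \<Rightarrow> unit_cell (a, []) k (obr 0 (\<lambda>_. 0))
   | TOne y \<Rightarrow> unit_cell y k (obr (plen y) id)
   | THi x y \<phi> \<alpha> \<Rightarrow> unit_cell y k \<alpha>)"

text \<open>Any other lift gives the same generator: \<alpha> is the image under \<open>enum\<close>
  of its relabelling on the face spanned by its vertices, and \<open>unit_cell_prestr\<close> moves
  generators along faces. Functoriality of \<open>gen_cell\<close> can then be checked on
  lifts.\<close>

lemma gen_cell_tcell:
  assumes z: "z \<in> paths A" and \<alpha>: "\<alpha> \<in> ocells (plen z) k"
  shows "gen_cell k (tcell z k \<alpha>) = unit_cell z k \<alpha>"
proof -
  let ?W = "supp \<alpha>"
  have W: "?W \<subseteq> {..plen z}" "?W \<noteq> {}" "finite ?W" using supp_subset[OF \<alpha>] \<alpha> by auto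
  note rp = rank_props[OF W(3), of "plen z"]
  have o: "omap (rank ?W) \<alpha> \<in> ocells (card ?W - 1) k" by (rule omap_ocells[OF rp \<alpha>])
  have "omap (enum ?W) (omap (rank ?W) \<alpha>) = \<alpha>"
    unfolding omap_omap using enum_rank[OF W(3)] by (intro omap_ident[OF \<alpha>])
  then have main: "unit_cell (prestr z ?W) k (omap (rank ?W) \<alpha>) = unit_cell z k \<alpha>"
    using unit_cell_prestr[OF z W(1,2) o] by simp
  have sr: "supp (omap (rank ?W) \<alpha>) = {..card ?W - 1}"
    using supp_omap(1)[OF rp \<alpha>] rank_image_self[OF W(3,2)] by simp
  note tc = tcell_cells[OF z \<alpha>]
  consider "k = 0" | "k = 1" | "k \<ge> 2" by linarith
  then show ?thesis
  proof cases
    case 1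
    obtain u v where uv: "u \<le> v" "v \<le> plen z" "\<alpha> 0 False = frag_of [u]" "\<alpha> 0 True = frag_of [v]"
      using ocells_ends[OF \<alpha>] .
    have \<alpha>u: "\<alpha> = obr 0 (\<lambda>_. u)" using ocells_0_obr \<alpha> uv(3) 1 by blast
    have "?W = {u}" unfolding \<alpha>u supp_obr by simp
    then have p: "prestr z ?W = (pob A z u, [])" "rank ?W u = 0"
      using enum_0[of "{u}"] rank_Min[of "{u}"] by (simp_all add: prestr_def steps_def)
    have "omap (rank ?W) \<alpha> = obr 0 (\<lambda>_. 0)"
      by (rule ocells_0_obr[where n = "card ?W - 1"])
        (use o 1 omap_vertex[where u = u and \<alpha> = \<alpha> and \<phi> = "rank ?W" and \<epsilon> = False]
          uv(3) p(2) in simp_all)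
    then show ?thesis using main tc 1 p(1) by (simp add: gen_cell_def tcell_def)
  next
    case 2
    have "omap (rank ?W) \<alpha> = obr (card ?W - 1) id"
      using o 2 sr by (intro ocells_1_eqI[of _ "card ?W - 1" _ "card ?W - 1"] obr_cells)
        (auto simp: strict_mono_on_def)
    then show ?thesis using main tc 2 by (simp add: gen_cell_def tcell_def)
  next
    case 3
    then show ?thesis using main tc by (simp add: gen_cell_def tcell_def)
  qed
qed

lemma ifunctor_gen_cell: "ifunctor (tilde A) (c_inf S) gen_cell"
  unfolding ifunctor_def tilde_simps(1)
proof (intro conjI allI ballI impI)
  fix k
  have "gen_cell k X \<in> icells (c_inf S) k" if X: "X \<in> tilde_cells A k" for X
  proof -
    obtain z \<alpha> where z: "z \<in> paths A" and \<alpha>: "\<alpha> \<in> ocells (plen z) k" "X = tcell z k \<alpha>"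
      using tcell_lift[OF X] by metis
    then show ?thesis
      using gen_cell_tcell[OF z \<alpha>(1)] ifunctorD(2)[OF ifunctor_c_unit[OF spath_simp[OF z]], of \<alpha> k] by simp
  qed
  then show "gen_cell k \<in> tilde_cells A k \<rightarrow>\<^sub>E icells (c_inf S) k" by (intro PiE_I) (simp_all add: gen_cell_def)
next
  fix k X assume X: "X \<in> tilde_cells A (Suc k)"
  obtain z \<alpha> where z: "z \<in> paths A" and \<alpha>: "\<alpha> \<in> ocells (plen z) (Suc k)" "X = tcell z (Suc k) \<alpha>"
    using tcell_lift[OF X] by metis
  note f = ifunctorD[OF ifunctor_c_unit[OF spath_simp[OF z]]]
  show "gen_cell k (isrc (tilde A) k X) = isrc (c_inf S) k (gen_cell (Suc k) X)"
    "gen_cell k (itgt (tilde A) k X) = itgt (c_inf S) k (gen_cell (Suc k) X)"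
    using gen_cell_tcell[OF z \<alpha>(1)] gen_cell_tcell[OF z ocells_src[OF \<alpha>(1)]]
      gen_cell_tcell[OF z ocells_tgt[OF \<alpha>(1)]] tcell_src[OF z \<alpha>(1)] tcell_tgt[OF z \<alpha>(1)]
      f(3,4)[of \<alpha> k] \<alpha> by simp_all
next
  fix k X assume X: "X \<in> tilde_cells A k"
  obtain z \<alpha> where z: "z \<in> paths A" and \<alpha>: "\<alpha> \<in> ocells (plen z) k" "X = tcell z k \<alpha>"
    using tcell_lift[OF X] by metis
  show "gen_cell (Suc k) (iidt (tilde A) k X) = iidt (c_inf S) k (gen_cell k X)"
    using gen_cell_tcell[OF z \<alpha>(1)] gen_cell_tcell[OF z ocells_idt[OF \<alpha>(1)]] tcell_idt[OF z \<alpha>(1)]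
      ifunctorD(5)[OF ifunctor_c_unit[OF spath_simp[OF z]], of \<alpha> k] \<alpha> by (simp add: oriental_simps)
next
  fix j k Y X assume c: "composable (tilde A) j k Y X"
  obtain z \<beta> \<alpha> where z: "z \<in> paths A" and ba: "composable (oriental (plen z)) j k \<beta> \<alpha>"
    "Y = tcell z k \<beta>" "X = tcell z k \<alpha>" using tcell_lift2[OF c] by metis
  have o: "\<alpha> \<in> ocells (plen z) k" "\<beta> \<in> ocells (plen z) k" using ba by (auto simp: composable_def)
  show "gen_cell k (icmp (tilde A) j k Y X) = icmp (c_inf S) j k (gen_cell k Y) (gen_cell k X)"
    using gen_cell_tcell[OF z o(1)] gen_cell_tcell[OF z o(2)] gen_cell_tcell[OF z ocells_cmp[OF ba(1)]]
      tcell_cmp[OF z ba(1)] ifunctorD(6)[OF ifunctor_c_unit[OF spath_simp[OF z]] ba(1)] ba(2,3) by simp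
qed

lemma represents_spath: "z \<in> paths A \<Longrightarrow> represents (plen z) (spath z) z (\<lambda>i. i)"
  by (auto simp: represents_def spath_def mono_on_def)

theorem icat_iso_tilde: "icat_iso (tilde A) (c_inf S)"
proof -
  obtain G where G: "ifunctor (c_inf S) (tilde A) G"
    "\<And>n s. s \<in> simp S n \<Longrightarrow> fcomp (oriental n) G (c_unit S n s) = cell_map n s"
    using c_inf_universal[OF strict_icat_tilde smap_cell_map] by blast
  have Gu: "G k (c_unit S n s k \<alpha>) = cell_map n s k \<alpha>" if "s \<in> simp S n" "\<alpha> \<in> ocells n k" for n s k \<alpha>
    using fun_cong[OF fun_cong[OF G(2)[OF that(1)]], of k \<alpha>] that(2) by (simp add: fcomp_def compose_def)
  have GF: "G k (gen_cell k X) = X" if X: "X \<in> tilde_cells A k" for k X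
  proof -
    obtain z \<alpha> where z: "z \<in> paths A" and \<alpha>: "\<alpha> \<in> ocells (plen z) k" "X = tcell z k \<alpha>"
      using tcell_lift[OF X] by metis
    show ?thesis
      using gen_cell_tcell[OF z \<alpha>(1)] Gu[OF spath_simp[OF z] \<alpha>(1)] cell_map_eq[OF represents_spath[OF z] \<alpha>(1)]
        omap_ident[OF \<alpha>(1)] \<alpha>(2) by simp
  qed
  \<comment> \<open>The identity functor, made extensional so that it can be compared with the
    composite as a HOL function.\<close>
  define I where "I = (\<lambda>k. \<lambda>C\<in>icells (c_inf S) k. C)"
  have SC: "strict_icat (c_inf S)" by (rule strict_icat_c_inf)
  have I: "ifunctor (c_inf S) (c_inf S) I"
    using strict_icatD[OF SC] by (auto simp: ifunctor_def I_def composable_def)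
  have Iu: "fcomp (oriental n) I (c_unit S n s) = c_unit S n s" if s: "s \<in> simp S n" for n s
    using ifunctorD(1,2)[OF ifunctor_c_unit[OF s]]
    by (intro ext) (auto simp: fcomp_def compose_def I_def PiE_def extensional_def)
  note H = ifunctor_fcomp[OF SC G(1) ifunctor_gen_cell]
  \<comment> \<open>It suffices to compare with the identity on generators: a generator for
    \<open>s\<close> is represented over a path, where \<open>G\<close> gives a \<open>tcell\<close>
    and \<open>gen_cell\<close> returns the generator.\<close>
  have Hu: "fcomp (oriental n) (fcomp (c_inf S) gen_cell G) (c_unit S n s) = c_unit S n s"
    if s: "s \<in> simp S n" for n s
  proof (intro ext)
    fix k \<alpha>
    show "fcomp (oriental n) (fcomp (c_inf S) gen_cell G) (c_unit S n s) k \<alpha> = c_unit S n s k \<alpha>"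
    proof (cases "\<alpha> \<in> ocells n k")
      case True
      obtain z \<sigma> where r: "represents n s z \<sigma>" using represents_ex[OF s] .
      then have z: "z \<in> paths A" and \<sigma>: "mono_on {..n} \<sigma>" "\<sigma> ` {..n} \<subseteq> {..plen z}"
        by (auto simp: represents_def)
      have "gen_cell k (G k (c_unit S n s k \<alpha>)) = c_unit S n s k \<alpha>"
        using Gu[OF s True] cell_map_eq[OF r True] gen_cell_tcell[OF z omap_ocells[OF \<sigma> True]]
          unit_cell_represents[OF r True] by simp
      then show ?thesis
        using True ifunctorD(2)[OF ifunctor_c_unit[OF s], of \<alpha> k] by (simp add: fcomp_def compose_def)
    next
      case False
      then show ?thesis using s by (simp add: fcomp_def compose_def c_unit_def)
    qed
  qed
  have "\<exists>!F. ifunctor (c_inf S) (c_inf S) F \<and>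
      (\<forall>n. \<forall>s\<in>simp S n. fcomp (oriental n) F (c_unit S n s) = c_unit S n s)"
    by (rule c_inf_universal[OF SC smap_c_unit[OF is_sset_nerve]])
  then have HI: "fcomp (c_inf S) gen_cell G = I" using H Hu I Iu by blast
  have FG: "gen_cell k (G k C) = C" if "C \<in> icells (c_inf S) k" for k C
    using fun_cong[OF fun_cong[OF HI], of k C] that by (simp add: fcomp_def compose_def I_def)
  have "bij_betw (gen_cell k) (tilde_cells A k) (icells (c_inf S) k)" for k
    using GF FG ifunctorD(2)[OF ifunctor_gen_cell, of _ k] ifunctorD(2)[OF G(1), of _ k]
    by (intro bij_betw_byWitness[where f' = "G k"]) auto
  then show ?thesis
    unfolding icat_iso_def tilde_simps(1) using strict_icat_tilde SC ifunctor_gen_cell by blast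
qed

end

theorem theorem5p0p17:
  fixes A :: "('o, 'a) cat"
  assumes "category A" and "split_free A"
  shows "icat_iso (tilde A) (c_inf (nerve (icat_of_cat A)))"
proof -
  interpret split_free_cat A by standard (fact assms)+
  show ?thesis by (rule icat_iso_tilde)
qed

end
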